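(* Let $\mathbb F$ be an algebraically closed field, $G$ a Cayley bigraph on a finite group $\mathcal G$, $L$ a subgraph of $G$, $1\le k\le\rho(L)$, and let $L'$ be obtained from $L$ by removing a single edge. Then the generic maximum excess of $(L',G,\mathcal G,\mathbb F,k-1)$ is at least the generic maximum excess of $(L,G,\mathcal G,\mathbb F,k)$.
   Context: Cayley bigraph on $\mathcal G$ with generators $g_1,g_2$: $V_G=\mathcal G$, $E_G=\mathcal G\times\{1,2\}$, edge $(g,i)$ has tail $g$, head $g_ig$. For $x\in\mathcal G$ and a subgraph $L$, $Lx$ is the image of $L$ under $g\mapsto gx$, $(g,i)\mapsto(gx,i)$; for $P\in V_G\sqcup E_G$, $\mathcal G_L(P)=\{x\in\mathcal G:P\in Lx\}$. For $k\ge0$ and $M\in\mathbb F^{k\times\mathcal G}$ with columns $m^x$, $M$ is $L$-surjective if for every $P$ the columns $m^x$, $x\in\mathcal G_L(P)$, span $\mathbb F^k$; then $\mathcal K_M(L)$ is the sheaf on $G$ with $\mathcal K_M(L)(P)=\{a\in\mathbb F^{\mathcal G}:a_x=0\ \forall x\notin\mathcal G_L(P),\ \sum_xa_xm^x=0\}$ and restriction maps the inclusions. The generic maximum excess of $(L,G,\mathcal G,\mathbb F,k)$ (for $k\le\rho(L)$) is the largest integer $m$ such that the set of $L$-surjective $M\in\mathbb F^{k\times\mathcal G}$ with ${\rm m.e.}(\mathcal K_M(L))\ge m$ is Zariski dense in $\mathbb F^{k\times\mathcal G}$. Maximum excess of a sheaf $\mathcal F$: with $\mathcal F(V)=\bigoplus_v\mathcal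 F(v)$, $d_h,d_t$ sending $\mathcal F(e)$ into $\mathcal F(he)$, $\mathcal F(te)$ by the restriction maps, $\Gamma_{\rm ht}(U)=\bigoplus_e\{w\in\mathcal F(e):d_hw,d_tw\in U\}$ and ${\rm m.e.}(\mathcal F)=\max_{U\subset\mathcal F(V)}(\dim\Gamma_{\rm ht}(U)-\dim U)$. $\rho(L)=\sum_X\max(0,|E_X|-|V_X|)$ over connected components $X$ of $L$ as an undirected graph (note $\rho(L')\ge\rho(L)-1$). *)

theory Defs
  imports "HOL-Algebra.Group" "HOL-Library.Function_Algebras"
          "HOL-Computational_Algebra.Polynomial"
begin

definition alg_closed :: "'f::field itself \<Rightarrow> bool" where
  "alg_closed _ \<longleftrightarrow> (\<forall>p::'f poly. degree p > 0 \<longrightarrow> (\<exists>x. poly p x = 0))"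

definition fscale :: "'f::field \<Rightarrow> ('a \<Rightarrow> 'f) \<Rightarrow> ('a \<Rightarrow> 'f)" where
  "fscale c f = (\<lambda>x. c * f x)"

lemma vector_space_fscale: "vector_space (fscale :: 'f::field \<Rightarrow> ('a \<Rightarrow> 'f) \<Rightarrow> _)"
  by unfold_locales (auto simp: fscale_def algebra_simps)

definition fsubspace :: "('a \<Rightarrow> 'f::field) set \<Rightarrow> bool" where
  "fsubspace U = module.subspace (fscale :: 'f \<Rightarrow> ('a \<Rightarrow> 'f) \<Rightarrow> _) U"

definition fdim :: "('a \<Rightarrow> 'f::field) set \<Rightarrow> nat" where
  "fdim U = vector_space.dim (fscale :: 'f \<Rightarrow> ('a \<Rightarrow> 'f) \<Rightarrow> _) U"

datatype 'g cell = VCell 'g | ECell 'g nat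

definition gen :: "'g \<Rightarrow> 'g \<Rightarrow> nat \<Rightarrow> 'g" where
  "gen g1 g2 i = (if i = 1 then g1 else g2)"

definition cay_verts :: "('g, 'b) monoid_scheme \<Rightarrow> 'g set" where
  "cay_verts Gr = carrier Gr"

definition cay_edges :: "('g, 'b) monoid_scheme \<Rightarrow> ('g \<times> nat) set" where
  "cay_edges Gr = carrier Gr \<times> {1, 2}"

definition edge_tail :: "'g \<times> nat \<Rightarrow> 'g" where
  "edge_tail e = fst e"

definition edge_head :: "('g, 'b) monoid_scheme \<Rightarrow> 'g \<Rightarrow> 'g \<Rightarrow> 'g \<times> nat \<Rightarrow> 'g" where
  "edge_head Gr g1 g2 e = gen g1 g2 (snd e) \<otimes>\<^bsub>Gr\<^esub> fst e"

definition cay_cells :: "('g, 'b) monoid_scheme \<Rightarrow> 'g cell set" where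
  "cay_cells Gr = VCell ` cay_verts Gr \<union> (\<lambda>(g, i). ECell g i) ` cay_edges Gr"

definition is_subgraph :: "('g, 'b) monoid_scheme \<Rightarrow> 'g \<Rightarrow> 'g \<Rightarrow> 'g set \<times> ('g \<times> nat) set \<Rightarrow> bool" where
  "is_subgraph Gr g1 g2 L \<longleftrightarrow> fst L \<subseteq> cay_verts Gr \<and> snd L \<subseteq> cay_edges Gr \<and>
     (\<forall>e \<in> snd L. edge_tail e \<in> fst L \<and> edge_head Gr g1 g2 e \<in> fst L)"

definition translate :: "('g, 'b) monoid_scheme \<Rightarrow> 'g set \<times> ('g \<times> nat) set \<Rightarrow> 'g
    \<Rightarrow> 'g set \<times> ('g \<times> nat) set" where
  "translate Gr L x = ((\<lambda>g. g \<otimes>\<^bsub>Gr\<^esub> x) ` fst L, (\<lambda>(g, i). (g \<otimes>\<^bsub>Gr\<^esub> x, i)) ` snd L)"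

definition cell_in :: "'g cell \<Rightarrow> 'g set \<times> ('g \<times> nat) set \<Rightarrow> bool" where
  "cell_in P L = (case P of VCell v \<Rightarrow> v \<in> fst L | ECell g i \<Rightarrow> (g, i) \<in> snd L)"

definition Gset :: "('g, 'b) monoid_scheme \<Rightarrow> 'g set \<times> ('g \<times> nat) set \<Rightarrow> 'g cell \<Rightarrow> 'g set" where
  "Gset Gr L P = {x \<in> carrier Gr. cell_in P (translate Gr L x)}"

definition und_adj :: "('g, 'b) monoid_scheme \<Rightarrow> 'g \<Rightarrow> 'g \<Rightarrow> 'g set \<times> ('g \<times> nat) set \<Rightarrow> ('g \<times> 'g) set" where
  "und_adj Gr g1 g2 L = {(u, v). \<exists>e \<in> snd L.
     (u = edge_tail e \<and> v = edge_head Gr g1 g2 e) \<or> (v = edge_tail e \<and> u = edge_head Gr g1 g2 e)}"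

definition conn_rel :: "('g, 'b) monoid_scheme \<Rightarrow> 'g \<Rightarrow> 'g \<Rightarrow> 'g set \<times> ('g \<times> nat) set \<Rightarrow> ('g \<times> 'g) set" where
  "conn_rel Gr g1 g2 L = (und_adj Gr g1 g2 L)\<^sup>* \<inter> (fst L \<times> fst L)"

definition rho :: "('g, 'b) monoid_scheme \<Rightarrow> 'g \<Rightarrow> 'g \<Rightarrow> 'g set \<times> ('g \<times> nat) set \<Rightarrow> int" where
  "rho Gr g1 g2 L = (\<Sum>C \<in> fst L // conn_rel Gr g1 g2 L.
      max 0 (int (card {e \<in> snd L. edge_tail e \<in> C}) - int (card C)))"

text \<open>A sheaf F: stalks F(P) subspaces of ('g => 'f) (vectors in F^G), restriction maps
  resh e : F(e) -> F(he), rest e : F(e) -> F(te). F(V) is realised as functions on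
  V_G x G, F(E) as functions on E_G x G.\<close>

definition vemb :: "'g \<Rightarrow> ('g \<Rightarrow> 'f::zero) \<Rightarrow> ('g \<times> 'g \<Rightarrow> 'f)" where
  "vemb v w = (\<lambda>(u, x). if u = v then w x else 0)"

definition FV :: "('g, 'b) monoid_scheme \<Rightarrow> ('g cell \<Rightarrow> ('g \<Rightarrow> 'f::zero) set) \<Rightarrow> ('g \<times> 'g \<Rightarrow> 'f) set" where
  "FV Gr F = {f. (\<forall>v x. v \<notin> cay_verts Gr \<longrightarrow> f (v, x) = 0) \<and>
                 (\<forall>v \<in> cay_verts Gr. (\<lambda>x. f (v, x)) \<in> F (VCell v))}"

definition Gamma_ht :: "('g, 'b) monoid_scheme \<Rightarrow> 'g \<Rightarrow> 'g \<Rightarrow> ('g cell \<Rightarrow> ('g \<Rightarrow> 'f::zero) set)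
    \<Rightarrow> ('g \<times> nat \<Rightarrow> ('g \<Rightarrow> 'f) \<Rightarrow> ('g \<Rightarrow> 'f)) \<Rightarrow> ('g \<times> nat \<Rightarrow> ('g \<Rightarrow> 'f) \<Rightarrow> ('g \<Rightarrow> 'f))
    \<Rightarrow> ('g \<times> 'g \<Rightarrow> 'f) set \<Rightarrow> (('g \<times> nat) \<times> 'g \<Rightarrow> 'f) set" where
  "Gamma_ht Gr g1 g2 F resh rest U = {\<phi>.
     (\<forall>e x. e \<notin> cay_edges Gr \<longrightarrow> \<phi> (e, x) = 0) \<and>
     (\<forall>e \<in> cay_edges Gr. (\<lambda>x. \<phi> (e, x)) \<in> F (ECell (fst e) (snd e)) \<and>
        vemb (edge_head Gr g1 g2 e) (resh e (\<lambda>x. \<phi> (e, x))) \<in> U \<and>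
        vemb (edge_tail e) (rest e (\<lambda>x. \<phi> (e, x))) \<in> U)}"

definition max_excess :: "('g, 'b) monoid_scheme \<Rightarrow> 'g \<Rightarrow> 'g \<Rightarrow> ('g cell \<Rightarrow> ('g \<Rightarrow> 'f::field) set)
    \<Rightarrow> ('g \<times> nat \<Rightarrow> ('g \<Rightarrow> 'f) \<Rightarrow> ('g \<Rightarrow> 'f)) \<Rightarrow> ('g \<times> nat \<Rightarrow> ('g \<Rightarrow> 'f) \<Rightarrow> ('g \<Rightarrow> 'f)) \<Rightarrow> int" where
  "max_excess Gr g1 g2 F resh rest = Max {int (fdim (Gamma_ht Gr g1 g2 F resh rest U)) - int (fdim U) | U.
      fsubspace U \<and> U \<subseteq> FV Gr F}"

text \<open>A matrix M in F^{k x G} is represented as M :: nat => 'g => 'f, entries M i x for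
  i < k and x in the group; column m^x = (M i x)_i.\<close>

definition mat_space :: "('g, 'b) monoid_scheme \<Rightarrow> nat \<Rightarrow> (nat \<Rightarrow> 'g \<Rightarrow> 'f::zero) set" where
  "mat_space Gr k = {M. \<forall>i x. (k \<le> i \<or> x \<notin> carrier Gr) \<longrightarrow> M i x = 0}"

definition L_surjective :: "('g, 'b) monoid_scheme \<Rightarrow> nat \<Rightarrow> 'g set \<times> ('g \<times> nat) set
    \<Rightarrow> (nat \<Rightarrow> 'g \<Rightarrow> 'f::field) \<Rightarrow> bool" where
  "L_surjective Gr k L M \<longleftrightarrow> (\<forall>P \<in> cay_cells Gr. \<forall>v :: nat \<Rightarrow> 'f. \<exists>a :: 'g \<Rightarrow> 'f.
      (\<forall>x. x \<notin> Gset Gr L P \<longrightarrow> a x = 0) \<and>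
      (\<forall>i < k. (\<Sum>x \<in> carrier Gr. a x * M i x) = v i))"

definition Ksheaf :: "('g, 'b) monoid_scheme \<Rightarrow> nat \<Rightarrow> (nat \<Rightarrow> 'g \<Rightarrow> 'f::field)
    \<Rightarrow> 'g set \<times> ('g \<times> nat) set \<Rightarrow> 'g cell \<Rightarrow> ('g \<Rightarrow> 'f) set" where
  "Ksheaf Gr k M L P = {a. (\<forall>x. x \<notin> Gset Gr L P \<longrightarrow> a x = 0) \<and>
      (\<forall>i < k. (\<Sum>x \<in> carrier Gr. a x * M i x) = 0)}"

definition Kmax_excess :: "('g, 'b) monoid_scheme \<Rightarrow> 'g \<Rightarrow> 'g \<Rightarrow> nat \<Rightarrow> (nat \<Rightarrow> 'g \<Rightarrow> 'f::field)
    \<Rightarrow> 'g set \<times> ('g \<times> nat) set \<Rightarrow> int" where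
  "Kmax_excess Gr g1 g2 k M L = max_excess Gr g1 g2 (Ksheaf Gr k M L) (\<lambda>e w. w) (\<lambda>e w. w)"

inductive polyfun :: "('g, 'b) monoid_scheme \<Rightarrow> nat \<Rightarrow> ((nat \<Rightarrow> 'g \<Rightarrow> 'f::field) \<Rightarrow> 'f) \<Rightarrow> bool"
  for Gr k where
  pf_const: "polyfun Gr k (\<lambda>M. c)"
| pf_coord: "i < k \<Longrightarrow> x \<in> carrier Gr \<Longrightarrow> polyfun Gr k (\<lambda>M. M i x)"
| pf_add: "polyfun Gr k p \<Longrightarrow> polyfun Gr k q \<Longrightarrow> polyfun Gr k (\<lambda>M. p M + q M)"
| pf_mult: "polyfun Gr k p \<Longrightarrow> polyfun Gr k q \<Longrightarrow> polyfun Gr k (\<lambda>M. p M * q M)"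

definition zariski_dense :: "('g, 'b) monoid_scheme \<Rightarrow> nat \<Rightarrow> (nat \<Rightarrow> 'g \<Rightarrow> 'f::field) set \<Rightarrow> bool" where
  "zariski_dense Gr k S \<longleftrightarrow> S \<subseteq> mat_space Gr k \<and>
     (\<forall>p. polyfun Gr k p \<longrightarrow> (\<forall>M \<in> S. p M = 0) \<longrightarrow> (\<forall>M \<in> mat_space Gr k. p M = 0))"

definition generic_max_excess :: "('g, 'b) monoid_scheme \<Rightarrow> 'g \<Rightarrow> 'g \<Rightarrow> 'g set \<times> ('g \<times> nat) set
    \<Rightarrow> 'f::field itself \<Rightarrow> nat \<Rightarrow> int" where
  "generic_max_excess Gr g1 g2 L _ k = (GREATEST m::int. zariski_dense Gr k
     {M :: nat \<Rightarrow> 'g \<Rightarrow> 'f. M \<in> mat_space Gr k \<and> L_surjective Gr k L M \<and> Kmax_excess Gr g1 g2 k M L \<ge> m})"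

end

(*
  Call a property of matrices generic if it holds off the zero set of some nonzero polynomial. By
  elimination of quantifiers over the algebraically closed field, every constructible property is
  generic or its negation is, so the generic maximum excess m_k of (L, k) is simply the value taken
  by the maximum excess at a generic matrix, and one generic matrix serves for all k at once.

  Write the excess as a function of a family of subspaces U_v of the stalks at the vertices. It is
  supermodular, with two consequences. First, m_{k-1} + m_{k+1} \<ge> 2 m_k: maximizers for the rows
  1, ..., k-1, k and for the rows 1, ..., k-1, k+1 have their sum in the sheaf of the first k - 1 rows
  and their intersection in the sheaf of the first k + 1 rows. Secondly, the maximizer of minimal
  dimension is unique; as the attainable dimension vectors of a generic matrix are invariant under
  right translation by the group, this maximizer has constant dimensions along translates, so |G|
  divides m_k.

  If \<kappa> is the least number of edges of L carrying a given label, then rho(L) \<le> \<kappa>, and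
  m_\<kappa> = 0 because the edge stalks of that label vanish. If m_k > 0, convexity therefore forces
  m_{k-1} - m_k > 0, hence m_{k-1} - m_k \<ge> |G|. Removing an edge e from L imposes one linear
  condition on each of the |G| edges of the same label and so costs at most |G|.
*)

theory Submission
  imports Defs "Jordan_Normal_Form.Determinant"
begin

section \<open>Spaces of functions\<close>

text \<open>The obstacle is that translation does not act on a single sheaf: it carries the
  maximizers for a matrix to those for the matrix with translated columns. Only dimension vectors
  can be compared. There are finitely many of them, each is attained generically or generically not,
  and permuting columns preserves genericity. So a generic matrix and its translates attain the same
  vectors, and uniqueness of the minimal maximizer turns equality of totals into equality at each
  vertex and edge. Permuting rows in the same way shows that the two row selections in the convexity
  argument have the same generic excess.

  Convexity alone gives a drop of at least 1: if m_{k-1} - m_k were nonpositive, so would be all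
  later differences, and m_\<kappa> could not be 0. An edge may cost |G|, so divisibility by |G|
  closes the gap. If m_k = 0, it suffices that the excess is never negative. The number \<kappa> is
  also a lower bound for the sizes of all index sets of L, so up to \<kappa> rows L-surjectivity is
  generic and the density in the definition measures the generic value.\<close>

interpretation fs: vector_space "fscale :: 'f::field \<Rightarrow> ('a \<Rightarrow> 'f) \<Rightarrow> ('a \<Rightarrow> 'f)"
  by (rule vector_space_fscale)

text \<open>Finiteness is attached to the subspace because the index type, and with it the full
  function space, may be infinite.\<close>

definition fin_dim :: "('a \<Rightarrow> 'f::field) set \<Rightarrow> bool" where
  "fin_dim V \<longleftrightarrow> (\<exists>W. finite W \<and> V \<subseteq> fs.span W)"

lemma fin_dim_subset: "fin_dim V \<Longrightarrow> U \<subseteq> V \<Longrightarrow> fin_dim U"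
  unfolding fin_dim_def by blast

lemma fin_dim_basis:
  assumes "fin_dim V" "\<not> fs.dependent B" "B \<subseteq> V"
  shows "\<exists>C. B \<subseteq> C \<and> C \<subseteq> V \<and> \<not> fs.dependent C \<and> V \<subseteq> fs.span C \<and> finite C \<and> card C = fs.dim V"
proof -
  obtain W where W: "finite W" "V \<subseteq> fs.span W"
    using assms(1) unfolding fin_dim_def by blast
  obtain C where C: "B \<subseteq> C" "C \<subseteq> V" "\<not> fs.dependent C" "V \<subseteq> fs.span C"
    using fs.maximal_independent_subset_extend[OF assms(3,2)] by blast
  moreover have "finite C"
    using fs.independent_span_bound[OF W(1) C(3)] C(2) W(2) by blast
  moreover have "card C = fs.dim V"
    using fs.basis_card_eq_dim[OF C(2,4,3)] .
  ultimately show ?thesis by blast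
qed

lemmas fin_dim_basis_exists = fin_dim_basis[OF _ fs.independent_empty empty_subsetI]

lemma card_le_fin_dim:
  assumes "fin_dim V" "\<not> fs.dependent B" "B \<subseteq> V"
  shows "finite B" "card B \<le> fs.dim V"
proof -
  obtain C where "B \<subseteq> C" "finite C" "card C = fs.dim V"
    using fin_dim_basis[OF assms] by blast
  then show "finite B" "card B \<le> fs.dim V"
    using finite_subset card_mono by metis+
qed

lemma dim_mono_fin:
  assumes "fin_dim V" "U \<subseteq> V"
  shows "fs.dim U \<le> fs.dim V"
proof -
  obtain B where "\<not> fs.dependent B" "B \<subseteq> U" "card B = fs.dim U"
    using fin_dim_basis_exists[OF fin_dim_subset[OF assms]] by blast
  then show ?thesis
    using card_le_fin_dim[OF assms(1)] assms(2) by force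
qed

lemma subspace_eq_fin:
  assumes "fin_dim V" "fs.subspace U" "U \<subseteq> V" "fs.dim V \<le> fs.dim U"
  shows "U = V"
proof -
  obtain B where B: "\<not> fs.dependent B" "B \<subseteq> U" "card B = fs.dim U" "U \<subseteq> fs.span B"
    using fin_dim_basis_exists[OF fin_dim_subset[OF assms(1,3)]] by blast
  have "B \<subseteq> V" using B(2) assms(3) by blast
  then obtain C where C: "B \<subseteq> C" "V \<subseteq> fs.span C" "finite C" "card C = fs.dim V"
    using fin_dim_basis[OF assms(1) B(1)] by metis
  have "B = C" using C B(3) assms(4) by (metis card_seteq)
  then have "V \<subseteq> U" using C(2) fs.span_minimal[OF B(2) assms(2)] by blast
  then show ?thesis using assms(3) by blast
qed

text \<open>A basis \<open>B\<close> of the kernel extends to a basis \<open>C\<close> of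
  \<open>A\<close>; \<open>f\<close> kills \<open>B\<close> and is injective on the span of
  \<open>C - B\<close>, so the images of \<open>C - B\<close> form a basis of the image.\<close>

lemma rank_nullity:
  fixes f :: "('a \<Rightarrow> 'f::field) \<Rightarrow> ('c \<Rightarrow> 'f)"
  assumes f: "Vector_Spaces.linear fscale fscale f" and A: "fin_dim A" "fs.subspace A"
  shows "fs.dim A = fs.dim {a \<in> A. f a = 0} + fs.dim (f ` A)"
proof -
  interpret f: Vector_Spaces.linear fscale fscale f by fact
  let ?K = "{a \<in> A. f a = 0}"
  have K: "?K \<subseteq> A" "fs.subspace ?K"
    using A(2) by (auto simp: fs.subspace_def f.add f.scale f.zero)
  obtain B where B: "fs.independent B" "B \<subseteq> ?K" "?K \<subseteq> fs.span B" "card B = fs.dim ?K" "finite B"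
    using fin_dim_basis_exists[OF fin_dim_subset[OF A(1) K(1)]] by blast
  have "B \<subseteq> A" using B(2) by blast
  then obtain C where C: "B \<subseteq> C" "C \<subseteq> A" "fs.independent C" "A \<subseteq> fs.span C" "finite C" "card C = fs.dim A"
    using fin_dim_basis[OF A(1) B(1)] by metis
  let ?D = "C - B"
  have D: "fs.span ?D \<subseteq> A" using C(2) fs.span_minimal[OF _ A(2)] by blast
  have "x = 0" if x: "x \<in> fs.span ?D" "f x = 0" for x
  proof -
    have "x \<in> fs.span B" using x D B(3) by blast
    then obtain u where u: "x = (\<Sum>b\<in>B. fscale (u b) b)"
      using fs.span_finite[OF B(5)] by auto
    obtain v where v: "x = (\<Sum>b\<in>?D. fscale (v b) b)"
      using x(1) fs.span_finite[of ?D] C(5) by auto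
    \<comment> \<open>\<open>x\<close> is written both through \<open>B\<close> and through
      \<open>C - B\<close>; the difference of the two expressions is a relation on \<open>C\<close>,
      whose coefficients must vanish.\<close>
    define w where "w = (\<lambda>b. if b \<in> B then u b else - v b)"
    have "(\<Sum>b\<in>C. fscale (w b) b) = (\<Sum>b\<in>?D. fscale (w b) b) + (\<Sum>b\<in>B. fscale (w b) b)"
      using C(1,5) by (rule sum.subset_diff)
    also have "(\<Sum>b\<in>B. fscale (w b) b) = x" by (simp add: u w_def)
    also have "(\<Sum>b\<in>?D. fscale (w b) b) = - x"
      by (simp add: v w_def sum_negf)
    finally have "(\<Sum>b\<in>C. fscale (w b) b) = 0" by (simp only: add.left_inverse)
    then have "w b = 0" if "b \<in> B" for b
      using fs.independentD[OF C(3,5), of w b] that C(1) by blast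
    then have "u b = 0" if "b \<in> B" for b using that unfolding w_def by simp
    then show "x = 0" unfolding u by simp
  qed
  then have inj: "inj_on f (fs.span ?D)"
    using f.inj_on_iff_eq_0[OF fs.subspace_span] by blast
  have ind: "fs.independent (f ` ?D)"
    using f.independent_injective_image[OF fs.independent_mono[OF C(3)] inj] by blast
  have "f ` A \<subseteq> fs.span (f ` ?D)"
  proof -
    have "f ` A \<subseteq> fs.span (f ` C)" using f.spans_image[OF C(4)] .
    also have "\<dots> \<subseteq> fs.span (f ` ?D)"
    proof (rule fs.span_minimal[OF _ fs.subspace_span])
      show "f ` C \<subseteq> fs.span (f ` ?D)"
      proof
        fix y assume "y \<in> f ` C"
        then obtain c where c: "c \<in> C" "y = f c" by blast
        show "y \<in> fs.span (f ` ?D)"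
        proof (cases "c \<in> B")
          case True
          then have "y = 0" using B(2) c(2) by auto
          then show ?thesis by (simp add: fs.span_zero)
        next
          case False
          then show ?thesis using c by (intro fs.span_base) auto
        qed
      qed
    qed
    finally show ?thesis .
  qed
  moreover have "f ` ?D \<subseteq> f ` A" using C(2) by blast
  ultimately have "fs.dim (f ` A) = card (f ` ?D)"
    using fs.basis_card_eq_dim[OF _ _ ind] by metis
  also have "\<dots> = card ?D"
    by (rule card_image) (meson inj inj_on_subset fs.span_superset)
  also have "\<dots> = card C - card B"
    by (rule card_Diff_subset[OF B(5) C(1)])
  finally show ?thesis
    using B(4) C(5,6) card_mono[OF C(5,1)] by linarith
qed

lemma sum_fun_apply: "(\<Sum>i\<in>I. f i) x = (\<Sum>i\<in>I. f i x :: 'b::comm_monoid_add)"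
  by (induction I rule: infinite_finite_induct) (simp_all add: zero_fun_def plus_fun_def)

lemma fsubspace_iff:
  "fsubspace U \<longleftrightarrow> (\<lambda>x. 0) \<in> U \<and> (\<forall>f\<in>U. \<forall>g\<in>U. (\<lambda>x. f x + g x) \<in> U) \<and> (\<forall>c. \<forall>f\<in>U. (\<lambda>x. c * f x) \<in> U)"
  unfolding fsubspace_def fs.subspace_def by (auto simp: zero_fun_def plus_fun_def fscale_def)

lemma fsubspace_scale: "fsubspace U \<Longrightarrow> f \<in> U \<Longrightarrow> (\<lambda>x. c * f x) \<in> U"
  by (simp add: fsubspace_iff)

definition supp_in :: "'a set \<Rightarrow> ('a \<Rightarrow> 'f::zero) set" where
  "supp_in X = {f. \<forall>x. x \<notin> X \<longrightarrow> f x = 0}"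

lemma fsubspace_supp_in: "fsubspace (supp_in X :: ('a \<Rightarrow> 'f::field) set)"
  by (auto simp: fsubspace_iff supp_in_def)

lemma fsubspace_Int: "fsubspace U \<Longrightarrow> fsubspace W \<Longrightarrow> fsubspace (U \<inter> W)"
  by (auto simp: fsubspace_iff)

lemma fsubspace_sum:
  "finite I \<Longrightarrow> fsubspace U \<Longrightarrow> (\<And>i. i \<in> I \<Longrightarrow> f i \<in> U) \<Longrightarrow> (\<lambda>x. \<Sum>i\<in>I. c i * f i x) \<in> U"
  by (induction I rule: finite_induct) (auto simp: fsubspace_iff)

lemma supp_in_subset_span:
  assumes "finite X"
  shows "(supp_in X :: ('a \<Rightarrow> 'f::field) set) \<subseteq> fs.span ((\<lambda>x y. if y = x then 1 else 0) ` X)"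
proof
  fix f :: "'a \<Rightarrow> 'f" assume f: "f \<in> supp_in X"
  have "f = (\<Sum>x\<in>X. fscale (f x) (\<lambda>y. if y = x then 1 else 0))"
  proof
    fix y
    show "f y = (\<Sum>x\<in>X. fscale (f x) (\<lambda>y. if y = x then 1 else 0)) y"
      using f assms by (simp add: sum_fun_apply fscale_def supp_in_def if_distrib cong: if_cong)
  qed
  also have "\<dots> \<in> fs.span ((\<lambda>x y. if y = x then 1 else 0) ` X)"
    by (intro fs.span_sum fs.span_scale fs.span_base imageI)
  finally show "f \<in> fs.span ((\<lambda>x y. if y = x then 1 else 0) ` X)" .
qed

lemma fin_dim_supp_in:
  assumes "finite X" "U \<subseteq> supp_in X"
  shows "fin_dim U"
  unfolding fin_dim_def using supp_in_subset_span[OF assms(1)] assms by blast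

lemma fdim_supp_in_le:
  assumes "finite X" "U \<subseteq> supp_in X"
  shows "fdim U \<le> card X"
proof -
  let ?B = "((\<lambda>x y. if y = x then 1 else 0) ` X) :: ('a \<Rightarrow> 'b) set"
  have "fdim U \<le> card ?B"
    unfolding fdim_def using supp_in_subset_span[OF assms(1)] assms
    by (intro fs.dim_le_card) blast+
  also have "\<dots> \<le> card X" by (rule card_image_le[OF assms(1)])
  finally show ?thesis .
qed

lemma fdim_mono:
  assumes "finite X" "V \<subseteq> supp_in X" "U \<subseteq> V"
  shows "fdim U \<le> fdim V"
  unfolding fdim_def by (rule dim_mono_fin[OF fin_dim_supp_in[OF assms(1,2)] assms(3)])

lemma fsubspace_eqI:
  assumes "finite X" "V \<subseteq> supp_in X" "fsubspace U" "U \<subseteq> V" "fdim V \<le> fdim U"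
  shows "U = V"
  using subspace_eq_fin[OF fin_dim_supp_in[OF assms(1,2)]] assms(3-)
  unfolding fdim_def fsubspace_def by blast

definition flinear :: "(('a \<Rightarrow> 'f::field) \<Rightarrow> ('c \<Rightarrow> 'f)) \<Rightarrow> bool" where
  "flinear T \<longleftrightarrow> (\<forall>f g. T (\<lambda>x. f x + g x) = (\<lambda>x. T f x + T g x)) \<and> (\<forall>c f. T (\<lambda>x. c * f x) = (\<lambda>x. c * T f x))"

lemma flinear_linear: "flinear T \<Longrightarrow> Vector_Spaces.linear fscale fscale T"
  by (intro Vector_Spaces.linear.intro module_hom.intro module_hom_axioms.intro)
    (auto simp: flinear_def plus_fun_def fscale_def fs.module_axioms fs.vector_space_axioms)

lemma fsubspace_image: "flinear T \<Longrightarrow> fsubspace U \<Longrightarrow> fsubspace (T ` U)"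
  using module_hom.subspace_image flinear_linear module_hom_iff_linear
  unfolding fsubspace_def by blast

lemma fdim_rank_nullity:
  assumes "finite X" "A \<subseteq> supp_in X" "fsubspace A" "flinear T"
  shows "fdim A = fdim {a \<in> A. T a = (\<lambda>x. 0)} + fdim (T ` A)"
  using rank_nullity[OF flinear_linear[OF assms(4)] fin_dim_supp_in[OF assms(1,2)]] assms(3)
  unfolding fdim_def fsubspace_def zero_fun_def by blast

lemma fdim_trivial: "U \<subseteq> {\<lambda>x. 0} \<Longrightarrow> fdim U = 0"
  unfolding fdim_def using fs.dim_le_card[of U "{}"] by (simp add: zero_fun_def)

lemma fdim_image_inj:
  assumes "finite X" "A \<subseteq> supp_in X" "fsubspace A" "flinear T"
    "\<And>a. a \<in> A \<Longrightarrow> T a = (\<lambda>x. 0) \<Longrightarrow> a = (\<lambda>x. 0)"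
  shows "fdim (T ` A) = fdim A"
proof -
  have "fdim {a \<in> A. T a = (\<lambda>x. 0)} = 0" using assms(5) by (intro fdim_trivial) blast
  then show ?thesis using fdim_rank_nullity[OF assms(1-4)] by simp
qed

text \<open>Keeping only the coordinate at \<open>x\<close> is a linear map with image of dimension
  at most one. This is the price of one vanishing condition, paid when an edge is removed.\<close>

lemma fdim_hyperplane:
  assumes "finite X" "A \<subseteq> supp_in X" "fsubspace A"
  shows "fdim A \<le> fdim {a \<in> A. a x = 0} + 1"
proof -
  define T :: "('a \<Rightarrow> 'b) \<Rightarrow> 'a \<Rightarrow> 'b" where "T = (\<lambda>a y. if y = x then a x else 0)"
  have T: "flinear T" by (auto simp: flinear_def T_def fun_eq_iff)
  have "{a \<in> A. T a = (\<lambda>x. 0)} = {a \<in> A. a x = 0}" by (auto simp: T_def fun_eq_iff)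
  moreover have "fdim (T ` A) \<le> 1"
    using fdim_supp_in_le[of "{x}" "T ` A"] by (force simp: T_def supp_in_def)
  ultimately show ?thesis using fdim_rank_nullity[OF assms T] by simp
qed

section \<open>Direct sums, sums and intersections of subspaces\<close>

definition fprod :: "'i set \<Rightarrow> ('i \<Rightarrow> ('x \<Rightarrow> 'f::zero) set) \<Rightarrow> ('i \<times> 'x \<Rightarrow> 'f) set" where
  "fprod I S = {\<phi>. (\<forall>i x. i \<notin> I \<longrightarrow> \<phi> (i, x) = 0) \<and> (\<forall>i\<in>I. (\<lambda>x. \<phi> (i, x)) \<in> S i)}"

lemma fprod_supp: "(\<And>i. i \<in> I \<Longrightarrow> S i \<subseteq> supp_in X) \<Longrightarrow> fprod I S \<subseteq> supp_in (I \<times> X)"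
  by (fastforce simp: fprod_def supp_in_def)

lemma fsubspace_fprod: "(\<And>i. i \<in> I \<Longrightarrow> fsubspace (S i)) \<Longrightarrow> fsubspace (fprod I S)"
  by (auto simp: fprod_def fsubspace_iff)

text \<open>Evaluation at a new index \<open>j\<close> maps the larger product onto
  \<open>S j\<close>, with the smaller product as kernel.\<close>

lemma fdim_fprod:
  assumes "finite I" "finite X" "\<And>i. i \<in> I \<Longrightarrow> fsubspace (S i)" "\<And>i. i \<in> I \<Longrightarrow> S i \<subseteq> supp_in X"
  shows "fdim (fprod I S) = (\<Sum>i\<in>I. fdim (S i))"
  using assms(1,3,4)
proof (induction I rule: finite_induct)
  case empty
  then show ?case by (auto intro!: fdim_trivial simp: fprod_def)
next
  case (insert j I)
  define T :: "('a \<times> 'b \<Rightarrow> 'c) \<Rightarrow> 'b \<Rightarrow> 'c" where "T = (\<lambda>\<phi> x. \<phi> (j, x))"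
  have T: "flinear T" by (auto simp: flinear_def T_def)
  have z: "(\<lambda>x. 0) \<in> S i" if "i \<in> insert j I" for i using insert.prems(1)[OF that] by (simp add: fsubspace_iff)
  have "T ` fprod (insert j I) S = S j"
  proof (intro equalityI subsetI)
    fix a assume a: "a \<in> S j"
    have "(\<lambda>(i, x). if i = j then a x else 0) \<in> fprod (insert j I) S"
    proof -
      have "(\<lambda>x. if i = j then a x else 0) \<in> S i" if "i \<in> insert j I" for i
        using a z[OF that] by (cases "i = j") simp_all
      then show ?thesis using a by (auto simp: fprod_def)
    qed
    moreover have "a = T (\<lambda>(i, x). if i = j then a x else 0)" by (simp add: T_def)
    ultimately show "a \<in> T ` fprod (insert j I) S" by blast
  qed (auto simp: T_def fprod_def)
  moreover have "{\<phi> \<in> fprod (insert j I) S. T \<phi> = (\<lambda>x. 0)} = fprod I S"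
    using insert.hyps z[of j] by (auto simp: fprod_def T_def fun_eq_iff)
  moreover have "fdim (fprod (insert j I) S) = fdim {\<phi> \<in> fprod (insert j I) S. T \<phi> = (\<lambda>x. 0)} + fdim (T ` fprod (insert j I) S)"
    using insert assms(2) by (intro fdim_rank_nullity[of "insert j I \<times> X"] fprod_supp fsubspace_fprod T) auto
  ultimately show ?case using insert by simp
qed

definition fplus :: "('a \<Rightarrow> 'f::plus) set \<Rightarrow> ('a \<Rightarrow> 'f) set \<Rightarrow> ('a \<Rightarrow> 'f) set" where
  "fplus A B = {\<lambda>x. a x + b x | a b. a \<in> A \<and> b \<in> B}"

lemma fsubspace_fplus:
  assumes "fsubspace A" "fsubspace B"
  shows "fsubspace (fplus A B)"
proof -
  have "fplus A B = {a + b | a b. a \<in> A \<and> b \<in> B}" by (simp add: fplus_def plus_fun_def)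
  then show ?thesis
    using fs.subspace_sums[of A B] assms unfolding fsubspace_def by simp
qed

lemma fplus_least:
  assumes "fsubspace W" "A \<subseteq> W" "B \<subseteq> W"
  shows "fplus A B \<subseteq> W"
proof
  fix c assume "c \<in> fplus A B"
  then obtain a b where "a \<in> W" "b \<in> W" "c = (\<lambda>x. a x + b x)"
    using assms(2,3) unfolding fplus_def by blast
  then show "c \<in> W" using assms(1) by (simp add: fsubspace_iff)
qed

lemma fplus_upper:
  assumes "fsubspace A" "fsubspace B"
  shows "A \<subseteq> fplus A B" "B \<subseteq> fplus A B"
proof -
  have z: "(\<lambda>x. 0) \<in> A" "(\<lambda>x. 0) \<in> B" using assms by (simp_all add: fsubspace_iff)
  have "a \<in> fplus A B" if "a \<in> A" for a
    unfolding fplus_def using that z(2) by (intro CollectI exI[of _ a] exI[of _ "\<lambda>x. 0"]) simp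
  moreover have "b \<in> fplus A B" if "b \<in> B" for b
    unfolding fplus_def using that z(1) by (intro CollectI exI[of _ "\<lambda>x. 0"] exI[of _ b]) simp
  ultimately show "A \<subseteq> fplus A B" "B \<subseteq> fplus A B" by blast+
qed

text \<open>The addition map on the direct sum of \<open>A\<close> and \<open>B\<close> has image
  \<open>fplus A B\<close>, and its kernel is the antidiagonal copy of \<open>A \<inter> B\<close>
  given by \<open>N\<close>.\<close>

lemma fdim_fplus_Int:
  assumes "finite X" "A \<subseteq> supp_in X" "B \<subseteq> supp_in X" "fsubspace A" "fsubspace B"
  shows "fdim (fplus A B) + fdim (A \<inter> B) = fdim A + fdim B"
proof -
  define S where "S = (\<lambda>b::bool. if b then A else B)"
  define T :: "(bool \<times> 'a \<Rightarrow> 'b) \<Rightarrow> 'a \<Rightarrow> 'b" where "T = (\<lambda>\<phi> x. \<phi> (True, x) + \<phi> (False, x))"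
  define N :: "('a \<Rightarrow> 'b) \<Rightarrow> bool \<times> 'a \<Rightarrow> 'b" where "N = (\<lambda>a (b, x). if b then a x else - a x)"
  have T: "flinear T" by (auto simp: flinear_def T_def algebra_simps)
  have N: "flinear N" by (auto simp: flinear_def N_def fun_eq_iff)
  have S: "S b \<subseteq> supp_in X" "fsubspace (S b)" for b using assms by (auto simp: S_def)
  have neg: "(\<lambda>x. - a x) \<in> W" if "a \<in> W" "fsubspace W" for a :: "'a \<Rightarrow> 'b" and W
    using fsubspace_scale[OF that(2,1), of "- 1"] by simp
  have P: "fdim (fprod UNIV S) = fdim A + fdim B"
    by (subst fdim_fprod[OF _ assms(1)]) (auto simp: S UNIV_bool, auto simp: S_def)
  have "T ` fprod UNIV S = fplus A B"
  proof (intro equalityI subsetI)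
    fix c assume "c \<in> fplus A B"
    then obtain a b where ab: "a \<in> A" "b \<in> B" "c = (\<lambda>x. a x + b x)" unfolding fplus_def by blast
    define \<phi> where "\<phi> = (\<lambda>(i, x). if i then a x else b x)"
    have "\<phi> \<in> fprod UNIV S" using ab by (auto simp: fprod_def S_def \<phi>_def)
    moreover have "c = T \<phi>" by (simp add: T_def ab \<phi>_def)
    ultimately show "c \<in> T ` fprod UNIV S" by blast
  next
    fix c assume "c \<in> T ` fprod UNIV S"
    then obtain \<phi> where \<phi>: "c = T \<phi>" "\<phi> \<in> fprod UNIV S" by blast
    then have "(\<lambda>x. \<phi> (True, x)) \<in> A" "(\<lambda>x. \<phi> (False, x)) \<in> B"
      by (simp_all add: fprod_def S_def all_bool_eq)
    then show "c \<in> fplus A B" unfolding fplus_def \<phi>(1) T_def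
      by (intro CollectI exI[of _ "\<lambda>x. \<phi> (True, x)"] exI[of _ "\<lambda>x. \<phi> (False, x)"]) simp
  qed
  moreover have "{\<phi> \<in> fprod UNIV S. T \<phi> = (\<lambda>x. 0)} = N ` (A \<inter> B)"
  proof (intro equalityI subsetI)
    fix \<phi> assume "\<phi> \<in> {\<phi> \<in> fprod UNIV S. T \<phi> = (\<lambda>x. 0)}"
    then have \<phi>: "\<phi> \<in> fprod UNIV S" "\<And>x. \<phi> (True, x) + \<phi> (False, x) = 0"
      by (auto simp: T_def fun_eq_iff)
    then have A: "(\<lambda>x. \<phi> (True, x)) \<in> A" and B: "(\<lambda>x. \<phi> (False, x)) \<in> B"
      by (simp_all add: fprod_def S_def all_bool_eq)
    have eq: "\<phi> (False, x) = - \<phi> (True, x)" for x using \<phi>(2)[of x] by (simp add: eq_neg_iff_add_eq_0 add.commute)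
    have "(\<lambda>x. - \<phi> (False, x)) \<in> B" using neg[OF B assms(5)] .
    then have "(\<lambda>x. \<phi> (True, x)) \<in> A \<inter> B" using A by (simp add: eq)
    moreover have "\<phi> = N (\<lambda>x. \<phi> (True, x))" by (auto simp: N_def fun_eq_iff eq)
    ultimately show "\<phi> \<in> N ` (A \<inter> B)" by blast
  next
    fix \<phi> assume "\<phi> \<in> N ` (A \<inter> B)"
    then show "\<phi> \<in> {\<phi> \<in> fprod UNIV S. T \<phi> = (\<lambda>x. 0)}"
      using neg[OF _ assms(5)] by (auto simp: N_def fprod_def S_def T_def)
  qed
  moreover have "fdim (N ` (A \<inter> B)) = fdim (A \<inter> B)"
  proof (rule fdim_image_inj[OF assms(1) _ _ N])
    show "A \<inter> B \<subseteq> supp_in X" using assms by blast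
    show "fsubspace (A \<inter> B)" using assms fsubspace_Int by blast
    fix a assume "N a = (\<lambda>x. 0)"
    then have "N a (True, x) = 0" for x by metis
    then show "a = (\<lambda>x. 0)" by (auto simp: N_def)
  qed
  moreover have "fdim (fprod UNIV S) = fdim {\<phi> \<in> fprod UNIV S. T \<phi> = (\<lambda>x. 0)} + fdim (T ` fprod UNIV S)"
    using assms(1) S by (intro fdim_rank_nullity[of "UNIV \<times> X"] fprod_supp fsubspace_fprod T) auto
  ultimately show ?thesis using P by simp
qed

text \<open>Spanning by \<open>d\<close> vectors, with zeros and repetitions allowed, turns an upper
  bound on a dimension into the existence of coordinates satisfying equations.\<close>

lemma fdim_le_iff_spanning:
  assumes "finite X" "U \<subseteq> supp_in X" "fsubspace U"
  shows "fdim U \<le> d \<longleftrightarrow> (\<exists>u. (\<forall>i<d. u i \<in> U) \<and> (\<forall>a\<in>U. \<exists>c. a = (\<lambda>x. \<Sum>i<d. c i * u i x)))"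
proof
  assume le: "fdim U \<le> d"
  obtain B where B: "B \<subseteq> U" "U \<subseteq> fs.span B" "finite B" "card B = fdim U"
    using fin_dim_basis_exists[OF fin_dim_supp_in[OF assms(1,2)]] unfolding fdim_def by blast
  obtain h where h: "bij_betw h {..<card B} B"
    using ex_bij_betw_nat_finite[OF B(3)] by (auto simp: atLeast0LessThan)
  \<comment> \<open>The basis is padded with zero vectors up to length \<open>d\<close>.\<close>
  define u where "u = (\<lambda>i. if i < card B then h i else (\<lambda>x. 0))"
  have "u i \<in> U" for i
    using B(1) h assms(3) unfolding u_def bij_betw_def fsubspace_iff by auto
  moreover have "\<exists>c. a = (\<lambda>x. \<Sum>i<d. c i * u i x)" if a: "a \<in> U" for a
  proof -
    have "a \<in> range (\<lambda>v. \<Sum>b\<in>B. fscale (v b) b)" using a B(2) fs.span_finite[OF B(3)] by auto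
    then obtain v where v: "a = (\<Sum>b\<in>B. fscale (v b) b)" by (rule rangeE)
    have "a x = (\<Sum>i<d. v (u i) * u i x)" for x
    proof -
      have "a x = (\<Sum>b\<in>B. v b * b x)" by (simp add: v sum_fun_apply fscale_def)
      also have "\<dots> = (\<Sum>i<card B. v (h i) * h i x)" by (rule sum.reindex_bij_betw[OF h, symmetric])
      also have "\<dots> = (\<Sum>i<card B. v (u i) * u i x)" by (simp add: u_def)
      also have "\<dots> = (\<Sum>i<d. v (u i) * u i x)"
        using le B(4) by (intro sum.mono_neutral_left) (auto simp: u_def)
      finally show ?thesis .
    qed
    then show ?thesis by (intro exI[of _ "\<lambda>i. v (u i)"]) (simp add: fun_eq_iff)
  qed
  ultimately show "\<exists>u. (\<forall>i<d. u i \<in> U) \<and> (\<forall>a\<in>U. \<exists>c. a = (\<lambda>x. \<Sum>i<d. c i * u i x))" by blast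
next
  assume "\<exists>u. (\<forall>i<d. u i \<in> U) \<and> (\<forall>a\<in>U. \<exists>c. a = (\<lambda>x. \<Sum>i<d. c i * u i x))"
  then obtain u where u: "\<forall>a\<in>U. \<exists>c. a = (\<lambda>x. \<Sum>i<d. c i * u i x)" by blast
  have "U \<subseteq> fs.span (u ` {..<d})"
  proof
    fix a assume "a \<in> U"
    then obtain c where c: "a = (\<lambda>x. \<Sum>i<d. c i * u i x)" using u by blast
    have "a = (\<Sum>i<d. fscale (c i) (u i))" by (simp add: c fun_eq_iff sum_fun_apply fscale_def)
    also have "\<dots> \<in> fs.span (u ` {..<d})" by (intro fs.span_sum fs.span_scale fs.span_base) auto
    finally show "a \<in> fs.span (u ` {..<d})" .
  qed
  then have "fdim U \<le> card (u ` {..<d})" unfolding fdim_def by (intro fs.dim_le_card) auto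
  also have "\<dots> \<le> d" using card_image_le[of "{..<d}" u] by simp
  finally show "fdim U \<le> d" .
qed

text \<open>Relations are tested only at the coordinates in \<open>X\<close>, which gives finitely
  many equations; elsewhere all vectors of \<open>U\<close> vanish.\<close>

lemma fdim_ge_iff_independent:
  assumes "finite X" "U \<subseteq> supp_in X" "fsubspace U"
  shows "d \<le> fdim U \<longleftrightarrow> (\<exists>u. (\<forall>i<d. u i \<in> U) \<and>
    (\<forall>c. (\<forall>x\<in>X. (\<Sum>i<d. c i * u i x) = 0) \<longrightarrow> (\<forall>i<d. c i = 0)))"
proof
  assume le: "d \<le> fdim U"
  obtain B where B: "fs.independent B" "B \<subseteq> U" "finite B" "card B = fdim U"
    using fin_dim_basis_exists[OF fin_dim_supp_in[OF assms(1,2)]] unfolding fdim_def by blast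
  obtain h where h: "bij_betw h {..<card B} B"
    using ex_bij_betw_nat_finite[OF B(3)] by (auto simp: atLeast0LessThan)
  have inj: "inj_on h {..<d}" using h le B(4) unfolding bij_betw_def by (auto intro: inj_on_subset)
  have hB: "h ` {..<d} \<subseteq> B" using h le B(4) unfolding bij_betw_def by auto
  have "\<forall>i<d. c i = 0" if c: "\<forall>x\<in>X. (\<Sum>i<d. c i * h i x) = 0" for c
  proof (intro allI impI)
    fix i assume i: "i < d"
    let ?v = "c \<circ> the_inv_into {..<d} h"
    have "(\<Sum>j<d. c j * h j x) = 0" for x
    proof (cases "x \<in> X")
      case False
      have "h j x = 0" if "j < d" for j
        using that hB B(2) assms(2) False by (auto simp: supp_in_def)
      then show ?thesis by simp
    qed (use c in blast)
    then have "0 = (\<Sum>j<d. fscale (c j) (h j))" by (simp add: fun_eq_iff sum_fun_apply fscale_def)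
    also have "\<dots> = (\<Sum>j<d. fscale (?v (h j)) (h j))"
      by (intro sum.cong) (auto simp: the_inv_into_f_f[OF inj])
    also have "\<dots> = (\<Sum>b\<in>h ` {..<d}. fscale (?v b) b)" by (simp add: sum.reindex[OF inj])
    finally have "?v (h i) = 0"
      using fs.independentD[OF B(1) _ hB, of ?v "h i"] i by auto
    then show "c i = 0" using i by (simp add: the_inv_into_f_f[OF inj])
  qed
  moreover have "\<forall>i<d. h i \<in> U" using hB B(2) by auto
  ultimately show "\<exists>u. (\<forall>i<d. u i \<in> U) \<and>
    (\<forall>c. (\<forall>x\<in>X. (\<Sum>i<d. c i * u i x) = 0) \<longrightarrow> (\<forall>i<d. c i = 0))" by blast
next
  assume "\<exists>u. (\<forall>i<d. u i \<in> U) \<and>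
    (\<forall>c. (\<forall>x\<in>X. (\<Sum>i<d. c i * u i x) = 0) \<longrightarrow> (\<forall>i<d. c i = 0))"
  then obtain u where u: "\<forall>i<d. u i \<in> U"
    and ind: "\<And>c. \<forall>x\<in>X. (\<Sum>i<d. c i * u i x) = 0 \<Longrightarrow> \<forall>i<d. c i = 0" by blast
  have inj: "inj_on u {..<d}"
  proof (rule inj_onI)
    fix i j assume ij: "i \<in> {..<d}" "j \<in> {..<d}" "u i = u j"
    show "i = j"
    proof (rule ccontr)
      assume ne: "i \<noteq> j"
      \<comment> \<open>Equal vectors at two indices would be related by the difference of two unit
        vectors.\<close>
      define c :: "nat \<Rightarrow> 'b" where "c = (\<lambda>l. (if l = i then 1 else 0) - (if l = j then 1 else 0))"
      have "(\<Sum>l<d. c l * u l x) = u i x - u j x" for x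
        using ij by (simp add: c_def left_diff_distrib sum_subtractf if_distrib[of "\<lambda>t. t * _"] cong: if_cong)
      then have "\<forall>l<d. c l = 0" using ij(3) by (intro ind) simp
      then show False using ij ne by (auto simp: c_def)
    qed
  qed
  have "fs.independent (u ` {..<d})"
  proof (rule fs.independent_if_scalars_zero)
    fix v b assume v: "(\<Sum>b\<in>u ` {..<d}. fscale (v b) b) = 0" and b: "b \<in> u ` {..<d}"
    have "(\<Sum>i<d. fscale (v (u i)) (u i)) = 0" using v by (simp add: sum.reindex[OF inj])
    then have "\<forall>x\<in>X. (\<Sum>i<d. v (u i) * u i x) = 0"
      by (simp add: fun_eq_iff sum_fun_apply fscale_def)
    from ind[OF this] show "v b = 0" using b by auto
  qed simp
  then have "card (u ` {..<d}) \<le> fdim U"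
    unfolding fdim_def using u by (intro card_le_fin_dim[OF fin_dim_supp_in[OF assms(1,2)]]) auto
  then show "d \<le> fdim U" by (simp add: card_image[OF inj])
qed

section \<open>Constructible and generic properties\<close>

text \<open>Over a finite field, one plus the product of all linear factors
  \<open>[:- a, 1:]\<close> would be a nonconstant polynomial without a root.\<close>

lemma alg_closed_infinite:
  assumes "alg_closed TYPE('f::field)"
  shows "infinite (UNIV :: 'f set)"
proof
  assume fin: "finite (UNIV :: 'f set)"
  define p :: "'f poly" where "p = (\<Prod>a\<in>UNIV. [:- a, 1:]) + 1"
  have "degree (\<Prod>a\<in>UNIV. [:- a, 1 :: 'f:]) = card (UNIV :: 'f set)"
    by (subst degree_prod_sum_eq) auto
  moreover have "card (UNIV :: 'f set) > 0" using fin by (simp add: card_gt_0_iff)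
  ultimately have "degree p > 0" unfolding p_def by (simp add: degree_add_eq_left)
  then obtain x where "poly p x = 0" using assms unfolding alg_closed_def by blast
  moreover have "(\<Prod>a\<in>UNIV. poly [:- a, 1:] x) = 0"
    using fin by (subst prod_zero_iff) (auto intro!: exI[of _ x])
  ultimately show False by (simp add: p_def poly_prod)
qed

lemma poly_nonroot:
  assumes "infinite (UNIV :: 'f::field set)" "p \<noteq> (0 :: 'f poly)"
  shows "\<exists>c. poly p c \<noteq> 0"
proof (rule ccontr)
  assume "\<nexists>c. poly p c \<noteq> 0"
  then have "{c. poly p c = 0} = UNIV" by auto
  then show False using poly_roots_finite[OF assms(2)] assms(1) by simp
qed

text \<open>Over an algebraically closed field this turns the existence of a common (non-)root into
  a divisibility, which pseudo-division decides by a condition on the coefficients.\<close>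

lemma root_nonroot_iff_not_dvd:
  assumes "alg_closed TYPE('f::field)" "(p :: 'f poly) \<noteq> 0" "degree p \<le> n"
  shows "(\<exists>c. poly p c = 0 \<and> poly q c \<noteq> 0) \<longleftrightarrow> \<not> p dvd q ^ n"
proof
  assume "\<exists>c. poly p c = 0 \<and> poly q c \<noteq> 0"
  then obtain c where c: "poly p c = 0" "poly q c \<noteq> 0" by blast
  show "\<not> p dvd q ^ n"
  proof
    assume "p dvd q ^ n"
    then obtain r where "q ^ n = p * r" by (elim dvdE)
    then have "poly (q ^ n) c = 0" using c(1) by simp
    then show False using c(2) by (simp add: poly_power)
  qed
next
  \<comment> \<open>If all roots of \<open>p\<close> are roots of \<open>q\<close>, splitting off
    the linear factors of \<open>p\<close> one at a time shows the divisibility.\<close>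
  have "p dvd q ^ degree p" if "\<forall>c. poly p c = 0 \<longrightarrow> poly q c = 0"
    using assms(2) that
  proof (induction "degree p" arbitrary: p)
    case 0
    then have "is_unit p" by (simp add: is_unit_iff_degree)
    then show ?case by (rule unit_imp_dvd)
  next
    case (Suc d)
    obtain c where c: "poly p c = 0"
      using assms(1) Suc(2) unfolding alg_closed_def by (metis zero_less_Suc)
    then obtain r where r: "p = [:- c, 1:] * r" by (auto simp: poly_eq_0_iff_dvd)
    have r0: "r \<noteq> 0" using Suc(3) r by auto
    have "degree p = Suc (degree r)" unfolding r using r0 by (subst degree_mult_eq) auto
    then have d: "degree r = d" using Suc(2) by simp
    have "r dvd q ^ degree r"
      using Suc(1)[of r] d r0 Suc(4) unfolding r by auto
    moreover have "[:- c, 1:] dvd q" using Suc(4) c by (auto simp: poly_eq_0_iff_dvd)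
    ultimately show ?case unfolding Suc(2)[symmetric] d unfolding r power_Suc by (rule mult_dvd_mono[rotated])
  qed
  moreover assume "\<not> p dvd q ^ n"
  ultimately show "\<exists>c. poly p c = 0 \<and> poly q c \<noteq> 0"
    using assms(3) by (meson dvd_trans le_imp_power_dvd)
qed

section \<open>Polynomial functions and constructible conditions\<close>

inductive polyfn :: "'v set \<Rightarrow> (('v \<Rightarrow> 'f::field) \<Rightarrow> 'f) \<Rightarrow> bool" for A where
  polyfn_const: "polyfn A (\<lambda>\<rho>. c)"
| polyfn_var: "v \<in> A \<Longrightarrow> polyfn A (\<lambda>\<rho>. \<rho> v)"
| polyfn_add: "polyfn A p \<Longrightarrow> polyfn A q \<Longrightarrow> polyfn A (\<lambda>\<rho>. p \<rho> + q \<rho>)"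
| polyfn_mult: "polyfn A p \<Longrightarrow> polyfn A q \<Longrightarrow> polyfn A (\<lambda>\<rho>. p \<rho> * q \<rho>)"

lemma polyfn_mono: "polyfn A p \<Longrightarrow> A \<subseteq> B \<Longrightarrow> polyfn B p"
  by (induction rule: polyfn.induct) (auto intro: polyfn.intros)

lemma polyfn_cong: "polyfn A p \<Longrightarrow> (\<And>v. v \<in> A \<Longrightarrow> \<rho> v = \<rho>' v) \<Longrightarrow> p \<rho> = p \<rho>'"
  by (induction rule: polyfn.induct) auto

lemma polyfn_diff: "polyfn A p \<Longrightarrow> polyfn A q \<Longrightarrow> polyfn A (\<lambda>\<rho>. p \<rho> - q \<rho>)"
  using polyfn_add[OF _ polyfn_mult[OF polyfn_const[of A "- 1"]], of p q] by simp

lemma polyfn_sum: "(\<And>i. i \<in> I \<Longrightarrow> polyfn A (f i)) \<Longrightarrow> polyfn A (\<lambda>\<rho>. \<Sum>i\<in>I. f i \<rho>)"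
  by (induction I rule: infinite_finite_induct) (auto intro: polyfn.intros)

lemma polyfn_prod: "(\<And>i. i \<in> I \<Longrightarrow> polyfn A (f i)) \<Longrightarrow> polyfn A (\<lambda>\<rho>. \<Prod>i\<in>I. f i \<rho>)"
  by (induction I rule: infinite_finite_induct) (auto intro: polyfn.intros)

lemma polyfn_subst:
  "polyfn A p \<Longrightarrow> (\<And>v. v \<in> A \<Longrightarrow> polyfn B (\<lambda>\<rho>. \<sigma> \<rho> v)) \<Longrightarrow> polyfn B (\<lambda>\<rho>. p (\<sigma> \<rho>))"
  by (induction rule: polyfn.induct) (auto intro: polyfn.intros)

text \<open>Restriction to a line reduces nonvanishing in many variables to one variable, where a
  nonzero polynomial has finitely many roots.\<close>

lemma polyfn_line: "polyfn A p \<Longrightarrow> \<exists>P. \<forall>t. p (\<lambda>v. a v + t * b v) = poly P t"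
proof (induction rule: polyfn.induct)
  case (polyfn_const c)
  show ?case by (rule exI[of _ "[:c:]"]) simp
next
  case (polyfn_var v)
  show ?case by (rule exI[of _ "[:a v, b v:]"]) simp
next
  case (polyfn_add p q)
  then show ?case by (metis poly_add)
next
  case (polyfn_mult p q)
  then show ?case by (metis poly_mult)
qed

inductive constructible :: "'v set \<Rightarrow> (('v \<Rightarrow> 'f::field) \<Rightarrow> bool) \<Rightarrow> bool" for A where
  constructible_eq0: "polyfn A p \<Longrightarrow> constructible A (\<lambda>\<rho>. p \<rho> = 0)"
| constructible_conj: "constructible A P \<Longrightarrow> constructible A Q \<Longrightarrow> constructible A (\<lambda>\<rho>. P \<rho> \<and> Q \<rho>)"
| constructible_not: "constructible A P \<Longrightarrow> constructible A (\<lambda>\<rho>. \<not> P \<rho>)"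

lemma constructible_cong: "constructible A P \<Longrightarrow> (\<And>\<rho>. P \<rho> \<longleftrightarrow> Q \<rho>) \<Longrightarrow> constructible A Q"
proof -
  assume "constructible A P" "\<And>\<rho>. P \<rho> \<longleftrightarrow> Q \<rho>"
  moreover from this(2) have "P = Q" by blast
  ultimately show ?thesis by simp
qed

lemma constructible_eq: "polyfn A p \<Longrightarrow> polyfn A q \<Longrightarrow> constructible A (\<lambda>\<rho>. p \<rho> = q \<rho>)"
  using constructible_eq0[OF polyfn_diff, of A p q] by simp

lemma constructible_const: "constructible A (\<lambda>\<rho>. b)"
  using constructible_eq0[OF polyfn_const[of A "if b then 0 else 1"]] by (cases b) simp_all

lemma constructible_disj: "constructible A P \<Longrightarrow> constructible A Q \<Longrightarrow> constructible A (\<lambda>\<rho>. P \<rho> \<or> Q \<rho>)"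
  by (rule constructible_cong[OF constructible_not[OF constructible_conj[OF constructible_not constructible_not]]]) auto

lemma constructible_imp: "constructible A P \<Longrightarrow> constructible A Q \<Longrightarrow> constructible A (\<lambda>\<rho>. P \<rho> \<longrightarrow> Q \<rho>)"
  by (rule constructible_cong[OF constructible_disj[OF constructible_not]]) auto

lemma constructible_ball:
  "finite I \<Longrightarrow> (\<And>i. i \<in> I \<Longrightarrow> constructible A (P i)) \<Longrightarrow> constructible A (\<lambda>\<rho>. \<forall>i\<in>I. P i \<rho>)"
  by (induction I rule: finite_induct) (auto intro: constructible_const constructible_conj)

lemma constructible_bex:
  "finite I \<Longrightarrow> (\<And>i. i \<in> I \<Longrightarrow> constructible A (P i)) \<Longrightarrow> constructible A (\<lambda>\<rho>. \<exists>i\<in>I. P i \<rho>)"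
  by (induction I rule: finite_induct) (auto intro: constructible_const constructible_disj)

lemma constructible_all_less:
  "(\<And>i::nat. i < n \<Longrightarrow> constructible A (P i)) \<Longrightarrow> constructible A (\<lambda>\<rho>. \<forall>i<n. P i \<rho>)"
  by (rule constructible_cong[OF constructible_ball[of "{..<n}" A P]]) auto

text \<open>A polynomial in one further variable with coefficients depending on the variables in
  \<open>A\<close>. The number \<open>n\<close> is a strict degree bound, uniform in the point: the
  coefficient at \<open>n - 1\<close> may vanish at some points, and \<open>n = 0\<close> forces the
  zero polynomial.\<close>

definition upoly :: "'v set \<Rightarrow> nat \<Rightarrow> (('v \<Rightarrow> 'f::field) \<Rightarrow> 'f poly) \<Rightarrow> bool" where
  "upoly A n \<phi> \<longleftrightarrow> (\<forall>i. polyfn A (\<lambda>\<rho>. coeff (\<phi> \<rho>) i)) \<and> (\<forall>\<rho> i. n \<le> i \<longrightarrow> coeff (\<phi> \<rho>) i = 0)"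

lemma upoly_coeff: "upoly A n \<phi> \<Longrightarrow> polyfn A (\<lambda>\<rho>. coeff (\<phi> \<rho>) i)"
  by (simp add: upoly_def)

lemma upoly_const: "polyfn A p \<Longrightarrow> upoly A 1 (\<lambda>\<rho>. [:p \<rho>:])"
  unfolding upoly_def
proof safe
  fix i assume "polyfn A p"
  then show "polyfn A (\<lambda>\<rho>. coeff [:p \<rho>:] i)" by (cases i) (auto intro: polyfn_const)
qed (auto simp: coeff_pCons split: nat.splits)

lemma upoly_X: "upoly A 2 (\<lambda>\<rho>. [:0, 1:])"
  by (auto simp: upoly_def coeff_pCons intro: polyfn_const split: nat.splits)

lemma upoly_add: "upoly A n \<phi> \<Longrightarrow> upoly A m \<psi> \<Longrightarrow> upoly A (max n m) (\<lambda>\<rho>. \<phi> \<rho> + \<psi> \<rho>)"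
  by (auto simp: upoly_def intro: polyfn_add)

lemma upoly_mult: "upoly A n \<phi> \<Longrightarrow> upoly A m \<psi> \<Longrightarrow> upoly A (n + m) (\<lambda>\<rho>. \<phi> \<rho> * \<psi> \<rho>)"
  unfolding upoly_def
proof safe
  fix i assume a: "\<forall>i. polyfn A (\<lambda>\<rho>. coeff (\<phi> \<rho>) i)" "\<forall>i. polyfn A (\<lambda>\<rho>. coeff (\<psi> \<rho>) i)"
  show "polyfn A (\<lambda>\<rho>. coeff (\<phi> \<rho> * \<psi> \<rho>) i)"
    unfolding coeff_mult using a by (intro polyfn_sum polyfn_mult) auto
next
  fix \<rho> i assume a: "\<forall>\<rho> i. n \<le> i \<longrightarrow> coeff (\<phi> \<rho>) i = 0" "\<forall>\<rho> i. m \<le> i \<longrightarrow> coeff (\<psi> \<rho>) i = 0" "n + m \<le> i"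
  show "coeff (\<phi> \<rho> * \<psi> \<rho>) i = 0"
    unfolding coeff_mult
  proof (intro sum.neutral ballI)
    fix j assume "j \<in> {..i}"
    then have "n \<le> j \<or> m \<le> i - j" using a(3) by auto
    then show "coeff (\<phi> \<rho>) j * coeff (\<psi> \<rho>) (i - j) = 0" using a(1,2) by auto
  qed
qed

lemma upoly_power: "upoly A m \<psi> \<Longrightarrow> \<exists>n. upoly A n (\<lambda>\<rho>. \<psi> \<rho> ^ k)"
proof (induction k)
  case 0
  show ?case using upoly_const[OF polyfn_const[of A 1]] by (auto simp: one_pCons)
next
  case (Suc k)
  then show ?case using upoly_mult by fastforce
qed

lemma polyfn_insert_upoly:
  "polyfn (insert v A) p \<Longrightarrow> \<exists>n \<phi>. upoly A n \<phi> \<and> (\<forall>\<rho>. p \<rho> = poly (\<phi> \<rho>) (\<rho> v))"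
proof (induction rule: polyfn.induct)
  case (polyfn_const c)
  show ?case using upoly_const[OF polyfn.polyfn_const[of A c]] by (intro exI conjI) auto
next
  case (polyfn_var w)
  show ?case
  proof (cases "w = v")
    case True
    show ?thesis using upoly_X[of A] True by (intro exI conjI) auto
  next
    case False
    then have "w \<in> A" using polyfn_var by simp
    from upoly_const[OF polyfn.polyfn_var[OF this]] show ?thesis by (intro exI conjI) auto
  qed
next
  case (polyfn_add p q)
  then obtain n \<phi> m \<psi> where "upoly A n \<phi>" "\<forall>\<rho>. p \<rho> = poly (\<phi> \<rho>) (\<rho> v)" "upoly A m \<psi>" "\<forall>\<rho>. q \<rho> = poly (\<psi> \<rho>) (\<rho> v)"
    by blast
  then show ?case using upoly_add[of A n \<phi> m \<psi>]
    by (intro exI[of _ "max n m"] exI[of _ "\<lambda>\<rho>. \<phi> \<rho> + \<psi> \<rho>"]) simp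
next
  case (polyfn_mult p q)
  then obtain n \<phi> m \<psi> where "upoly A n \<phi>" "\<forall>\<rho>. p \<rho> = poly (\<phi> \<rho>) (\<rho> v)" "upoly A m \<psi>" "\<forall>\<rho>. q \<rho> = poly (\<psi> \<rho>) (\<rho> v)"
    by blast
  then show ?case using upoly_mult[of A n \<phi> m \<psi>]
    by (intro exI[of _ "n + m"] exI[of _ "\<lambda>\<rho>. \<phi> \<rho> * \<psi> \<rho>"]) simp
qed

text \<open>One step of division of \<psi> by \<phi>, with the coefficients at degree
  \<open>m - 1\<close> cancelled by cross-multiplication. Nothing is divided, so the coefficients
  stay polynomial functions.\<close>

definition pseudo_reduce :: "nat \<Rightarrow> ('e \<Rightarrow> 'f::field poly) \<Rightarrow> nat \<Rightarrow> ('e \<Rightarrow> 'f poly) \<Rightarrow> 'e \<Rightarrow> 'f poly" where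
  "pseudo_reduce n \<phi> m \<psi> = (\<lambda>\<rho>. Polynomial.smult (coeff (\<phi> \<rho>) (n - 1)) (\<psi> \<rho>) - monom (coeff (\<psi> \<rho>) (m - 1)) (m - n) * \<phi> \<rho>)"

lemma upoly_pseudo_reduce:
  assumes "upoly A n \<phi>" "upoly A m \<psi>" "0 < n" "n \<le> m"
  shows "upoly A (m - 1) (pseudo_reduce n \<phi> m \<psi>)"
  unfolding upoly_def
proof safe
  fix i
  show "polyfn A (\<lambda>\<rho>. coeff (pseudo_reduce n \<phi> m \<psi> \<rho>) i)"
    using assms(1,2)
    by (cases "i < m - n") (auto simp: pseudo_reduce_def coeff_monom_mult upoly_coeff
        intro!: polyfn_diff polyfn_mult polyfn_const)
next
  fix \<rho> i assume i: "m - 1 \<le> i"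
  show "coeff (pseudo_reduce n \<phi> m \<psi> \<rho>) i = 0"
  proof (cases "i = m - 1")
    case True
    moreover have "m - 1 - (m - n) = n - 1" "\<not> m - 1 < m - n" using assms(3,4) by auto
    ultimately show ?thesis by (simp add: pseudo_reduce_def coeff_monom_mult)
  next
    case False
    then have "m \<le> i" "n \<le> i - (m - n)" using i assms(3,4) by auto
    then show ?thesis using assms(1,2) by (simp add: pseudo_reduce_def coeff_monom_mult upoly_def)
  qed
qed

lemma upoly_drop_lead:
  assumes "upoly A n \<phi>"
  shows "upoly A (n - 1) (\<lambda>\<rho>. \<phi> \<rho> - monom (coeff (\<phi> \<rho>) (n - 1)) (n - 1))"
  unfolding upoly_def
proof safe
  fix i
  show "polyfn A (\<lambda>\<rho>. coeff (\<phi> \<rho> - monom (coeff (\<phi> \<rho>) (n - 1)) (n - 1)) i)"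
    using assms by (cases "i = n - 1") (auto simp: upoly_coeff intro: polyfn_const)
next
  fix \<rho> i assume "n - 1 \<le> i"
  then show "coeff (\<phi> \<rho> - monom (coeff (\<phi> \<rho>) (n - 1)) (n - 1)) i = 0"
    using assms by (cases "i = n - 1") (auto simp: upoly_def)
qed

lemma upoly_nonzero_iff: "upoly A n \<phi> \<Longrightarrow> \<phi> \<rho> = 0 \<longleftrightarrow> (\<forall>i<n. coeff (\<phi> \<rho>) i = 0)"
  unfolding upoly_def poly_eq_iff coeff_0 using not_less by blast

lemma constructible_upoly_eq0: "upoly A n \<phi> \<Longrightarrow> constructible A (\<lambda>\<rho>. \<phi> \<rho> = 0)"
  by (rule constructible_cong[OF constructible_all_less[OF constructible_eq0]])
    (auto simp: upoly_nonzero_iff upoly_coeff)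

text \<open>Where the leading coefficient of \<phi> is nonzero, a pseudo-division step changes
  \<psi> by a nonzero factor and a multiple of \<phi>, which keeps divisibility. Once
  \<open>m < n\<close>, degrees leave only the case that \<psi> is zero.\<close>

lemma constructible_dvd:
  assumes \<phi>: "upoly A n \<phi>" "0 < n"
  shows "upoly A m \<psi> \<Longrightarrow> constructible A (\<lambda>\<rho>. coeff (\<phi> \<rho>) (n - 1) \<noteq> 0 \<and> \<phi> \<rho> dvd \<psi> \<rho>)"
proof (induction m arbitrary: \<psi> rule: less_induct)
  case (less m)
  show ?case
  proof (cases "m < n")
    case True
    have "\<phi> \<rho> dvd \<psi> \<rho> \<longleftrightarrow> \<psi> \<rho> = 0" if nz: "coeff (\<phi> \<rho>) (n - 1) \<noteq> 0" for \<rho>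
    proof
      assume dvd: "\<phi> \<rho> dvd \<psi> \<rho>"
      show "\<psi> \<rho> = 0"
      proof (rule ccontr)
        assume "\<psi> \<rho> \<noteq> 0"
        then have "m \<le> degree (\<psi> \<rho>)"
          using dvd_imp_degree_le[OF dvd] le_degree[OF nz] True by simp
        then have "lead_coeff (\<psi> \<rho>) = 0" using less(2) unfolding upoly_def by blast
        then show False using \<open>\<psi> \<rho> \<noteq> 0\<close> by simp
      qed
    qed simp
    then show ?thesis
      by (intro constructible_cong[OF constructible_conj[OF constructible_not[OF constructible_eq0[OF upoly_coeff[OF \<phi>(1)]]]
            constructible_upoly_eq0[OF less(2)]], of "n - 1"]) blast
  next
    case False
    have "\<phi> \<rho> dvd pseudo_reduce n \<phi> m \<psi> \<rho> \<longleftrightarrow> \<phi> \<rho> dvd \<psi> \<rho>" if nz: "coeff (\<phi> \<rho>) (n - 1) \<noteq> 0" for \<rho>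
    proof -
      have "\<phi> \<rho> dvd pseudo_reduce n \<phi> m \<psi> \<rho> \<longleftrightarrow> \<phi> \<rho> dvd Polynomial.smult (coeff (\<phi> \<rho>) (n - 1)) (\<psi> \<rho>)"
        unfolding pseudo_reduce_def by (rule dvd_diff_left_iff) simp
      then show ?thesis using nz by (simp add: dvd_smult_iff)
    qed
    note dvd_iff = this
    have "constructible A (\<lambda>\<rho>. coeff (\<phi> \<rho>) (n - 1) \<noteq> 0 \<and> \<phi> \<rho> dvd pseudo_reduce n \<phi> m \<psi> \<rho>)"
      using False \<phi>(2) by (intro less(1)[OF _ upoly_pseudo_reduce[OF \<phi>(1) less(2) \<phi>(2)]]) simp_all
    then show ?thesis by (rule constructible_cong) (use dvd_iff in blast)
  qed
qed

definition solvable_at :: "(nat \<times> ('e \<Rightarrow> 'f::field poly)) list \<Rightarrow> ('e \<Rightarrow> 'f poly) \<Rightarrow> 'e \<Rightarrow> bool" where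
  "solvable_at ps q \<rho> \<longleftrightarrow> (\<exists>c. (\<forall>(n, \<phi>)\<in>set ps. poly (\<phi> \<rho>) c = 0) \<and> poly (q \<rho>) c \<noteq> 0)"

text \<open>Euclid's algorithm with branching: of two equations, the one with the smaller bound
  reduces the other where its leading coefficient is nonzero, and loses its top term elsewhere. With
  one equation left, divisibility decides; with none, a nonzero \<open>q\<close> has a nonroot
  because the field is infinite. The \<open>Suc\<close> in the measure makes discarding a zero
  polynomial count as progress.\<close>

lemma constructible_solvable_at:
  assumes ac: "alg_closed TYPE('f::field)" and q: "upoly A m (q :: ('v \<Rightarrow> 'f) \<Rightarrow> 'f poly)"
  shows "\<forall>(n, \<phi>)\<in>set ps. upoly A n \<phi> \<Longrightarrow> constructible A (solvable_at ps q)"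
proof (induction "sum_list (map (\<lambda>(n, \<phi>). Suc n) ps)" arbitrary: ps rule: less_induct)
  case less
  note IH = less(1) and ps = less(2)
  have drop_lead: "constructible A (\<lambda>\<rho>. coeff (\<phi> \<rho>) (n - 1) = 0 \<and> solvable_at ((n, \<phi>) # rs) q \<rho>)"
    if eq: "sum_list (map (\<lambda>(n, \<phi>). Suc n) ps) = sum_list (map (\<lambda>(n, \<phi>). Suc n) ((n, \<phi>) # rs))"
      and up: "\<forall>(n, \<phi>)\<in>set ((n, \<phi>) # rs). upoly A n \<phi>" and n: "0 < n" for n \<phi> rs
  proof -
    let ?\<phi> = "\<lambda>\<rho>. \<phi> \<rho> - monom (coeff (\<phi> \<rho>) (n - 1)) (n - 1)"
    have "constructible A (solvable_at ((n - 1, ?\<phi>) # rs) q)"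
      using eq up n upoly_drop_lead[of A n \<phi>] by (intro IH) auto
    then have "constructible A (\<lambda>\<rho>. coeff (\<phi> \<rho>) (n - 1) = 0 \<and> solvable_at ((n - 1, ?\<phi>) # rs) q \<rho>)"
      using up by (intro constructible_conj constructible_eq0) (auto simp: upoly_coeff)
    then show ?thesis by (rule constructible_cong) (auto simp: solvable_at_def)
  qed
  have step: "constructible A (solvable_at ps q)"
    if eq: "sum_list (map (\<lambda>(n, \<phi>). Suc n) ps) = sum_list (map (\<lambda>(n, \<phi>). Suc n) ((n, \<phi>) # (k, \<psi>) # rs))"
      and set: "set ps = set ((n, \<phi>) # (k, \<psi>) # rs)"
      and n: "0 < n" "n \<le> k" for n \<phi> k \<psi> rs
  proof -
    have up: "\<forall>(n, \<phi>)\<in>set ((n, \<phi>) # (k, \<psi>) # rs). upoly A n \<phi>" using ps unfolding set .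
    let ?a = "\<lambda>\<rho>. coeff (\<phi> \<rho>) (n - 1)"
    let ?ps = "(n, \<phi>) # (k - 1, pseudo_reduce n \<phi> k \<psi>) # rs"
    have "constructible A (solvable_at ?ps q)"
      using eq up n upoly_pseudo_reduce[of A n \<phi> k \<psi>] by (intro IH) auto
    then have 1: "constructible A (\<lambda>\<rho>. ?a \<rho> \<noteq> 0 \<and> solvable_at ?ps q \<rho>)"
      using up by (intro constructible_conj constructible_not constructible_eq0) (auto simp: upoly_coeff)
    have 2: "constructible A (\<lambda>\<rho>. ?a \<rho> = 0 \<and> solvable_at ((n, \<phi>) # (k, \<psi>) # rs) q \<rho>)"
      by (rule drop_lead[OF eq up n(1)])
    have "poly (\<psi> \<rho>) c = 0 \<longleftrightarrow> poly (pseudo_reduce n \<phi> k \<psi> \<rho>) c = 0"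
      if "poly (\<phi> \<rho>) c = 0" "?a \<rho> \<noteq> 0" for c \<rho>
      using that by (simp add: pseudo_reduce_def)
    then have *: "solvable_at ((n, \<phi>) # (k, \<psi>) # rs) q \<rho> \<longleftrightarrow> solvable_at ?ps q \<rho>" if "?a \<rho> \<noteq> 0" for \<rho>
      using that unfolding solvable_at_def by auto
    have "solvable_at ps q = solvable_at ((n, \<phi>) # (k, \<psi>) # rs) q"
      by (intro ext) (simp only: solvable_at_def set)
    then show ?thesis
      using * by (intro constructible_cong[OF constructible_disj[OF 1 2]]) auto
  qed
  consider "ps = []" | \<phi> rs where "ps = (0, \<phi>) # rs" | n \<phi> where "ps = [(n, \<phi>)]" "0 < n"
    | \<psi> x rs where "ps = x # (0, \<psi>) # rs" | n \<phi> k \<psi> rs where "ps = (n, \<phi>) # (k, \<psi>) # rs" "0 < n" "0 < k"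
    by (metis list.exhaust neq0_conv surj_pair)
  then show ?case
  proof cases
    case 1
    have "solvable_at ps q \<rho> \<longleftrightarrow> q \<rho> \<noteq> 0" for \<rho>
      using poly_nonroot[OF alg_closed_infinite[OF ac], of "q \<rho>"] by (auto simp: solvable_at_def 1)
    then show ?thesis
      by (intro constructible_cong[OF constructible_not[OF constructible_upoly_eq0[OF q]]]) simp
  next
    case (2 \<phi> rs)
    have "upoly A 0 \<phi>" using ps 2 by auto
    then have "\<phi> \<rho> = 0" for \<rho> using upoly_nonzero_iff by blast
    then have "solvable_at ps q = solvable_at rs q" by (auto simp: solvable_at_def 2 fun_eq_iff)
    moreover have "constructible A (solvable_at rs q)" using ps 2 by (intro IH) auto
    ultimately show ?thesis by simp
  next
    case (3 n \<phi>)
    have \<phi>: "upoly A n \<phi>" using ps 3 by auto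
    obtain l where l: "upoly A l (\<lambda>\<rho>. q \<rho> ^ n)" using upoly_power[OF q] by blast
    have "solvable_at ps q \<rho> \<longleftrightarrow> \<not> \<phi> \<rho> dvd q \<rho> ^ n" if "coeff (\<phi> \<rho>) (n - 1) \<noteq> 0" for \<rho>
    proof -
      have "\<phi> \<rho> \<noteq> 0" using that by auto
      moreover have "degree (\<phi> \<rho>) \<le> n" using \<phi> by (intro degree_le) (auto simp: upoly_def)
      ultimately show ?thesis
        using root_nonroot_iff_not_dvd[OF ac, of "\<phi> \<rho>" n "q \<rho>"] by (simp add: solvable_at_def 3)
    qed
    then have *: "solvable_at ps q \<rho> \<longleftrightarrow> (coeff (\<phi> \<rho>) (n - 1) = 0 \<and> solvable_at ps q \<rho>) \<or>
      (\<not> (coeff (\<phi> \<rho>) (n - 1) = 0) \<and> \<not> (coeff (\<phi> \<rho>) (n - 1) \<noteq> 0 \<and> \<phi> \<rho> dvd q \<rho> ^ n))" for \<rho> by blast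
    have "constructible A (\<lambda>\<rho>. coeff (\<phi> \<rho>) (n - 1) = 0 \<and> solvable_at ps q \<rho>)"
      unfolding 3 using ps 3 by (intro drop_lead) auto
    then show ?thesis
      by (rule constructible_cong[OF constructible_disj[OF _ constructible_conj[OF constructible_not[OF constructible_eq0[OF upoly_coeff[OF \<phi>]]]
            constructible_not[OF constructible_dvd[OF \<phi> 3(2) l]]]] *[symmetric]])
  next
    case (4 \<psi> x rs)
    have "upoly A 0 \<psi>" using ps 4 by auto
    then have "\<psi> \<rho> = 0" for \<rho> using upoly_nonzero_iff by blast
    then have "solvable_at ps q = solvable_at (x # rs) q" by (auto simp: solvable_at_def 4 fun_eq_iff)
    moreover have "constructible A (solvable_at (x # rs) q)" using ps 4 by (intro IH) auto
    ultimately show ?thesis by simp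
  next
    case (5 n \<phi> k \<psi> rs)
    show ?thesis
    proof (cases "n \<le> k")
      case True
      show ?thesis by (rule step[of n \<phi> k \<psi> rs]) (use 5 True in auto)
    next
      case False
      show ?thesis by (rule step[of k \<psi> n \<phi> rs]) (use 5 False in auto)
    qed
  qed
qed

section \<open>Elimination of existential quantifiers\<close>

inductive dnf :: "'v set \<Rightarrow> (('v \<Rightarrow> 'f::field) \<Rightarrow> bool) \<Rightarrow> bool" for A where
  dnf_basic: "\<forall>p\<in>set ps. polyfn A p \<Longrightarrow> polyfn A q \<Longrightarrow> dnf A (\<lambda>\<rho>. (\<forall>p\<in>set ps. p \<rho> = 0) \<and> q \<rho> \<noteq> 0)"
| dnf_disj: "dnf A P \<Longrightarrow> dnf A Q \<Longrightarrow> dnf A (\<lambda>\<rho>. P \<rho> \<or> Q \<rho>)"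

lemma dnf_cong: "dnf A P \<Longrightarrow> (\<And>\<rho>. P \<rho> \<longleftrightarrow> Q \<rho>) \<Longrightarrow> dnf A Q"
proof -
  assume "dnf A P" "\<And>\<rho>. P \<rho> \<longleftrightarrow> Q \<rho>"
  moreover from this(2) have "P = Q" by blast
  ultimately show ?thesis by simp
qed

lemma dnf_conj_basic:
  assumes ps: "\<forall>p\<in>set ps. polyfn A p" and q: "polyfn A q"
  shows "dnf A Q \<Longrightarrow> dnf A (\<lambda>\<rho>. ((\<forall>p\<in>set ps. p \<rho> = 0) \<and> q \<rho> \<noteq> 0) \<and> Q \<rho>)"
proof (induction rule: dnf.induct)
  case (dnf_basic rs r)
  have "dnf A (\<lambda>\<rho>. (\<forall>p\<in>set (ps @ rs). p \<rho> = 0) \<and> q \<rho> * r \<rho> \<noteq> 0)"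
    using ps q dnf_basic by (intro dnf.dnf_basic polyfn_mult) auto
  then show ?case by (rule dnf_cong) auto
next
  case (dnf_disj P Q)
  then show ?case by (intro dnf_cong[OF dnf.dnf_disj[OF dnf_disj.IH]]) auto
qed

lemma dnf_conj: "dnf A P \<Longrightarrow> dnf A Q \<Longrightarrow> dnf A (\<lambda>\<rho>. P \<rho> \<and> Q \<rho>)"
proof (induction rule: dnf.induct)
  case (dnf_basic ps q)
  then show ?case by (rule dnf_conj_basic)
next
  case (dnf_disj P R)
  then show ?case by (intro dnf_cong[OF dnf.dnf_disj[OF dnf_disj.IH(1)[OF dnf_disj.prems] dnf_disj.IH(2)[OF dnf_disj.prems]]]) auto
qed

text \<open>Treating \<open>P\<close> and its negation together makes the case of negation
  symmetric. One inequation per disjunct is enough, because several inequations are one for their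
  product.\<close>

lemma constructible_dnf: "constructible A P \<Longrightarrow> dnf A P \<and> dnf A (\<lambda>\<rho>. \<not> P \<rho>)"
proof (induction rule: constructible.induct)
  case (constructible_eq0 p)
  have "dnf A (\<lambda>\<rho>. (\<forall>p\<in>set [p]. p \<rho> = 0) \<and> 1 \<noteq> (0::'b))"
    using constructible_eq0 by (intro dnf_basic polyfn_const) auto
  moreover have "dnf A (\<lambda>\<rho>. (\<forall>p\<in>set ([] :: (('a \<Rightarrow> 'b) \<Rightarrow> 'b) list). p \<rho> = 0) \<and> p \<rho> \<noteq> 0)"
    using constructible_eq0 by (intro dnf_basic) auto
  ultimately show ?case by simp
next
  case (constructible_conj P Q)
  have "dnf A (\<lambda>\<rho>. \<not> P \<rho> \<or> \<not> Q \<rho>)" using constructible_conj by (intro dnf_disj) auto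
  then show ?case using constructible_conj dnf_conj[of A P Q] by simp
qed simp

text \<open>The quantifier distributes over disjunctions, which leaves a system of equations and one
  inequation in the single unknown \<open>v\<close>, as handled by
  \<open>constructible_solvable_at\<close>.\<close>

lemma dnf_ex:
  assumes ac: "alg_closed TYPE('f::field)" and v: "v \<notin> A"
  shows "dnf (insert v A) (P :: ('v \<Rightarrow> 'f) \<Rightarrow> bool) \<Longrightarrow> constructible A (\<lambda>\<rho>. \<exists>c. P (\<rho>(v := c)))"
proof (induction rule: dnf.induct)
  case (dnf_basic ps q)
  \<comment> \<open>The coefficients depend only on variables in \<open>A\<close>, so they do not
    see the value at \<open>v\<close>.\<close>
  have upd: "\<phi> (\<rho>(v := c)) = \<phi> \<rho>" if "upoly A n \<phi>" for n \<phi> \<rho> c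
  proof (rule poly_eqI)
    fix i
    show "coeff (\<phi> (\<rho>(v := c))) i = coeff (\<phi> \<rho>) i"
      by (rule polyfn_cong[OF upoly_coeff[OF that]]) (use v in auto)
  qed
  have "\<exists>n \<phi>. upoly A n \<phi> \<and> (\<forall>\<rho> c. p (\<rho>(v := c)) = poly (\<phi> \<rho>) c)" if p: "polyfn (insert v A) p" for p :: "('v \<Rightarrow> 'f) \<Rightarrow> 'f"
  proof -
    obtain n \<phi> where n: "upoly A n \<phi>" "\<forall>\<rho>. p \<rho> = poly (\<phi> \<rho>) (\<rho> v)" using polyfn_insert_upoly[OF p] by blast
    then have "p (\<rho>(v := c)) = poly (\<phi> \<rho>) c" for \<rho> c by (simp add: upd[OF n(1)])
    then show ?thesis using n(1) by blast
  qed
  then have "\<forall>p :: ('v \<Rightarrow> 'f) \<Rightarrow> 'f. \<exists>x. polyfn (insert v A) p \<longrightarrow> upoly A (fst x) (snd x) \<and> (\<forall>\<rho> c. p (\<rho>(v := c)) = poly (snd x \<rho>) c)"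
    by simp
  from choice[OF this] obtain F where F: "\<forall>p :: ('v \<Rightarrow> 'f) \<Rightarrow> 'f. polyfn (insert v A) p \<longrightarrow>
      upoly A (fst (F p)) (snd (F p)) \<and> (\<forall>\<rho> c. p (\<rho>(v := c)) = poly (snd (F p) \<rho>) c)"
    by (elim exE)
  define N \<Phi> where "N = fst \<circ> F" and "\<Phi> = snd \<circ> F"
  have N: "upoly A (N p) (\<Phi> p)" "p (\<rho>(v := c)) = poly (\<Phi> p \<rho>) c" if "polyfn (insert v A) p" for p :: "('v \<Rightarrow> 'f) \<Rightarrow> 'f" and \<rho> c
    using F[rule_format, OF that] by (simp_all add: N_def \<Phi>_def)
  have "constructible A (solvable_at (map (\<lambda>p. (N p, \<Phi> p)) ps) (\<Phi> q))"
    using N dnf_basic by (intro constructible_solvable_at[OF ac, of A "N q"]) auto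
  then show ?case
    by (rule constructible_cong) (simp add: solvable_at_def N(2)[symmetric] dnf_basic fun_upd_def)
next
  case (dnf_disj P Q)
  show ?case by (rule constructible_cong[OF constructible_disj[OF dnf_disj.IH]]) blast
qed

text \<open>\<sigma> assigns a value to every variable, but only its values on \<open>S\<close> are
  read. One quantifier over \<sigma> thus stands for finitely many, which are eliminated one
  variable at a time.\<close>

lemma constructible_ex:
  fixes P :: "('v \<Rightarrow> 'f::field) \<Rightarrow> bool"
  assumes ac: "alg_closed TYPE('f)" and S: "finite S" "A \<inter> S = {}"
  shows "constructible (A \<union> S) P \<Longrightarrow> constructible A (\<lambda>\<rho>. \<exists>\<sigma>. P (\<lambda>v. if v \<in> S then \<sigma> v else \<rho> v))"
  using S
proof (induction S arbitrary: P rule: finite_induct)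
  case empty
  then show ?case by simp
next
  case (insert v S)
  have "constructible (insert v (A \<union> S)) P" using insert by simp
  then have "dnf (insert v (A \<union> S)) P" using constructible_dnf by blast
  then have "constructible (A \<union> S) (\<lambda>\<rho>. \<exists>c. P (\<rho>(v := c)))"
    using insert by (intro dnf_ex[OF ac]) auto
  then have "constructible A (\<lambda>\<rho>. \<exists>\<sigma>. \<exists>c. P ((\<lambda>v. if v \<in> S then \<sigma> v else \<rho> v)(v := c)))"
    using insert.IH insert.prems by auto
  then show ?case
  proof (rule constructible_cong, safe)
    fix \<rho> \<sigma> c assume "P ((\<lambda>v. if v \<in> S then \<sigma> v else \<rho> v)(v := c))"
    also have "(\<lambda>v. if v \<in> S then \<sigma> v else \<rho> v)(v := c) = (\<lambda>w. if w \<in> insert v S then (\<sigma>(v := c)) w else \<rho> w)"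
      using insert.hyps by auto
    finally show "\<exists>\<sigma>. P (\<lambda>w. if w \<in> insert v S then \<sigma> w else \<rho> w)" by blast
  next
    fix \<rho> \<sigma> assume "P (\<lambda>w. if w \<in> insert v S then \<sigma> w else \<rho> w)"
    also have "(\<lambda>w. if w \<in> insert v S then \<sigma> w else \<rho> w) = (\<lambda>v. if v \<in> S then \<sigma> v else \<rho> v)(v := \<sigma> v)"
      by auto
    finally show "\<exists>\<sigma> c. P ((\<lambda>v. if v \<in> S then \<sigma> v else \<rho> v)(v := c))" by blast
  qed
qed

section \<open>Generic properties\<close>

definition generically :: "'v set \<Rightarrow> (('v \<Rightarrow> 'f::field) \<Rightarrow> bool) \<Rightarrow> bool" where
  "generically A P \<longleftrightarrow> (\<exists>h. polyfn A h \<and> (\<exists>\<rho>. h \<rho> \<noteq> 0) \<and> (\<forall>\<rho>. h \<rho> \<noteq> 0 \<longrightarrow> P \<rho>))"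

lemma generically_mono: "generically A P \<Longrightarrow> (\<And>\<rho>. P \<rho> \<Longrightarrow> Q \<rho>) \<Longrightarrow> generically A Q"
  unfolding generically_def by blast

lemma generically_superset: "generically A P \<Longrightarrow> A \<subseteq> B \<Longrightarrow> generically B P"
  unfolding generically_def using polyfn_mono by blast

lemma generically_all: "(\<And>\<rho>. P \<rho>) \<Longrightarrow> generically A P"
  unfolding generically_def by (intro exI[of _ "\<lambda>\<rho>. 1"]) (auto intro: polyfn_const)

lemma generically_ex: "generically A P \<Longrightarrow> \<exists>\<rho>. P \<rho>"
  unfolding generically_def by blast

text \<open>On the line through \<open>a\<close> and \<open>b\<close> both factors become nonzero
  polynomials in \<open>t\<close>: the first does not vanish at 0, the second not at 1.\<close>

lemma polyfn_nonzero_mult: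
  assumes inf: "infinite (UNIV :: 'f::field set)"
    and p: "polyfn A p" "p a \<noteq> (0::'f)" and q: "polyfn A q" "q b \<noteq> 0"
  shows "\<exists>\<rho>. p \<rho> * q \<rho> \<noteq> 0"
proof -
  obtain P where P: "\<And>t. p (\<lambda>v. a v + t * (b v - a v)) = poly P t"
    using polyfn_line[OF p(1), of a "\<lambda>v. b v - a v"] by blast
  obtain Q where Q: "\<And>t. q (\<lambda>v. a v + t * (b v - a v)) = poly Q t"
    using polyfn_line[OF q(1), of a "\<lambda>v. b v - a v"] by blast
  have "P \<noteq> 0" using P[of 0] p(2) by auto
  moreover have "Q \<noteq> 0" using Q[of 1] q(2) by auto
  ultimately obtain t where "poly (P * Q) t \<noteq> 0" using poly_nonroot[OF inf, of "P * Q"] by auto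
  then show ?thesis using P[of t] Q[of t] by (intro exI[of _ "\<lambda>v. a v + t * (b v - a v)"]) simp
qed

lemma generically_conj:
  assumes "infinite (UNIV :: 'f::field set)"
    and "generically A (P :: ('v \<Rightarrow> 'f) \<Rightarrow> bool)" "generically A Q"
  shows "generically A (\<lambda>\<rho>. P \<rho> \<and> Q \<rho>)"
proof -
  obtain p a where p: "polyfn A p" "p a \<noteq> 0" "\<And>\<rho>. p \<rho> \<noteq> 0 \<Longrightarrow> P \<rho>" using assms(2) unfolding generically_def by blast
  obtain q b where q: "polyfn A q" "q b \<noteq> 0" "\<And>\<rho>. q \<rho> \<noteq> 0 \<Longrightarrow> Q \<rho>" using assms(3) unfolding generically_def by blast
  show ?thesis
    unfolding generically_def
    using polyfn_nonzero_mult[OF assms(1) p(1,2) q(1,2)] p(3) q(3) polyfn_mult[OF p(1) q(1)]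
    by (intro exI[of _ "\<lambda>\<rho>. p \<rho> * q \<rho>"]) auto
qed

lemma generically_ball:
  assumes "infinite (UNIV :: 'f::field set)"
  shows "finite I \<Longrightarrow> (\<And>i. i \<in> I \<Longrightarrow> generically A (P i :: ('v \<Rightarrow> 'f) \<Rightarrow> bool)) \<Longrightarrow> generically A (\<lambda>\<rho>. \<forall>i\<in>I. P i \<rho>)"
  by (induction I rule: finite_induct) (auto intro: generically_all generically_conj[OF assms])

text \<open>An equation holds identically or fails generically. For a conjunction, either both parts
  are generic, or the negation of one part is and refutes the whole.\<close>

lemma generically_dichotomy:
  assumes inf: "infinite (UNIV :: 'f::field set)"
  shows "constructible A (P :: ('v \<Rightarrow> 'f) \<Rightarrow> bool) \<Longrightarrow> generically A P \<or> generically A (\<lambda>\<rho>. \<not> P \<rho>)"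
proof (induction rule: constructible.induct)
  case (constructible_eq0 p)
  show ?case
  proof (cases "\<forall>\<rho>. p \<rho> = 0")
    case True
    then show ?thesis by (simp add: generically_all)
  next
    case False
    then show ?thesis using constructible_eq0 unfolding generically_def by blast
  qed
next
  case (constructible_conj P Q)
  then show ?case by (auto intro: generically_conj[OF inf] generically_mono)
next
  case (constructible_not P)
  then show ?case by auto
qed

text \<open>An injective renaming of variables cannot make a nonzero polynomial function vanish
  identically. It is applied to permutations of the rows and columns of a matrix.\<close>

lemma generically_subst:
  assumes P: "generically A P" and \<sigma>: "\<And>v. v \<in> A \<Longrightarrow> \<sigma> v \<in> B" "inj_on \<sigma> A"
  shows "generically B (\<lambda>\<rho>. P (\<rho> \<circ> \<sigma>))"
proof -
  obtain h a where h: "polyfn A h" "h a \<noteq> 0" "\<And>\<rho>. h \<rho> \<noteq> 0 \<Longrightarrow> P \<rho>" using P unfolding generically_def by blast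
  have "polyfn B (\<lambda>\<rho>. h (\<rho> \<circ> \<sigma>))"
    using \<sigma>(1) by (intro polyfn_subst[OF h(1)]) (auto intro: polyfn_var)
  moreover have "h ((a \<circ> the_inv_into A \<sigma>) \<circ> \<sigma>) = h a"
    by (rule polyfn_cong[OF h(1)]) (simp add: the_inv_into_f_f[OF \<sigma>(2)])
  ultimately show ?thesis
    unfolding generically_def using h(2,3)
    by (intro exI[of _ "\<lambda>\<rho>. h (\<rho> \<circ> \<sigma>)"] conjI exI[of _ "a \<circ> the_inv_into A \<sigma>"]) auto
qed

section \<open>Excess of families of subspaces\<close>

locale cayley_bigraph = group Gr for Gr :: "('g, 'b) monoid_scheme" (structure) +
  fixes g1 g2 :: 'g
  assumes finite_carrier: "finite (carrier Gr)"
    and gens_closed: "g1 \<in> carrier Gr" "g2 \<in> carrier Gr"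
begin

abbreviation "V \<equiv> carrier Gr"
abbreviation "E \<equiv> cay_edges Gr"
abbreviation "head \<equiv> edge_head Gr g1 g2"

text \<open>The equations given by the matrix are not repeated here: for an admissible family they
  already hold at the tail. Hence \<open>excess\<close> does not depend on the matrix, and families
  admissible for different matrices can be compared.\<close>

definition edge_space :: "'g set \<times> ('g \<times> nat) set \<Rightarrow> ('g \<Rightarrow> ('g \<Rightarrow> 'f::field) set) \<Rightarrow> 'g \<times> nat \<Rightarrow> ('g \<Rightarrow> 'f) set" where
  "edge_space L U f = supp_in (Gset Gr L (ECell (fst f) (snd f))) \<inter> U (head f) \<inter> U (edge_tail f)"

definition excess :: "'g set \<times> ('g \<times> nat) set \<Rightarrow> ('g \<Rightarrow> ('g \<Rightarrow> 'f::field) set) \<Rightarrow> int" where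
  "excess L U = (\<Sum>f\<in>E. int (fdim (edge_space L U f))) - (\<Sum>v\<in>V. int (fdim (U v)))"

definition admissible :: "nat \<Rightarrow> (nat \<Rightarrow> 'g \<Rightarrow> 'f::field) \<Rightarrow> 'g set \<times> ('g \<times> nat) set \<Rightarrow> ('g \<Rightarrow> ('g \<Rightarrow> 'f) set) \<Rightarrow> bool" where
  "admissible k M L U \<longleftrightarrow> (\<forall>v\<in>V. fsubspace (U v) \<and> U v \<subseteq> Ksheaf Gr k M L (VCell v))"

lemma finite_E: "finite E"
  by (simp add: cay_edges_def finite_carrier)

lemma tail_closed: "f \<in> E \<Longrightarrow> edge_tail f \<in> V"
  by (auto simp: cay_edges_def edge_tail_def)

lemma head_closed: "f \<in> E \<Longrightarrow> head f \<in> V"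
  using gens_closed by (auto simp: cay_edges_def edge_head_def gen_def)

lemma Gset_subset: "Gset Gr L P \<subseteq> V"
  by (auto simp: Gset_def)

lemma Ksheaf_iff: "a \<in> Ksheaf Gr k M L P \<longleftrightarrow> a \<in> supp_in (Gset Gr L P) \<and> (\<forall>i<k. (\<Sum>x\<in>V. a x * M i x) = 0)"
  by (auto simp: Ksheaf_def supp_in_def)

lemma Ksheaf_supp: "Ksheaf Gr k M L P \<subseteq> supp_in V"
proof
  fix a assume "a \<in> Ksheaf Gr k M L P"
  then show "a \<in> supp_in V" using Gset_subset[of L P] unfolding Ksheaf_def supp_in_def by blast
qed

lemma fsubspace_Ksheaf: "fsubspace (Ksheaf Gr k M L P)"
  by (auto simp: fsubspace_iff Ksheaf_def distrib_right sum.distrib mult.assoc sum_distrib_left[symmetric])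

lemma zero_in_Ksheaf: "(\<lambda>x. 0) \<in> Ksheaf Gr k M L P"
  by (simp add: Ksheaf_def)

lemma admissible_subspace: "admissible k M L U \<Longrightarrow> v \<in> V \<Longrightarrow> fsubspace (U v)"
  by (simp add: admissible_def)

lemma admissible_supp: "admissible k M L U \<Longrightarrow> v \<in> V \<Longrightarrow> U v \<subseteq> supp_in V"
  using Ksheaf_supp[of k M L "VCell v"] unfolding admissible_def by blast

lemma fsubspace_edge_space:
  assumes "\<And>v. v \<in> V \<Longrightarrow> fsubspace (U v)" "f \<in> E"
  shows "fsubspace (edge_space L U f)"
  unfolding edge_space_def using assms head_closed tail_closed
  by (intro fsubspace_Int fsubspace_supp_in) auto

lemma edge_space_supp: "edge_space L U f \<subseteq> supp_in V"
  using Gset_subset[of L "ECell (fst f) (snd f)"] unfolding edge_space_def supp_in_def by blast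

section \<open>The maximum excess in terms of families of vertex subspaces\<close>

lemma vemb_apply: "vemb v w (u, x) = (if u = v then w x else 0)"
  by (simp add: vemb_def)

lemma FV_supp: "FV Gr (Ksheaf Gr k M L) \<subseteq> supp_in (V \<times> V)"
proof
  fix \<phi> assume \<phi>: "\<phi> \<in> FV Gr (Ksheaf Gr k M L)"
  have "\<phi> (v, x) = 0" if "(v, x) \<notin> V \<times> V" for v x
  proof (cases "v \<in> V")
    case True
    then have "(\<lambda>x. \<phi> (v, x)) \<in> supp_in V" using \<phi> Ksheaf_supp unfolding FV_def cay_verts_def by blast
    then show ?thesis using that True by (simp add: supp_in_def)
  next
    case False
    then show ?thesis using \<phi> by (simp add: FV_def cay_verts_def)
  qed
  then show "\<phi> \<in> supp_in (V \<times> V)" by (auto simp: supp_in_def)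
qed

text \<open>The conditions on a section are imposed edge by edge, and the equations of the edge
  stalk follow from those at its tail.\<close>

lemma Gamma_ht_eq_fprod:
  assumes "U \<subseteq> FV Gr (Ksheaf Gr k M L)"
  shows "Gamma_ht Gr g1 g2 (Ksheaf Gr k M L) (\<lambda>e w. w) (\<lambda>e w. w) U = fprod E (edge_space L (\<lambda>v. {w. vemb v w \<in> U}))"
proof -
  have K: "w \<in> Ksheaf Gr k M L (VCell v)" if "vemb v w \<in> U" "v \<in> V" for v w
  proof -
    have "vemb v w \<in> FV Gr (Ksheaf Gr k M L)" using that(1) assms by blast
    then have "(\<lambda>x. vemb v w (v, x)) \<in> Ksheaf Gr k M L (VCell v)"
      using that(2) unfolding FV_def cay_verts_def by blast
    then show ?thesis by (simp add: vemb_apply)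
  qed
  have "(w \<in> Ksheaf Gr k M L (ECell (fst f) (snd f)) \<and> vemb (head f) w \<in> U \<and> vemb (edge_tail f) w \<in> U) \<longleftrightarrow>
      w \<in> edge_space L (\<lambda>v. {w. vemb v w \<in> U}) f" if "f \<in> E" for f w
    using K[of "edge_tail f" w] tail_closed[OF that] by (auto simp: edge_space_def Ksheaf_iff)
  then show ?thesis unfolding Gamma_ht_def fprod_def by (intro Collect_cong) auto
qed

lemma fsubspace_vemb:
  fixes U :: "('g \<times> 'g \<Rightarrow> 'f::field) set"
  assumes U: "fsubspace U"
  shows "fsubspace {w. vemb v w \<in> U}"
proof -
  have "vemb v (\<lambda>x. 0) = (\<lambda>x. 0 :: 'f)"
    by (auto simp: vemb_def)
  moreover have "vemb v (\<lambda>x. f x + g x) = (\<lambda>x. vemb v f x + vemb v g x)" for f g :: "'g \<Rightarrow> 'f"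
    by (auto simp: vemb_def)
  moreover have "vemb v (\<lambda>x. c * f x) = (\<lambda>x. c * vemb v f x)" for f :: "'g \<Rightarrow> 'f" and c
    by (auto simp: vemb_def)
  ultimately show ?thesis using U by (simp add: fsubspace_iff)
qed

text \<open>An element of the product is the sum of its embedded components, each of which lies in
  \<open>U\<close>.\<close>

lemma fprod_vemb_subset:
  fixes U :: "('g \<times> 'g \<Rightarrow> 'f::field) set"
  assumes "fsubspace U"
  shows "fprod V (\<lambda>v. {w. vemb v w \<in> U}) \<subseteq> U"
proof
  fix \<phi> assume \<phi>: "\<phi> \<in> fprod V (\<lambda>v. {w. vemb v w \<in> U})"
  have "(\<lambda>z. \<Sum>v\<in>V. 1 * vemb v (\<lambda>x. \<phi> (v, x)) z) \<in> U"
    using \<phi> by (intro fsubspace_sum finite_carrier assms) (auto simp: fprod_def)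
  also have "(\<lambda>z. \<Sum>v\<in>V. 1 * vemb v (\<lambda>x. \<phi> (v, x)) z) = \<phi>"
  proof
    fix z
    show "(\<Sum>v\<in>V. 1 * vemb v (\<lambda>x. \<phi> (v, x)) z) = \<phi> z"
      using \<phi> finite_carrier by (cases z) (simp add: vemb_apply fprod_def)
  qed
  finally show "\<phi> \<in> U" .
qed

text \<open>The maximum in the definition of the maximum excess may be taken over those subspaces that are
  direct sums of subspaces of the stalks at the vertices.\<close>

lemma Kmax_excess_ge_iff:
  fixes M :: "nat \<Rightarrow> 'g \<Rightarrow> 'f::field"
  shows   "m \<le> Kmax_excess Gr g1 g2 k M L \<longleftrightarrow> (\<exists>U. admissible k M L U \<and> m \<le> excess L U)"
proof -
  let ?F = "Ksheaf Gr k M L"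
  let ?G = "Gamma_ht Gr g1 g2 ?F (\<lambda>e w. w) (\<lambda>e w. w)"
  define S where "S = {int (fdim (?G U)) - int (fdim U) | U. fsubspace U \<and> U \<subseteq> FV Gr ?F}"
  have fin: "finite (V \<times> V)" "finite (E \<times> V)" using finite_carrier finite_E by auto
  have supp: "fprod E (edge_space L W) \<subseteq> supp_in (E \<times> V)" for W :: "'g \<Rightarrow> ('g \<Rightarrow> 'f) set"
    by (rule fprod_supp) (rule edge_space_supp)
  have dimG: "int (fdim (?G U)) = (\<Sum>f\<in>E. int (fdim (edge_space L (\<lambda>v. {w. vemb v w \<in> U}) f)))"
    if "fsubspace U" "U \<subseteq> FV Gr ?F" for U
    unfolding Gamma_ht_eq_fprod[OF that(2)]
    by (subst fdim_fprod[OF finite_E finite_carrier fsubspace_edge_space edge_space_supp])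
      (auto intro: fsubspace_vemb that)
  \<comment> \<open>\<open>Max\<close> needs a finite nonempty set: dimensions are bounded by the
    numbers of coordinates, and the zero subspace contributes an element.\<close>
  have "S \<subseteq> {- int (card (V \<times> V)) .. int (card (E \<times> V))}"
  proof
    fix s assume "s \<in> S"
    then obtain U where U: "fsubspace U" "U \<subseteq> FV Gr ?F" "s = int (fdim (?G U)) - int (fdim U)" unfolding S_def by blast
    have "fdim U \<le> card (V \<times> V)" using U(2) FV_supp by (intro fdim_supp_in_le fin) blast
    moreover have "fdim (?G U) \<le> card (E \<times> V)"
      unfolding Gamma_ht_eq_fprod[OF U(2)] by (intro fdim_supp_in_le fin supp)
    ultimately show "s \<in> {- int (card (V \<times> V)) .. int (card (E \<times> V))}" using U(3) by auto
  qed
  then have finS: "finite S" by (rule finite_subset) simp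
  have "fsubspace {\<lambda>x. 0 :: 'f} \<and> {\<lambda>x. 0} \<subseteq> FV Gr ?F"
    by (auto simp: fsubspace_iff FV_def zero_in_Ksheaf)
  then have "int (fdim (?G {\<lambda>x. 0})) - int (fdim {\<lambda>x :: 'g \<times> 'g. 0 :: 'f}) \<in> S"
    unfolding S_def by (intro CollectI exI[of _ "{\<lambda>x. 0}"]) simp
  then have neS: "S \<noteq> {}" by blast
  have "m \<le> Kmax_excess Gr g1 g2 k M L \<longleftrightarrow> (\<exists>s\<in>S. m \<le> s)"
    unfolding Kmax_excess_def max_excess_def S_def[symmetric] by (rule Max_ge_iff[OF finS neS])
  also have "\<dots> \<longleftrightarrow> (\<exists>U. admissible k M L U \<and> m \<le> excess L U)"
  proof safe
    fix s assume "s \<in> S" "m \<le> s"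
    then obtain U where U: "fsubspace U" "U \<subseteq> FV Gr ?F" "m \<le> int (fdim (?G U)) - int (fdim U)" unfolding S_def by blast
    \<comment> \<open>Replacing \<open>U\<close> by the sum of its vertex parts keeps the space of
      sections and can only lower the dimension that is subtracted.\<close>
    let ?U = "\<lambda>v. {w. vemb v w \<in> U}"
    have adm: "admissible k M L ?U"
      unfolding admissible_def
    proof (intro ballI conjI subsetI fsubspace_vemb U(1))
      fix v w assume v: "v \<in> V" and w: "w \<in> ?U v"
      have "(\<lambda>x. vemb v w (v, x)) \<in> Ksheaf Gr k M L (VCell v)"
        using v w U(2) unfolding FV_def cay_verts_def by blast
      then show "w \<in> Ksheaf Gr k M L (VCell v)" by (simp add: vemb_apply)
    qed
    have "(\<Sum>v\<in>V. fdim (?U v)) = fdim (fprod V ?U)"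
      using admissible_subspace[OF adm] admissible_supp[OF adm]
      by (intro fdim_fprod[OF finite_carrier finite_carrier, symmetric]) auto
    also have "\<dots> \<le> fdim U"
      using U(2) FV_supp by (intro fdim_mono[OF fin(1)] fprod_vemb_subset U(1)) blast
    finally have "(\<Sum>v\<in>V. int (fdim (?U v))) \<le> int (fdim U)" by (simp flip: of_nat_sum)
    then have "m \<le> excess L ?U" using U(3) dimG[OF U(1,2)] unfolding excess_def by simp
    then show "\<exists>U. admissible k M L U \<and> m \<le> excess L U" using adm by blast
  next
    fix U assume adm: "admissible k M L U" and m: "m \<le> excess L U"
    let ?U = "fprod V U"
    have U: "fsubspace ?U" using adm by (intro fsubspace_fprod) (rule admissible_subspace)
    have UF: "?U \<subseteq> FV Gr ?F"
      using adm unfolding fprod_def FV_def cay_verts_def admissible_def by blast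
    have z: "(\<lambda>x. 0) \<in> U v" if "v \<in> V" for v using admissible_subspace[OF adm that] by (simp add: fsubspace_iff)
    have eq: "{w. vemb v w \<in> ?U} = U v" if v: "v \<in> V" for v
    proof (intro equalityI subsetI)
      fix w assume "w \<in> {w. vemb v w \<in> ?U}"
      then have "(\<lambda>x. vemb v w (v, x)) \<in> U v" using v unfolding fprod_def by blast
      then show "w \<in> U v" by (simp add: vemb_apply)
    next
      fix w assume w: "w \<in> U v"
      have "(\<lambda>x. vemb v w (u, x)) \<in> U u" if "u \<in> V" for u
        using w z[OF that] by (cases "u = v") (simp_all add: vemb_apply)
      then show "w \<in> {w. vemb v w \<in> ?U}" using v by (auto simp: fprod_def vemb_apply)
    qed
    have "int (fdim (?G ?U)) = (\<Sum>f\<in>E. int (fdim (edge_space L U f)))"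
      unfolding dimG[OF U UF]
      by (intro sum.cong refl) (simp add: edge_space_def eq head_closed tail_closed)
    moreover have "fdim ?U = (\<Sum>v\<in>V. fdim (U v))"
      using admissible_subspace[OF adm] admissible_supp[OF adm] by (intro fdim_fprod[OF finite_carrier finite_carrier]) auto
    ultimately have "excess L U = int (fdim (?G ?U)) - int (fdim ?U)" unfolding excess_def by simp
    then show "\<exists>s\<in>S. m \<le> s" using U UF m unfolding S_def by auto
  qed
  finally show ?thesis .
qed

lemma admissible_excess_le: "admissible k M L U \<Longrightarrow> excess L U \<le> Kmax_excess Gr g1 g2 k M L"
  using Kmax_excess_ge_iff by blast

lemma Kmax_excess_attained: "\<exists>U. admissible k M L U \<and> excess L U = Kmax_excess Gr g1 g2 k M L"
proof -
  obtain U where "admissible k M L U" "Kmax_excess Gr g1 g2 k M L \<le> excess L U"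
    using Kmax_excess_ge_iff[of "Kmax_excess Gr g1 g2 k M L" k M L] by auto
  then show ?thesis using admissible_excess_le[of k M L U] by (intro exI[of _ U]) simp
qed

lemma Kmax_excess_nonneg:
  fixes M :: "nat \<Rightarrow> 'g \<Rightarrow> 'f::field"
  shows "0 \<le> Kmax_excess Gr g1 g2 k M L"
proof -
  have "admissible k M L (\<lambda>v. {\<lambda>x. 0})"
    by (auto simp: admissible_def fsubspace_iff zero_in_Ksheaf)
  moreover have "fdim {\<lambda>x::'g. 0 :: 'f} = 0" by (rule fdim_trivial) simp
  then have "0 \<le> excess L (\<lambda>v. {\<lambda>x::'g. 0 :: 'f})" by (simp add: excess_def sum_nonneg)
  ultimately show ?thesis using Kmax_excess_ge_iff by blast
qed

lemma fdim_edge_space_le: "fdim (edge_space L U f) \<le> card V"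
  by (rule fdim_supp_in_le[OF finite_carrier edge_space_supp])

lemma fdim_admissible_le: "admissible k M L U \<Longrightarrow> v \<in> V \<Longrightarrow> fdim (U v) \<le> card V"
  by (rule fdim_supp_in_le[OF finite_carrier admissible_supp])

lemma Kmax_excess_le:
  fixes M :: "nat \<Rightarrow> 'g \<Rightarrow> 'f::field"
  shows "Kmax_excess Gr g1 g2 k M L \<le> int (card E * card V)"
proof -
  obtain U :: "'g \<Rightarrow> ('g \<Rightarrow> 'f) set" where U: "excess L U = Kmax_excess Gr g1 g2 k M L"
    using Kmax_excess_attained[of k M L] by blast
  have "excess L U \<le> (\<Sum>f\<in>E. int (fdim (edge_space L U f)))" by (simp add: excess_def sum_nonneg)
  also have "\<dots> \<le> (\<Sum>f\<in>E. int (card V))" by (intro sum_mono) (simp add: fdim_edge_space_le)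
  finally show ?thesis using U by simp
qed

text \<open>Vertex terms are modular. At an edge, the space for the intersection is the intersection
  of the two spaces, while the space for the sum may be larger than their sum; this gives the
  inequality.\<close>

lemma excess_supermodular:
  assumes U: "\<And>v. v \<in> V \<Longrightarrow> fsubspace (U v) \<and> U v \<subseteq> supp_in V"
    and W: "\<And>v. v \<in> V \<Longrightarrow> fsubspace (W v) \<and> W v \<subseteq> supp_in V"
  shows "excess L U + excess L W \<le> excess L (\<lambda>v. U v \<inter> W v) + excess L (\<lambda>v. fplus (U v) (W v))"
proof -
  have edge: "fdim (edge_space L U f) + fdim (edge_space L W f) \<le>
      fdim (edge_space L (\<lambda>v. U v \<inter> W v) f) + fdim (edge_space L (\<lambda>v. fplus (U v) (W v)) f)" if f: "f \<in> E" for f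
  proof -
    let ?A = "edge_space L U f" and ?B = "edge_space L W f"
    have up: "U v \<subseteq> fplus (U v) (W v)" "W v \<subseteq> fplus (U v) (W v)" if "v \<in> V" for v
      using fplus_upper[of "U v" "W v"] U[OF that] W[OF that] by simp_all
    have sub: "fsubspace ?A" "fsubspace ?B" using f U W by (auto intro: fsubspace_edge_space)
    have "fdim ?A + fdim ?B = fdim (fplus ?A ?B) + fdim (?A \<inter> ?B)"
      using fdim_fplus_Int[OF finite_carrier edge_space_supp edge_space_supp sub] by simp
    also have "?A \<inter> ?B = edge_space L (\<lambda>v. U v \<inter> W v) f" by (auto simp: edge_space_def)
    also have "fdim (fplus ?A ?B) \<le> fdim (edge_space L (\<lambda>v. fplus (U v) (W v)) f)"
    proof (intro fdim_mono[OF finite_carrier edge_space_supp] fplus_least fsubspace_edge_space f)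
      show "fsubspace (fplus (U v) (W v))" if "v \<in> V" for v using U W that fsubspace_fplus by blast
      show "?A \<subseteq> edge_space L (\<lambda>v. fplus (U v) (W v)) f" "?B \<subseteq> edge_space L (\<lambda>v. fplus (U v) (W v)) f"
        using up[OF head_closed[OF f]] up[OF tail_closed[OF f]] unfolding edge_space_def by blast+
    qed
    finally show ?thesis by simp
  qed
  have vert: "fdim (U v) + fdim (W v) = fdim (U v \<inter> W v) + fdim (fplus (U v) (W v))" if "v \<in> V" for v
    using fdim_fplus_Int[OF finite_carrier, of "U v" "W v"] U[OF that] W[OF that] by simp
  have "(\<Sum>f\<in>E. int (fdim (edge_space L U f) + fdim (edge_space L W f))) \<le>
    (\<Sum>f\<in>E. int (fdim (edge_space L (\<lambda>v. U v \<inter> W v) f) + fdim (edge_space L (\<lambda>v. fplus (U v) (W v)) f)))"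
    using edge by (intro sum_mono) (simp only: of_nat_le_iff)
  moreover have "(\<Sum>v\<in>V. int (fdim (U v) + fdim (W v))) = (\<Sum>v\<in>V. int (fdim (U v \<inter> W v) + fdim (fplus (U v) (W v))))"
    using vert by (intro sum.cong) auto
  ultimately show ?thesis unfolding excess_def by (simp add: sum.distrib)
qed

lemma admissible_fplus:
  assumes "admissible k M L U" "admissible k M L W"
  shows "admissible k M L (\<lambda>v. fplus (U v) (W v))"
  using assms unfolding admissible_def by (simp add: fsubspace_fplus fplus_least fsubspace_Ksheaf)

text \<open>\<open>U\<close> and \<open>W\<close> see the first \<open>j\<close> rows and one further row each; their sum sees
  \<open>j\<close> rows and their intersection \<open>j + 2\<close>.\<close>

lemma Kmax_excess_convex:
  assumes rows: "\<And>i x. i < j \<Longrightarrow> M i x = N i x" "\<And>x. N j x = M (Suc j) x"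
  shows "Kmax_excess Gr g1 g2 (Suc j) M L + Kmax_excess Gr g1 g2 (Suc j) N L
    \<le> Kmax_excess Gr g1 g2 j M L + Kmax_excess Gr g1 g2 (Suc (Suc j)) M L"
proof -
  obtain U where U: "admissible (Suc j) M L U" "excess L U = Kmax_excess Gr g1 g2 (Suc j) M L"
    using Kmax_excess_attained by blast
  obtain W where W: "admissible (Suc j) N L W" "excess L W = Kmax_excess Gr g1 g2 (Suc j) N L"
    using Kmax_excess_attained by blast
  have "Ksheaf Gr (Suc j) M L P \<subseteq> Ksheaf Gr j M L P" for P by (auto simp: Ksheaf_def)
  moreover have "Ksheaf Gr (Suc j) N L P \<subseteq> Ksheaf Gr j M L P" for P
    using rows(1) by (auto simp: Ksheaf_def)
  ultimately have "admissible j M L U" "admissible j M L W"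
    using U(1) W(1) unfolding admissible_def by blast+
  then have 1: "admissible j M L (\<lambda>v. fplus (U v) (W v))" by (rule admissible_fplus)
  have "Ksheaf Gr (Suc j) M L P \<inter> Ksheaf Gr (Suc j) N L P \<subseteq> Ksheaf Gr (Suc (Suc j)) M L P" for P
    using rows by (auto simp: Ksheaf_def less_Suc_eq)
  then have 2: "admissible (Suc (Suc j)) M L (\<lambda>v. U v \<inter> W v)"
    using U(1) W(1) fsubspace_Int unfolding admissible_def by blast
  have "excess L U + excess L W \<le> excess L (\<lambda>v. U v \<inter> W v) + excess L (\<lambda>v. fplus (U v) (W v))"
    using U(1) W(1) admissible_supp admissible_subspace by (intro excess_supermodular) blast+
  then show ?thesis using admissible_excess_le[OF 1] admissible_excess_le[OF 2] U(2) W(2) by linarith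
qed

section \<open>The minimal maximizer and its dimensions\<close>

definition total_dim :: "('g \<Rightarrow> ('g \<Rightarrow> 'f::field) set) \<Rightarrow> nat" where
  "total_dim U = (\<Sum>v\<in>V. fdim (U v))"

text \<open>By supermodularity the intersection of two maximizers is again a maximizer. Its total
  dimension cannot be smaller than that of \<open>U\<close>, so both families coincide with
  it.\<close>

lemma minimal_maximizer_unique:
  assumes U: "admissible k M L U" "excess L U = Kmax_excess Gr g1 g2 k M L"
    and min: "\<And>W. admissible k M L W \<Longrightarrow> excess L W = Kmax_excess Gr g1 g2 k M L \<Longrightarrow> total_dim U \<le> total_dim W"
    and W: "admissible k M L W" "excess L W = Kmax_excess Gr g1 g2 k M L" "total_dim W \<le> total_dim U"
    and v: "v \<in> V"
  shows "W v = U v"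
proof -
  let ?I = "\<lambda>v. U v \<inter> W v"
  have I: "admissible k M L ?I"
    using U(1) W(1) fsubspace_Int unfolding admissible_def by blast
  have "excess L U + excess L W \<le> excess L ?I + excess L (\<lambda>v. fplus (U v) (W v))"
    using U(1) W(1) admissible_supp admissible_subspace by (intro excess_supermodular) blast+
  then have "excess L ?I = Kmax_excess Gr g1 g2 k M L"
    using admissible_excess_le[OF I] admissible_excess_le[OF admissible_fplus[OF U(1) W(1)]] U(2) W(2) by linarith
  then have I_min: "total_dim U \<le> total_dim ?I" using min I by blast
  \<comment> \<open>A family that contains the intersection and has no larger total dimension equals
    it at each vertex.\<close>
  have *: "U' v = ?I v" if U': "admissible k M L U'" "\<And>v. v \<in> V \<Longrightarrow> ?I v \<subseteq> U' v" "total_dim U' \<le> total_dim ?I" for U'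
  proof -
    have le: "fdim (?I u) \<le> fdim (U' u)" if "u \<in> V" for u
      using U'(2)[OF that] admissible_supp[OF U'(1) that] by (intro fdim_mono[OF finite_carrier])
    have "fdim (U' v) \<le> fdim (?I v)"
    proof (rule ccontr)
      assume "\<not> fdim (U' v) \<le> fdim (?I v)"
      then have "total_dim ?I < total_dim U'"
        unfolding total_dim_def using le v by (intro sum_strict_mono_ex1 finite_carrier) (auto intro!: bexI[of _ v])
      then show False using U'(3) by simp
    qed
    then show "U' v = ?I v"
      using fsubspace_eqI[OF finite_carrier admissible_supp[OF U'(1) v] admissible_subspace[OF I v] U'(2)[OF v]] by simp
  qed
  have "U v = ?I v" using U(1) I_min by (intro *) auto
  moreover have "W v = ?I v" using W(1,3) I_min by (intro *) auto
  ultimately show ?thesis by blast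
qed

text \<open>Bounds in these two directions already certify an excess of at least the difference of
  the sums, and each of them can be witnessed by vectors.\<close>

definition fits :: "'g set \<times> ('g \<times> nat) set \<Rightarrow> nat \<Rightarrow> ('g \<Rightarrow> nat) \<Rightarrow> ('g \<times> nat \<Rightarrow> nat) \<Rightarrow> (nat \<Rightarrow> 'g \<Rightarrow> 'f::field) \<Rightarrow> bool" where
  "fits L k d c M \<longleftrightarrow> (\<exists>U. admissible k M L U \<and> (\<forall>v\<in>V. fdim (U v) \<le> d v) \<and> (\<forall>f\<in>E. c f \<le> fdim (edge_space L U f)))"

abbreviation "vdims \<equiv> V \<rightarrow>\<^sub>E {..card V}"
abbreviation "edims \<equiv> E \<rightarrow>\<^sub>E {..card V}"

lemma finite_dims: "finite vdims" "finite edims"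
  by (auto intro: finite_PiE finite_carrier finite_E)

lemma sum_E: "(\<Sum>f\<in>E. h f) = (\<Sum>g\<in>V. h (g, 1)) + (\<Sum>g\<in>V. h (g, 2))"
proof -
  have "(\<Sum>f\<in>E. h f) = (\<Sum>g\<in>V. \<Sum>i\<in>{1, 2::nat}. h (g, i))"
    unfolding cay_edges_def by (simp only: sum.cartesian_product) (simp add: case_prod_unfold)
  then show ?thesis by (simp add: sum.distrib)
qed

text \<open>All dimensions are at most the group order, so a finite disjunction over pairs of
  dimension vectors is enough.\<close>

lemma Kmax_excess_ge_iff_fits:
  "m \<le> Kmax_excess Gr g1 g2 k M L \<longleftrightarrow>
    (\<exists>d\<in>vdims. \<exists>c\<in>edims. m \<le> (\<Sum>f\<in>E. int (c f)) - (\<Sum>v\<in>V. int (d v)) \<and> fits L k d c M)"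
  unfolding Kmax_excess_ge_iff
proof safe
  fix U assume U: "admissible k M L U" "m \<le> excess L U"
  let ?d = "restrict (\<lambda>v. fdim (U v)) V" and ?c = "restrict (\<lambda>f. fdim (edge_space L U f)) E"
  have "?d \<in> vdims" using fdim_admissible_le[OF U(1)] by auto
  moreover have "?c \<in> edims" using fdim_edge_space_le[of L U] by (intro restrict_PiE_iff[THEN iffD2]) auto
  moreover have "m \<le> (\<Sum>f\<in>E. int (?c f)) - (\<Sum>v\<in>V. int (?d v))" using U(2) by (simp add: excess_def)
  moreover have "fits L k ?d ?c M" unfolding fits_def using U(1) by auto
  ultimately show "\<exists>d\<in>vdims. \<exists>c\<in>edims. m \<le> (\<Sum>f\<in>E. int (c f)) - (\<Sum>v\<in>V. int (d v)) \<and> fits L k d c M" by blast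
next
  fix d c assume m: "m \<le> (\<Sum>f\<in>E. int (c f)) - (\<Sum>v\<in>V. int (d v))" and "fits L k d c M"
  then obtain U where U: "admissible k M L U" "\<forall>v\<in>V. fdim (U v) \<le> d v" "\<forall>f\<in>E. c f \<le> fdim (edge_space L U f)"
    unfolding fits_def by blast
  have "(\<Sum>f\<in>E. int (c f)) \<le> (\<Sum>f\<in>E. int (fdim (edge_space L U f)))" using U(3) by (intro sum_mono) auto
  moreover have "(\<Sum>v\<in>V. int (fdim (U v))) \<le> (\<Sum>v\<in>V. int (d v))" using U(2) by (intro sum_mono) auto
  ultimately have "m \<le> excess L U" using m unfolding excess_def by linarith
  then show "\<exists>U. admissible k M L U \<and> m \<le> excess L U" using U(1) by blast
qed

lemma sum_translate: "y \<in> V \<Longrightarrow> (\<Sum>v\<in>V. h (v \<otimes> y)) = (\<Sum>v\<in>V. h v)"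
  by (rule sum.reindex_bij_betw, rule bij_betwI[where g = "\<lambda>v. v \<otimes> inv y"]) (auto simp: m_assoc)

text \<open>By uniqueness, the minimal maximizer inherits the translation invariance of the attainable
  dimension vectors.\<close>

lemma card_dvd_Kmax_excess:
  fixes M :: "nat \<Rightarrow> 'g \<Rightarrow> 'f::field"
  assumes inv: "\<And>d c y. d \<in> vdims \<Longrightarrow> c \<in> edims \<Longrightarrow> y \<in> V \<Longrightarrow> fits L k d c M \<Longrightarrow>
      fits L k (\<lambda>v. d (v \<otimes> y)) (\<lambda>(g, i). c (g \<otimes> y, i)) M"
  shows "int (card V) dvd Kmax_excess Gr g1 g2 k M L"
proof -
  let ?P = "\<lambda>U. admissible k M L U \<and> excess L U = Kmax_excess Gr g1 g2 k M L"
  obtain U0 where "?P U0" using Kmax_excess_attained by blast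
  from ex_has_least_nat[of ?P, OF this, of total_dim]
  obtain U where U: "?P U" and min: "\<And>W. ?P W \<Longrightarrow> total_dim U \<le> total_dim W" by blast
  let ?d = "restrict (\<lambda>v. fdim (U v)) V" and ?c = "restrict (\<lambda>f. fdim (edge_space L U f)) E"
  have dc: "?d \<in> vdims" "?c \<in> edims"
    using fdim_admissible_le[of k M L U] U fdim_edge_space_le[of L U] by (auto intro!: restrict_PiE_iff[THEN iffD2])
  have fits: "fits L k ?d ?c M" unfolding fits_def using U by auto
  have Eiff: "(g, i) \<in> E \<longleftrightarrow> g \<in> V \<and> i \<in> {1, 2}" for g i by (auto simp: cay_edges_def)
  have const: "fdim (U (v \<otimes> y)) = fdim (U v)" "\<And>i. i \<in> {1, 2} \<Longrightarrow> fdim (edge_space L U (v \<otimes> y, i)) = fdim (edge_space L U (v, i))"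
    if y: "y \<in> V" and v: "v \<in> V" for y v
  proof -
    \<comment> \<open>\<open>W\<close> fits the translated dimensions of \<open>U\<close>.
      Translation preserves sums, so \<open>W\<close> has at least the excess of \<open>U\<close>
      and no larger total dimension; by uniqueness \<open>W\<close> agrees with \<open>U\<close> on
      \<open>V\<close>.\<close>
    obtain W where W: "admissible k M L W" and "\<forall>v\<in>V. fdim (W v) \<le> ?d (v \<otimes> y)"
      and "\<forall>f\<in>E. (case f of (g, i) \<Rightarrow> ?c (g \<otimes> y, i)) \<le> fdim (edge_space L W f)"
      using inv[OF dc y fits] unfolding fits_def by blast
    note W_dims = this
    have Wd: "fdim (W v) \<le> fdim (U (v \<otimes> y))" if "v \<in> V" for v
      using W_dims(2) that y by simp
    have Wc: "fdim (edge_space L U (g \<otimes> y, i)) \<le> fdim (edge_space L W (g, i))" if "g \<in> V" "i \<in> {1, 2}" for g i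
    proof -
      have "(g, i) \<in> E" "(g \<otimes> y, i) \<in> E" using that y by (simp_all add: Eiff)
      then show ?thesis using bspec[OF W_dims(3), of "(g, i)"] by simp
    qed
    have sd: "(\<Sum>v\<in>V. fdim (U (v \<otimes> y))) = total_dim U"
      unfolding total_dim_def by (rule sum_translate[OF y])
    have sc: "(\<Sum>g\<in>V. fdim (edge_space L U (g \<otimes> y, i))) = (\<Sum>g\<in>V. fdim (edge_space L U (g, i)))" for i
      using sum_translate[OF y, of "\<lambda>g. fdim (edge_space L U (g, i))"] .
    have d_le: "total_dim W \<le> total_dim U" unfolding sd[symmetric] unfolding total_dim_def by (intro sum_mono Wd)
    have c_le: "(\<Sum>g\<in>V. fdim (edge_space L U (g, i))) \<le> (\<Sum>g\<in>V. fdim (edge_space L W (g, i)))" if "i \<in> {1, 2}" for i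
      unfolding sc[of i, symmetric] using that by (intro sum_mono Wc)
    have ex: "excess L U' = int (\<Sum>g\<in>V. fdim (edge_space L U' (g, 1))) + int (\<Sum>g\<in>V. fdim (edge_space L U' (g, 2))) - int (total_dim U')"
      for U' :: "'g \<Rightarrow> ('g \<Rightarrow> 'f) set" by (simp add: excess_def sum_E total_dim_def)
    have "excess L W \<le> excess L U" using U admissible_excess_le[OF W] by simp
    then have "total_dim W = total_dim U"
      and exW: "excess L W = excess L U"
      using c_le[OF insertI1] c_le[OF insertI2[OF singletonI]] d_le unfolding ex by linarith+
    then have WU: "W v = U v" if "v \<in> V" for v
      using minimal_maximizer_unique[of k M L U W v] U W min that by auto
    have "edge_space L W f = edge_space L U f" if "f \<in> E" for f
      using WU head_closed[OF that] tail_closed[OF that] by (simp add: edge_space_def)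
    then have Wc': "fdim (edge_space L U (g \<otimes> y, i)) \<le> fdim (edge_space L U (g, i))" if "g \<in> V" "i \<in> {1, 2}" for g i
      using Wc[OF that] that by (simp add: Eiff)
    \<comment> \<open>A pointwise inequality between two functions with equal sums over the group is
      an equality.\<close>
    show "fdim (U (v \<otimes> y)) = fdim (U v)"
    proof (rule ccontr)
      assume "fdim (U (v \<otimes> y)) \<noteq> fdim (U v)"
      then have "fdim (U v) < fdim (U (v \<otimes> y))" using Wd[OF v] WU[OF v] by simp
      then have "(\<Sum>v\<in>V. fdim (U v)) < (\<Sum>v\<in>V. fdim (U (v \<otimes> y)))"
        using v Wd WU by (intro sum_strict_mono_ex1 finite_carrier) auto
      then show False using sd by (simp add: total_dim_def)
    qed
    show "fdim (edge_space L U (v \<otimes> y, i)) = fdim (edge_space L U (v, i))" if i: "i \<in> {1, 2}" for i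
    proof (rule ccontr)
      assume "fdim (edge_space L U (v \<otimes> y, i)) \<noteq> fdim (edge_space L U (v, i))"
      then have "fdim (edge_space L U (v \<otimes> y, i)) < fdim (edge_space L U (v, i))" using Wc'[OF v i] by simp
      then have "(\<Sum>g\<in>V. fdim (edge_space L U (g \<otimes> y, i))) < (\<Sum>g\<in>V. fdim (edge_space L U (g, i)))"
        using v Wc'[OF _ i] by (intro sum_strict_mono_ex1 finite_carrier) auto
      then show False using sc by simp
    qed
  qed
  have d1: "fdim (U v) = fdim (U \<one>)" if "v \<in> V" for v
    using const(1)[OF that one_closed] unfolding l_one[OF that] .
  have c1: "fdim (edge_space L U (v, i)) = fdim (edge_space L U (\<one>, i))" if "v \<in> V" "i \<in> {1, 2}" for v i
    using const(2)[OF that(1) one_closed that(2)] unfolding l_one[OF that(1)] .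
  have "(\<Sum>v\<in>V. int (fdim (U v))) = (\<Sum>v\<in>V. int (fdim (U \<one>)))"
    by (intro sum.cong refl arg_cong[of _ _ int] d1)
  moreover have "(\<Sum>v\<in>V. int (fdim (edge_space L U (v, i)))) = (\<Sum>v\<in>V. int (fdim (edge_space L U (\<one>, i))))"
    if "i \<in> {1, 2}" for i
    using that by (intro sum.cong refl arg_cong[of _ _ int] c1)
  ultimately have "excess L U = int (card V) * (int (fdim (edge_space L U (\<one>, 1))) + int (fdim (edge_space L U (\<one>, 2))) - int (fdim (U \<one>)))"
    by (simp add: excess_def sum_E right_diff_distrib distrib_left)
  then show ?thesis using U by (simp add: dvd_def)
qed

end

section \<open>Generic matrices\<close>

text \<open>Besides the entries of the matrix, these are the coordinates of witnesses for
  \<open>fits\<close>: spanning vectors at the vertices, independent vectors at the edges, their coefficients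
  with respect to the spanning vectors at head and tail, and scalars of a linear relation.\<close>

datatype 'g var = Entry nat 'g | VVec 'g nat 'g | EVec "'g \<times> nat" nat 'g
  | HCoef "'g \<times> nat" nat nat | TCoef "'g \<times> nat" nat nat | Scal nat

definition mat_of :: "('g var \<Rightarrow> 'f) \<Rightarrow> nat \<Rightarrow> 'g \<Rightarrow> 'f" where
  "mat_of \<rho> = (\<lambda>i x. \<rho> (Entry i x))"

context cayley_bigraph
begin

definition entries :: "nat \<Rightarrow> 'g var set" where
  "entries k = (\<lambda>(i, x). Entry i x) ` ({..<k} \<times> V)"

lemma Entry_in_entries [simp]: "Entry i x \<in> entries k \<longleftrightarrow> i < k \<and> x \<in> V"
  by (auto simp: entries_def)

lemma entries_mono: "j \<le> k \<Longrightarrow> entries j \<subseteq> entries k"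
  by (auto simp: entries_def)

text \<open>Apart from the last conjunct these are polynomial equations in finitely many variables.
  The universal quantifier over scalars in that conjunct is eliminated separately, by
  \<open>constructible_independent\<close>.\<close>

definition fit_witness :: "'g set \<times> ('g \<times> nat) set \<Rightarrow> nat \<Rightarrow> ('g \<Rightarrow> nat) \<Rightarrow> ('g \<times> nat \<Rightarrow> nat) \<Rightarrow> ('g var \<Rightarrow> 'f::field) \<Rightarrow> bool" where
  "fit_witness L k d c \<rho> \<longleftrightarrow>
    (\<forall>v\<in>V. \<forall>i<d v. (\<forall>x\<in>V. x \<notin> Gset Gr L (VCell v) \<longrightarrow> \<rho> (VVec v i x) = 0) \<and>
      (\<forall>r<k. (\<Sum>x\<in>V. \<rho> (VVec v i x) * \<rho> (Entry r x)) = 0)) \<and>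
    (\<forall>f\<in>E. \<forall>i<c f. \<forall>x\<in>V. (x \<notin> Gset Gr L (ECell (fst f) (snd f)) \<longrightarrow> \<rho> (EVec f i x) = 0) \<and>
      \<rho> (EVec f i x) = (\<Sum>l<d (head f). \<rho> (HCoef f i l) * \<rho> (VVec (head f) l x)) \<and>
      \<rho> (EVec f i x) = (\<Sum>l<d (edge_tail f). \<rho> (TCoef f i l) * \<rho> (VVec (edge_tail f) l x))) \<and>
    (\<forall>f\<in>E. \<forall>s. (\<forall>x\<in>V. (\<Sum>i<c f. s i * \<rho> (EVec f i x)) = 0) \<longrightarrow> (\<forall>i<c f. s i = 0))"

lemma fits_imp_fit_witness:
  assumes "fits L k d c (mat_of \<rho>)"
  shows "\<exists>\<sigma>. (\<forall>r x. \<sigma> (Entry r x) = \<rho> (Entry r x)) \<and> fit_witness L k d c \<sigma>"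
proof -
  obtain U where U: "admissible k (mat_of \<rho>) L U" "\<And>v. v \<in> V \<Longrightarrow> fdim (U v) \<le> d v"
    "\<And>f. f \<in> E \<Longrightarrow> c f \<le> fdim (edge_space L U f)"
    using assms unfolding fits_def by blast
  have "\<forall>v\<in>V. \<exists>u. (\<forall>i<d v. u i \<in> U v) \<and> (\<forall>a\<in>U v. \<exists>c. a = (\<lambda>x. \<Sum>i<d v. c i * u i x))"
    using U(2) fdim_le_iff_spanning[OF finite_carrier admissible_supp[OF U(1)] admissible_subspace[OF U(1)]] by blast
  from bchoice[OF this] obtain u where u: "\<forall>v\<in>V. (\<forall>i<d v. u v i \<in> U v) \<and> (\<forall>a\<in>U v. \<exists>c. a = (\<lambda>x. \<Sum>i<d v. c i * u v i x))"
    by (elim exE)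
  have "\<forall>f\<in>E. \<exists>w. (\<forall>i<c f. w i \<in> edge_space L U f) \<and>
      (\<forall>s. (\<forall>x\<in>V. (\<Sum>i<c f. s i * w i x) = 0) \<longrightarrow> (\<forall>i<c f. s i = 0))"
    using U(3) fdim_ge_iff_independent[OF finite_carrier edge_space_supp fsubspace_edge_space] admissible_subspace[OF U(1)] by blast
  from bchoice[OF this] obtain w where w: "\<forall>f\<in>E. (\<forall>i<c f. w f i \<in> edge_space L U f) \<and>
      (\<forall>s. (\<forall>x\<in>V. (\<Sum>i<c f. s i * w f i x) = 0) \<longrightarrow> (\<forall>i<c f. s i = 0))"
    by (elim exE)
  have w_mem: "w f i \<in> supp_in (Gset Gr L (ECell (fst f) (snd f)))" "w f i \<in> U (head f)" "w f i \<in> U (edge_tail f)"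
    if "f \<in> E" "i < c f" for f i
    using w that unfolding edge_space_def by blast+
  define coef where "coef = (\<lambda>v a. SOME c. a = (\<lambda>x. \<Sum>i<d v. c i * u v i x))"
  have coef: "a = (\<lambda>x. \<Sum>i<d v. coef v a i * u v i x)" if "v \<in> V" "a \<in> U v" for v a
  proof -
    have "\<exists>c. a = (\<lambda>x. \<Sum>i<d v. c i * u v i x)" using u that by blast
    from someI_ex[OF this] show ?thesis unfolding coef_def .
  qed
  have coef': "a x = (\<Sum>i<d v. coef v a i * u v i x)" if "v \<in> V" "a \<in> U v" for v a x
    using fun_cong[OF coef[OF that], of x] .
  \<comment> \<open>Matrix entries are kept, the chosen vectors and coefficients are written into
    their own variables, and the scalars get a default value.\<close>
  define \<sigma> where "\<sigma> = (\<lambda>z. case z of Entry r x \<Rightarrow> \<rho> (Entry r x) | VVec v i x \<Rightarrow> u v i x | EVec f i x \<Rightarrow> w f i x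
    | HCoef f i l \<Rightarrow> coef (head f) (w f i) l | TCoef f i l \<Rightarrow> coef (edge_tail f) (w f i) l | Scal i \<Rightarrow> 0)"
  have "u v i \<in> Ksheaf Gr k (mat_of \<rho>) L (VCell v)" if "v \<in> V" "i < d v" for v i
    using u U(1) that unfolding admissible_def by blast
  then have uK: "\<forall>v\<in>V. \<forall>i<d v. (\<forall>x\<in>V. x \<notin> Gset Gr L (VCell v) \<longrightarrow> u v i x = 0) \<and>
      (\<forall>r<k. (\<Sum>x\<in>V. u v i x * \<rho> (Entry r x)) = 0)"
    by (auto simp: Ksheaf_def mat_of_def)
  have "fit_witness L k d c \<sigma>"
    unfolding fit_witness_def
  proof (intro conjI ballI allI impI)
    fix f i x assume f: "f \<in> E" and i: "i < c f" and x: "x \<in> V"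
    show "\<sigma> (EVec f i x) = (\<Sum>l<d (head f). \<sigma> (HCoef f i l) * \<sigma> (VVec (head f) l x))"
      using coef'[OF head_closed[OF f] w_mem(2)[OF f i], of x] by (simp add: \<sigma>_def)
    show "\<sigma> (EVec f i x) = (\<Sum>l<d (edge_tail f). \<sigma> (TCoef f i l) * \<sigma> (VVec (edge_tail f) l x))"
      using coef'[OF tail_closed[OF f] w_mem(3)[OF f i], of x] by (simp add: \<sigma>_def)
    show "\<sigma> (EVec f i x) = 0" if "x \<notin> Gset Gr L (ECell (fst f) (snd f))"
      using w_mem(1)[OF f i] that by (simp add: \<sigma>_def supp_in_def)
  next
    fix f s i assume "f \<in> E" "\<forall>x\<in>V. (\<Sum>i<c f. s i * \<sigma> (EVec f i x)) = 0" "i < c f"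
    then show "s i = 0" using w by (simp add: \<sigma>_def)
  qed (use uK in \<open>auto simp: \<sigma>_def\<close>)
  then show ?thesis by (intro exI[of _ \<sigma>]) (simp add: \<sigma>_def)
qed

lemma fit_witness_imp_fits:
  assumes "fit_witness L k d c \<sigma>" "\<And>r x. r < k \<Longrightarrow> x \<in> V \<Longrightarrow> \<sigma> (Entry r x) = \<rho> (Entry r x)"
  shows "fits L k d c (mat_of \<rho>)"
proof -
  \<comment> \<open>The witness says nothing about coordinates outside \<open>V\<close>, so the
    vectors are cut off there.\<close>
  define u where "u = (\<lambda>v i x. if x \<in> V then \<sigma> (VVec v i x) else 0)"
  define w where "w = (\<lambda>f i x. if x \<in> V then \<sigma> (EVec f i x) else 0)"
  define U where "U = (\<lambda>v. range (\<lambda>s x. \<Sum>i<d v. s i * u v i x))"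
  have U_comb: "(\<lambda>x. \<Sum>i<d v. s i * u v i x) \<in> U v" for s v by (simp add: U_def)
  have U_sub: "fsubspace (U v)" for v
    unfolding fsubspace_iff
  proof (intro conjI ballI allI)
    show "(\<lambda>x. 0) \<in> U v" using U_comb[of "\<lambda>i. 0" v] by simp
    fix f assume "f \<in> U v"
    then obtain s where s: "f = (\<lambda>x. \<Sum>i<d v. s i * u v i x)" unfolding U_def by blast
    show "(\<lambda>x. a * f x) \<in> U v" for a
      using U_comb[of "\<lambda>i. a * s i" v] by (simp add: s sum_distrib_left mult.assoc)
    fix g assume "g \<in> U v"
    then obtain t where t: "g = (\<lambda>x. \<Sum>i<d v. t i * u v i x)" unfolding U_def by blast
    show "(\<lambda>x. f x + g x) \<in> U v"
      using U_comb[of "\<lambda>i. s i + t i" v] by (simp add: s t distrib_right sum.distrib)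
  qed
  have u_mem: "u v i \<in> U v" if "i < d v" for v i
  proof -
    have "u v i = (\<lambda>x. \<Sum>l<d v. (if l = i then 1 else 0) * u v l x)"
      using that by (simp add: if_distrib[of "\<lambda>t. t * _"] cong: if_cong)
    then show ?thesis using U_comb[of "\<lambda>l. if l = i then 1 else 0" v] by simp
  qed
  have "u v i \<in> Ksheaf Gr k (mat_of \<rho>) L (VCell v)" if "v \<in> V" "i < d v" for v i
    using assms that Gset_subset[of L "VCell v"]
    unfolding fit_witness_def Ksheaf_def u_def mat_of_def by simp
  then have "(\<lambda>x. \<Sum>i<d v. s i * u v i x) \<in> Ksheaf Gr k (mat_of \<rho>) L (VCell v)" if "v \<in> V" for v s
    using that by (intro fsubspace_sum fsubspace_Ksheaf) auto
  then have adm: "admissible k (mat_of \<rho>) L U"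
    unfolding admissible_def using U_sub by (auto simp: U_def)
  have "fdim (U v) \<le> d v" if v: "v \<in> V" for v
    unfolding fdim_le_iff_spanning[OF finite_carrier admissible_supp[OF adm v] U_sub]
    using u_mem by (intro exI[of _ "u v"]) (auto simp: U_def)
  moreover have "c f \<le> fdim (edge_space L U f)" if f: "f \<in> E" for f
    unfolding fdim_ge_iff_independent[OF finite_carrier edge_space_supp fsubspace_edge_space[OF U_sub f]]
  proof (intro exI[of _ "w f"] conjI allI impI)
    fix i assume i: "i < c f"
    have *: "\<forall>x\<in>V. (x \<notin> Gset Gr L (ECell (fst f) (snd f)) \<longrightarrow> \<sigma> (EVec f i x) = 0) \<and>
      \<sigma> (EVec f i x) = (\<Sum>l<d (head f). \<sigma> (HCoef f i l) * \<sigma> (VVec (head f) l x)) \<and>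
      \<sigma> (EVec f i x) = (\<Sum>l<d (edge_tail f). \<sigma> (TCoef f i l) * \<sigma> (VVec (edge_tail f) l x))"
      using assms(1) f i unfolding fit_witness_def by blast
    have "w f i = (\<lambda>x. \<Sum>l<d (head f). \<sigma> (HCoef f i l) * u (head f) l x)"
      using * by (auto simp: w_def u_def fun_eq_iff)
    moreover have "w f i = (\<lambda>x. \<Sum>l<d (edge_tail f). \<sigma> (TCoef f i l) * u (edge_tail f) l x)"
      using * by (auto simp: w_def u_def fun_eq_iff)
    moreover have "w f i \<in> supp_in (Gset Gr L (ECell (fst f) (snd f)))"
      using * by (auto simp: w_def supp_in_def)
    ultimately show "w f i \<in> edge_space L U f"
      unfolding edge_space_def using U_comb by (metis IntI)
  next
    fix s i assume "\<forall>x\<in>V. (\<Sum>i<c f. s i * w f i x) = 0" "i < c f"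
    then show "s i = 0" using assms(1) f unfolding fit_witness_def w_def by simp
  qed
  ultimately show ?thesis unfolding fits_def using adm by blast
qed

lemmas constructible_intros = constructible_conj constructible_imp constructible_ball constructible_all_less
  constructible_const constructible_eq constructible_not polyfn_const polyfn_var polyfn_sum polyfn_mult

text \<open>The scalars become the auxiliary variables \<open>Scal\<close>, and the universal
  quantifier is the negation of an existential one.\<close>

lemma constructible_independent:
  fixes A :: "'g var set"
  assumes ac: "alg_closed TYPE('f::field)"
    and A: "A \<inter> range Scal = {}" "\<And>i x. i < n \<Longrightarrow> x \<in> V \<Longrightarrow> EVec f i x \<in> A"
  shows "constructible A (\<lambda>\<rho> :: 'g var \<Rightarrow> 'f. \<forall>s. (\<forall>x\<in>V. (\<Sum>i<n. s i * \<rho> (EVec f i x)) = 0) \<longrightarrow> (\<forall>i<n. s i = 0))"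
proof -
  define P where "P = (\<lambda>\<rho> :: 'g var \<Rightarrow> 'f. (\<forall>x\<in>V. (\<Sum>i<n. \<rho> (Scal i) * \<rho> (EVec f i x)) = 0) \<longrightarrow> (\<forall>i<n. \<rho> (Scal i) = 0))"
  let ?S = "Scal ` {..<n} :: 'g var set"
  have "constructible (A \<union> ?S) (\<lambda>\<rho>. \<not> P \<rho>)"
    unfolding P_def using A(2) finite_carrier by (intro constructible_intros) auto
  then have "constructible A (\<lambda>\<rho>. \<exists>\<sigma>. \<not> P (\<lambda>v. if v \<in> ?S then \<sigma> v else \<rho> v))"
    using A(1) by (intro constructible_ex[OF ac]) auto
  then have "constructible A (\<lambda>\<rho>. \<not> (\<exists>\<sigma>. \<not> P (\<lambda>v. if v \<in> ?S then \<sigma> v else \<rho> v)))"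
    by (rule constructible_not)
  then show ?thesis
  proof (rule constructible_cong)
    fix \<rho> :: "'g var \<Rightarrow> 'f"
    let ?Q = "\<lambda>s. (\<forall>x\<in>V. (\<Sum>i<n. s i * \<rho> (EVec f i x)) = 0) \<longrightarrow> (\<forall>i<n. s i = 0)"
    have "P (\<lambda>v. if v \<in> ?S then \<sigma> v else \<rho> v) \<longleftrightarrow> ?Q (\<lambda>i. \<sigma> (Scal i))" for \<sigma>
      by (simp add: P_def image_iff)
    moreover have "(\<forall>\<sigma> :: 'g var \<Rightarrow> 'f. ?Q (\<lambda>i. \<sigma> (Scal i))) \<longleftrightarrow> (\<forall>s. ?Q s)"
    proof safe
      fix s i assume "\<forall>\<sigma> :: 'g var \<Rightarrow> 'f. ?Q (\<lambda>i. \<sigma> (Scal i))" "\<forall>x\<in>V. (\<Sum>i<n. s i * \<rho> (EVec f i x)) = 0" "i < n"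
      from this(1)[rule_format, of "\<lambda>z. case z of Scal i \<Rightarrow> s i | _ \<Rightarrow> 0"] this(2,3) show "s i = 0" by simp
    next
      fix \<sigma> i assume "\<forall>s. ?Q s" "\<forall>x\<in>V. (\<Sum>i<n. \<sigma> (Scal i) * \<rho> (EVec f i x)) = 0" "i < n"
      from this(1)[rule_format, of "\<lambda>i. \<sigma> (Scal i)"] this(2,3) show "\<sigma> (Scal i) = 0" by simp
    qed
    ultimately show "(\<not> (\<exists>\<sigma>. \<not> P (\<lambda>v. if v \<in> ?S then \<sigma> v else \<rho> v))) \<longleftrightarrow> (\<forall>s. ?Q s)"
      unfolding not_ex not_not by (simp only:)
  qed
qed

text \<open>The witness variables form a finite set disjoint from the entries; eliminating them
  leaves a condition on the matrix alone.\<close>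

lemma constructible_fits:
  assumes ac: "alg_closed TYPE('f::field)"
  shows "constructible (entries k) (\<lambda>\<rho> :: 'g var \<Rightarrow> 'f. fits L k d c (mat_of \<rho>))"
proof -
  define S where "S = (\<lambda>(v, i, x). VVec v i x) ` (SIGMA v:V. {..<d v} \<times> V) \<union> (\<lambda>(f, i, x). EVec f i x) ` (SIGMA f:E. {..<c f} \<times> V)
    \<union> (\<lambda>(f, i, l). HCoef f i l) ` (SIGMA f:E. {..<c f} \<times> {..<d (head f)})
    \<union> (\<lambda>(f, i, l). TCoef f i l) ` (SIGMA f:E. {..<c f} \<times> {..<d (edge_tail f)})"
  have finS: "finite S" unfolding S_def using finite_carrier finite_E by auto
  have S [simp]: "VVec v i x \<in> S \<longleftrightarrow> v \<in> V \<and> i < d v \<and> x \<in> V" "EVec f i x \<in> S \<longleftrightarrow> f \<in> E \<and> i < c f \<and> x \<in> V"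
    "HCoef f i l \<in> S \<longleftrightarrow> f \<in> E \<and> i < c f \<and> l < d (head f)" "TCoef f i l \<in> S \<longleftrightarrow> f \<in> E \<and> i < c f \<and> l < d (edge_tail f)"
    "Entry r x \<notin> S" "Scal i \<notin> S" for v i x f l r
    unfolding S_def image_iff Un_iff by (cases f; auto simp: Bex_def split_paired_Ex)+
  have disj: "entries k \<inter> S = {}" by (auto simp: entries_def)
  have "constructible (entries k \<union> S) (fit_witness L k d c :: ('g var \<Rightarrow> 'f) \<Rightarrow> bool)"
    unfolding fit_witness_def
    by (intro constructible_intros constructible_independent[OF ac] finite_carrier finite_E)
      (auto simp: head_closed tail_closed entries_def)
  then have "constructible (entries k) (\<lambda>\<rho> :: 'g var \<Rightarrow> 'f. \<exists>\<sigma>. fit_witness L k d c (\<lambda>v. if v \<in> S then \<sigma> v else \<rho> v))"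
    by (rule constructible_ex[OF ac finS disj])
  then show ?thesis
  proof (rule constructible_cong, safe)
    fix \<rho> :: "'g var \<Rightarrow> 'f" and \<sigma> assume "fit_witness L k d c (\<lambda>v. if v \<in> S then \<sigma> v else \<rho> v)"
    then show "fits L k d c (mat_of \<rho>)" by (rule fit_witness_imp_fits) simp
  next
    fix \<rho> :: "'g var \<Rightarrow> 'f" assume "fits L k d c (mat_of \<rho>)"
    then obtain \<sigma> where \<sigma>: "\<And>r x. \<sigma> (Entry r x) = \<rho> (Entry r x)" "fit_witness L k d c \<sigma>"
      using fits_imp_fit_witness by blast
    have "fit_witness L k d c (\<lambda>v. if v \<in> S then \<sigma> v else \<rho> v) \<longleftrightarrow> fit_witness L k d c \<sigma>"
      using \<sigma>(1) unfolding fit_witness_def by (simp add: head_closed tail_closed)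
    then have "fit_witness L k d c (\<lambda>v. if v \<in> S then \<sigma> v else \<rho> v)" using \<sigma>(2) by simp
    then show "\<exists>\<sigma>. fit_witness L k d c (\<lambda>v. if v \<in> S then \<sigma> v else \<rho> v)" by blast
  qed
qed

section \<open>Generic values of the maximum excess\<close>

lemma constructible_Kmax_excess_ge:
  assumes "alg_closed TYPE('f::field)"
  shows "constructible (entries k) (\<lambda>\<rho> :: 'g var \<Rightarrow> 'f. m \<le> Kmax_excess Gr g1 g2 k (mat_of \<rho>) L)"
  unfolding Kmax_excess_ge_iff_fits
  by (intro constructible_bex finite_dims constructible_conj constructible_const constructible_fits assms)

text \<open>The excess takes finitely many values. If each of them were avoided generically, some
  matrix would avoid them all.\<close>

lemma generic_value_exists:
  assumes ac: "alg_closed TYPE('f::field)"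
  shows "\<exists>m. generically (entries k) (\<lambda>\<rho> :: 'g var \<Rightarrow> 'f. Kmax_excess Gr g1 g2 k (mat_of \<rho>) L = m)"
proof (rule ccontr)
  note inf = alg_closed_infinite[OF ac]
  let ?e = "\<lambda>\<rho> :: 'g var \<Rightarrow> 'f. Kmax_excess Gr g1 g2 k (mat_of \<rho>) L"
  assume none: "\<nexists>m. generically (entries k) (\<lambda>\<rho>. ?e \<rho> = m)"
  have "generically (entries k) (\<lambda>\<rho>. ?e \<rho> \<noteq> m)" for m
  proof -
    have "constructible (entries k) (\<lambda>\<rho>. m \<le> ?e \<rho> \<and> \<not> m + 1 \<le> ?e \<rho>)"
      by (intro constructible_conj constructible_not constructible_Kmax_excess_ge[OF ac])
    then have "constructible (entries k) (\<lambda>\<rho>. ?e \<rho> = m)" by (rule constructible_cong) auto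
    then show ?thesis using generically_dichotomy[OF inf] none by blast
  qed
  then have "generically (entries k) (\<lambda>\<rho>. \<forall>m\<in>{0..int (card E * card V)}. ?e \<rho> \<noteq> m)"
    by (intro generically_ball[OF inf]) auto
  then obtain \<rho> where "\<forall>m\<in>{0..int (card E * card V)}. ?e \<rho> \<noteq> m" using generically_ex by blast
  then show False using Kmax_excess_nonneg Kmax_excess_le by (metis atLeastAtMost_iff)
qed

lemma Ksheaf_cong:
  assumes "\<And>i x. i < k \<Longrightarrow> x \<in> V \<Longrightarrow> M i x = N i x"
  shows "Ksheaf Gr k M L P = Ksheaf Gr k N L P"
  using assms unfolding Ksheaf_def by simp

lemma Kmax_excess_cong:
  assumes "\<And>i x. i < k \<Longrightarrow> x \<in> V \<Longrightarrow> M i x = N i x"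
  shows "Kmax_excess Gr g1 g2 k M L = Kmax_excess Gr g1 g2 k N L"
proof -
  have "Ksheaf Gr k M L = Ksheaf Gr k N L" by (intro ext Ksheaf_cong assms)
  then show ?thesis by (simp add: Kmax_excess_def)
qed

lemma fits_cong:
  assumes "\<And>i x. i < k \<Longrightarrow> x \<in> V \<Longrightarrow> M i x = N i x"
  shows "fits L k d c M \<longleftrightarrow> fits L k d c N"
  unfolding fits_def admissible_def using Ksheaf_cong[OF assms] by simp

section \<open>The action of right translations\<close>

lemma mult_inv_cancel: "h \<in> V \<Longrightarrow> x \<in> V \<Longrightarrow> h \<otimes> x \<otimes> inv x = h" "h \<in> V \<Longrightarrow> x \<in> V \<Longrightarrow> h \<otimes> inv x \<otimes> x = h"
  by (simp_all add: m_assoc)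

lemma Gset_VCell:
  assumes "fst L \<subseteq> V" "v \<in> V"
  shows "Gset Gr L (VCell v) = {x \<in> V. v \<otimes> inv x \<in> fst L}"
proof -
  have "v \<in> (\<lambda>g. g \<otimes> x) ` fst L \<longleftrightarrow> v \<otimes> inv x \<in> fst L" if x: "x \<in> V" for x
  proof
    assume "v \<in> (\<lambda>g. g \<otimes> x) ` fst L"
    then obtain h where h: "h \<in> fst L" "v = h \<otimes> x" by blast
    then have "v \<otimes> inv x = h" using mult_inv_cancel(1)[OF _ x, of h] assms(1) by blast
    then show "v \<otimes> inv x \<in> fst L" using h(1) by simp
  next
    assume "v \<otimes> inv x \<in> fst L"
    then show "v \<in> (\<lambda>g. g \<otimes> x) ` fst L"
      using mult_inv_cancel(2)[OF assms(2) x] by (metis imageI)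
  qed
  then show ?thesis by (auto simp: Gset_def cell_in_def translate_def)
qed

lemma Gset_ECell:
  assumes "snd L \<subseteq> E" "g \<in> V"
  shows "Gset Gr L (ECell g i) = {x \<in> V. (g \<otimes> inv x, i) \<in> snd L}"
proof -
  have V: "h \<in> V" if "(h, j) \<in> snd L" for h j using that assms(1) by (auto simp: cay_edges_def)
  have "(g, i) \<in> (\<lambda>(g, i). (g \<otimes> x, i)) ` snd L \<longleftrightarrow> (g \<otimes> inv x, i) \<in> snd L" if x: "x \<in> V" for x
  proof
    assume "(g, i) \<in> (\<lambda>(g, i). (g \<otimes> x, i)) ` snd L"
    then obtain h where h: "(h, i) \<in> snd L" "g = h \<otimes> x" by auto
    then have "g \<otimes> inv x = h" using mult_inv_cancel(1)[OF V[OF h(1)] x] by blast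
    then show "(g \<otimes> inv x, i) \<in> snd L" using h(1) by simp
  next
    assume h: "(g \<otimes> inv x, i) \<in> snd L"
    have "g = (g \<otimes> inv x) \<otimes> x" using assms(2) x by (simp add: m_assoc)
    then show "(g, i) \<in> (\<lambda>(g, i). (g \<otimes> x, i)) ` snd L"
      using h by (intro image_eqI[of _ _ "(g \<otimes> inv x, i)"]) simp_all
  qed
  note mem = this
  show ?thesis
    unfolding Gset_def cell_in_def translate_def by (intro Collect_cong) (simp add: mem cong: conj_cong)
qed

lemma Gset_translate:
  assumes "fst L \<subseteq> V" "snd L \<subseteq> E" "x \<in> V" "y \<in> V" "g \<in> V"
  shows "x \<otimes> y \<in> Gset Gr L (VCell (g \<otimes> y)) \<longleftrightarrow> x \<in> Gset Gr L (VCell g)"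
    "x \<otimes> y \<in> Gset Gr L (ECell (g \<otimes> y) i) \<longleftrightarrow> x \<in> Gset Gr L (ECell g i)"
proof -
  have "y \<otimes> (inv y \<otimes> inv x) = inv x" using assms(3,4) by (simp add: m_assoc[symmetric])
  then have "g \<otimes> y \<otimes> inv (x \<otimes> y) = g \<otimes> inv x"
    using assms(3-5) by (simp add: inv_mult_group m_assoc)
  then show "x \<otimes> y \<in> Gset Gr L (VCell (g \<otimes> y)) \<longleftrightarrow> x \<in> Gset Gr L (VCell g)"
    "x \<otimes> y \<in> Gset Gr L (ECell (g \<otimes> y) i) \<longleftrightarrow> x \<in> Gset Gr L (ECell g i)"
    using assms by (simp_all add: Gset_VCell Gset_ECell)
qed

text \<open>Reading a vector at \<open>x \<otimes> y\<close> instead of \<open>x\<close> carries the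
  subspace at \<open>v \<otimes> y\<close> to one at \<open>v\<close> of the same dimension and
  respects the index sets, provided the columns of the matrix are renamed in the same way.\<close>

lemma fits_translate:
  fixes M :: "nat \<Rightarrow> 'g \<Rightarrow> 'f::field"
  assumes L: "fst L \<subseteq> V" "snd L \<subseteq> E" and y: "y \<in> V" and fits: "fits L k d c M"
  shows "fits L k (\<lambda>v. d (v \<otimes> y)) (\<lambda>(g, i). c (g \<otimes> y, i)) (\<lambda>r x. M r (x \<otimes> y))"
proof -
  obtain U where U: "admissible k M L U" "\<And>v. v \<in> V \<Longrightarrow> fdim (U v) \<le> d v"
    "\<And>f. f \<in> E \<Longrightarrow> c f \<le> fdim (edge_space L U f)"
    using fits unfolding fits_def by blast
  \<comment> \<open>The product is unspecified outside the group, so \<open>T\<close> is set to zero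
    there.\<close>
  define T where "T = (\<lambda>a x. if x \<in> V then a (x \<otimes> y) else (0 :: 'f))"
  define U' where "U' = (\<lambda>v. T ` U (v \<otimes> y))"
  have T: "flinear T" by (auto simp: flinear_def T_def)
  have T0: "a = (\<lambda>x. 0)" if "T a = (\<lambda>x. 0)" "a \<in> supp_in V" for a
  proof
    fix x
    show "a x = 0"
    proof (cases "x \<in> V")
      case True
      have "T a (x \<otimes> inv y) = 0" using that(1) by simp
      then show ?thesis using True y by (simp add: T_def m_assoc)
    next
      case False
      then show ?thesis using that(2) by (simp add: supp_in_def)
    qed
  qed
  have dim: "fdim (T ` A) = fdim A" if "fsubspace A" "A \<subseteq> supp_in V" for A
    using that T0 by (intro fdim_image_inj[OF finite_carrier _ _ T]) blast+
  have "T a \<in> Ksheaf Gr k (\<lambda>r x. M r (x \<otimes> y)) L (VCell v)" if v: "v \<in> V" and a: "a \<in> U (v \<otimes> y)" for v a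
  proof -
    have "a \<in> Ksheaf Gr k M L (VCell (v \<otimes> y))" using U(1) v y a unfolding admissible_def by blast
    then have a: "\<And>x. x \<notin> Gset Gr L (VCell (v \<otimes> y)) \<Longrightarrow> a x = 0" "\<And>i. i < k \<Longrightarrow> (\<Sum>x\<in>V. a x * M i x) = 0"
      unfolding Ksheaf_def by blast+
    have "T a x = 0" if "x \<notin> Gset Gr L (VCell v)" for x
      using that a(1) Gset_translate(1)[OF L _ y v] by (auto simp: T_def)
    moreover have "(\<Sum>x\<in>V. T a x * M i (x \<otimes> y)) = 0" if "i < k" for i
      using a(2)[OF that] sum_translate[OF y, of "\<lambda>x. a x * M i x"] by (simp add: T_def)
    ultimately show ?thesis unfolding Ksheaf_def by blast
  qed
  then have adm: "admissible k (\<lambda>r x. M r (x \<otimes> y)) L U'"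
    unfolding admissible_def U'_def using admissible_subspace[OF U(1)] y by (auto intro!: fsubspace_image[OF T])
  have "fdim (U' v) \<le> d (v \<otimes> y)" if "v \<in> V" for v
    unfolding U'_def using that y U(2)[of "v \<otimes> y"] admissible_subspace[OF U(1)] admissible_supp[OF U(1)] by (subst dim) auto
  moreover have "c (g \<otimes> y, i) \<le> fdim (edge_space L U' (g, i))" if "(g, i) \<in> E" for g i
  proof -
    have g: "g \<in> V" "(g \<otimes> y, i) \<in> E" using that y by (auto simp: cay_edges_def)
    \<comment> \<open>Generators act on the left and translations on the right, so heads are
      translated together with their edges.\<close>
    have h: "head (g \<otimes> y, i) = head (g, i) \<otimes> y"
      using g gens_closed y by (auto simp: edge_head_def gen_def m_assoc)
    have "c (g \<otimes> y, i) \<le> fdim (edge_space L U (g \<otimes> y, i))" by (rule U(3)[OF g(2)])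
    also have "\<dots> = fdim (T ` edge_space L U (g \<otimes> y, i))"
      using admissible_subspace[OF U(1)] g(2) by (intro dim[symmetric] fsubspace_edge_space edge_space_supp)
    also have "T ` edge_space L U (g \<otimes> y, i) \<subseteq> edge_space L U' (g, i)"
    proof (intro image_subsetI)
      fix a assume a: "a \<in> edge_space L U (g \<otimes> y, i)"
      then have "\<And>x. x \<notin> Gset Gr L (ECell (g \<otimes> y) i) \<Longrightarrow> a x = 0" by (simp add: edge_space_def supp_in_def)
      then have "T a \<in> supp_in (Gset Gr L (ECell g i))"
        using Gset_translate(2)[OF L _ y g(1)] by (auto simp: T_def supp_in_def)
      then show "T a \<in> edge_space L U' (g, i)"
        using a unfolding edge_space_def U'_def by (auto simp: h edge_tail_def)
    qed
    then have "fdim (T ` edge_space L U (g \<otimes> y, i)) \<le> fdim (edge_space L U' (g, i))"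
      by (rule fdim_mono[OF finite_carrier edge_space_supp])
    finally show ?thesis .
  qed
  ultimately show ?thesis unfolding fits_def using adm by auto
qed

text \<open>If fitting is generic, it also holds generically for the matrix with columns shifted by
  the inverse of \<open>y\<close>, whose translate by \<open>y\<close> is the original matrix. If
  failing to fit is generic, the implication is vacuous.\<close>

lemma generically_fits_translate:
  assumes ac: "alg_closed TYPE('f::field)" and L: "fst L \<subseteq> V" "snd L \<subseteq> E" and y: "y \<in> V"
  shows "generically (entries k) (\<lambda>\<rho> :: 'g var \<Rightarrow> 'f. fits L k d c (mat_of \<rho>) \<longrightarrow>
    fits L k (\<lambda>v. d (v \<otimes> y)) (\<lambda>(g, i). c (g \<otimes> y, i)) (mat_of \<rho>))"
proof -
  let ?P = "\<lambda>\<rho> :: 'g var \<Rightarrow> 'f. fits L k d c (mat_of \<rho>)"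
  define \<sigma> where "\<sigma> = (\<lambda>z :: 'g var. case z of Entry r x \<Rightarrow> Entry r (x \<otimes> inv y) | _ \<Rightarrow> z)"
  have "generically (entries k) ?P \<or> generically (entries k) (\<lambda>\<rho>. \<not> ?P \<rho>)"
    by (rule generically_dichotomy[OF alg_closed_infinite[OF ac] constructible_fits[OF ac]])
  then show ?thesis
  proof
    assume gen: "generically (entries k) ?P"
    have "inj_on \<sigma> (entries k)" using y by (auto simp: entries_def \<sigma>_def intro!: inj_onI)
    moreover have "\<sigma> z \<in> entries k" if z: "z \<in> entries k" for z
    proof -
      obtain r x where "z = Entry r x" "r < k" "x \<in> V" using z by (auto simp: entries_def)
      then show ?thesis using y by (simp add: \<sigma>_def)
    qed
    ultimately have "generically (entries k) (\<lambda>\<rho>. ?P (\<rho> \<circ> \<sigma>))"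
      by (intro generically_subst[OF gen])
    then show ?thesis
    proof (rule generically_mono)
      fix \<rho> assume "?P (\<rho> \<circ> \<sigma>)"
      from fits_translate[OF L y this]
      have "fits L k (\<lambda>v. d (v \<otimes> y)) (\<lambda>(g, i). c (g \<otimes> y, i)) (\<lambda>r x. mat_of (\<rho> \<circ> \<sigma>) r (x \<otimes> y))" .
      moreover have "mat_of (\<rho> \<circ> \<sigma>) r (x \<otimes> y) = mat_of \<rho> r x" if "x \<in> V" for r x
        using that y by (simp add: mat_of_def \<sigma>_def m_assoc)
      ultimately show "?P \<rho> \<longrightarrow> fits L k (\<lambda>v. d (v \<otimes> y)) (\<lambda>(g, i). c (g \<otimes> y, i)) (mat_of \<rho>)"
        using fits_cong[of k "\<lambda>r x. mat_of (\<rho> \<circ> \<sigma>) r (x \<otimes> y)" "mat_of \<rho>"] by simp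
    qed
  next
    assume "generically (entries k) (\<lambda>\<rho>. \<not> ?P \<rho>)"
    then show ?thesis by (rule generically_mono) simp
  qed
qed

text \<open>Only finitely many dimension vectors and translations are involved, so a generic matrix
  satisfies all the implications at once.\<close>

lemma generically_card_dvd:
  assumes ac: "alg_closed TYPE('f::field)" and L: "fst L \<subseteq> V" "snd L \<subseteq> E"
  shows "generically (entries k) (\<lambda>\<rho> :: 'g var \<Rightarrow> 'f. int (card V) dvd Kmax_excess Gr g1 g2 k (mat_of \<rho>) L)"
proof -
  have "generically (entries k) (\<lambda>\<rho> :: 'g var \<Rightarrow> 'f. \<forall>d\<in>vdims. \<forall>c\<in>edims. \<forall>y\<in>V. fits L k d c (mat_of \<rho>) \<longrightarrow>
    fits L k (\<lambda>v. d (v \<otimes> y)) (\<lambda>(g, i). c (g \<otimes> y, i)) (mat_of \<rho>))"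
    by (intro generically_ball[OF alg_closed_infinite[OF ac]] finite_dims finite_carrier generically_fits_translate ac L)
  then show ?thesis by (rule generically_mono) (intro card_dvd_Kmax_excess, blast)
qed

section \<open>Invertible square submatrices and their consequences\<close>

definition cols_invertible :: "nat \<Rightarrow> (nat \<Rightarrow> 'g \<Rightarrow> 'f::field) \<Rightarrow> (nat \<Rightarrow> 'g) \<Rightarrow> bool" where
  "cols_invertible k M x \<longleftrightarrow> (\<exists>B. (\<forall>i<k. \<forall>j<k. (\<Sum>l<k. M i (x l) * B l j) = (if i = j then 1 else 0)) \<and>
    (\<forall>i<k. \<forall>j<k. (\<Sum>l<k. B i l * M l (x j)) = (if i = j then 1 else 0)))"

text \<open>Invertibility is the nonvanishing of a determinant, which is a polynomial function of
  the entries.\<close>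

lemma generically_cols_invertible:
  assumes x: "inj_on x {..<k}" "x ` {..<k} \<subseteq> V"
  shows "generically (entries k) (\<lambda>\<rho> :: 'g var \<Rightarrow> 'f::field. cols_invertible k (mat_of \<rho>) x)"
proof -
  define A where "A = (\<lambda>\<rho> :: 'g var \<Rightarrow> 'f. mat k k (\<lambda>(i, j). \<rho> (Entry i (x j))))"
  have carrier: "A \<rho> \<in> carrier_mat k k" for \<rho> by (simp add: A_def)
  have perm: "p i < k" if "p permutes {0..<k}" "i < k" for p i
    using permutes_in_image[OF that(1), of i] that(2) by simp
  have "polyfn (entries k) (\<lambda>\<rho>. \<Sum>p\<in>{p. p permutes {0..<k}}. signof p * (\<Prod>i = 0..<k. \<rho> (Entry i (x (p i)))))"
    using x(2) perm by (intro polyfn_sum polyfn_mult polyfn_const polyfn_prod polyfn_var) auto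
  also have "(\<lambda>\<rho>. \<Sum>p\<in>{p. p permutes {0..<k}}. signof p * (\<Prod>i = 0..<k. \<rho> (Entry i (x (p i))))) = (\<lambda>\<rho>. det (A \<rho>))"
    unfolding det_def'[OF carrier] by (intro ext sum.cong refl arg_cong2[of _ _ _ _ "(*)"] prod.cong)
      (auto simp: A_def perm)
  finally have poly: "polyfn (entries k) (\<lambda>\<rho>. det (A \<rho>))" .
  \<comment> \<open>At this assignment the chosen columns form the identity matrix, so the
    determinant is not identically zero.\<close>
  define \<rho>0 where "\<rho>0 = (\<lambda>z :: 'g var. case z of Entry i y \<Rightarrow> if y = x i then 1 else (0 :: 'f) | _ \<Rightarrow> 0)"
  have "A \<rho>0 = 1\<^sub>m k"
    using x(1) by (intro eq_matI) (auto simp: A_def \<rho>0_def inj_on_def)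
  then have "det (A \<rho>0) \<noteq> 0" by simp
  moreover have "cols_invertible k (mat_of \<rho>) x" if nz: "det (A \<rho>) \<noteq> 0" for \<rho>
  proof -
    obtain B where B: "B \<in> carrier_mat k k" "A \<rho> * B = 1\<^sub>m k" "B * A \<rho> = 1\<^sub>m k"
      using det_non_zero_imp_unit[OF carrier nz, of "()"] unfolding Units_def ring_mat_def by auto
    have "(\<Sum>l<k. mat_of \<rho> i (x l) * B $$ (l, j)) = (if i = j then 1 else 0)" if "i < k" "j < k" for i j
      using arg_cong[OF B(2), of "\<lambda>C. C $$ (i, j)"] that B(1) carrier[of \<rho>]
      by (simp add: scalar_prod_def A_def mat_of_def atLeast0LessThan)
    moreover have "(\<Sum>l<k. B $$ (i, l) * mat_of \<rho> l (x j)) = (if i = j then 1 else 0)" if "i < k" "j < k" for i j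
      using arg_cong[OF B(3), of "\<lambda>C. C $$ (i, j)"] that B(1) carrier[of \<rho>]
      by (simp add: scalar_prod_def A_def mat_of_def atLeast0LessThan)
    ultimately show ?thesis unfolding cols_invertible_def by (intro exI[of _ "\<lambda>i j. B $$ (i, j)"]) blast
  qed
  ultimately show ?thesis unfolding generically_def using poly by blast
qed

text \<open>The right inverse solves for the coefficients at the chosen columns; all others are set
  to zero.\<close>

lemma cols_invertible_surj:
  assumes inv: "cols_invertible k M x" and x: "inj_on x {..<k}" "x ` {..<k} \<subseteq> X" and X: "X \<subseteq> V"
  shows "\<exists>a. (\<forall>y. y \<notin> X \<longrightarrow> a y = 0) \<and> (\<forall>i<k. (\<Sum>y\<in>V. a y * M i y) = v i)"
proof -
  obtain B where B: "\<And>i j. i < k \<Longrightarrow> j < k \<Longrightarrow> (\<Sum>l<k. M i (x l) * B l j) = (if i = j then 1 else 0)"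
    using inv unfolding cols_invertible_def by blast
  define b where "b = (\<lambda>l. \<Sum>j<k. B l j * v j)"
  define a where "a = (\<lambda>y. if y \<in> x ` {..<k} then b (the_inv_into {..<k} x y) else 0)"
  have "(\<Sum>y\<in>V. a y * M i y) = v i" if i: "i < k" for i
  proof -
    have "(\<Sum>y\<in>V. a y * M i y) = (\<Sum>y\<in>x ` {..<k}. a y * M i y)"
      using x(2) X finite_carrier by (intro sum.mono_neutral_right) (auto simp: a_def)
    also have "\<dots> = (\<Sum>l<k. b l * M i (x l))"
      by (simp add: sum.reindex[OF x(1)] a_def the_inv_into_f_f[OF x(1)])
    also have "\<dots> = (\<Sum>l<k. \<Sum>j<k. M i (x l) * B l j * v j)"
      by (intro sum.cong refl) (simp add: b_def sum_distrib_left sum_distrib_right mult_ac)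
    also have "\<dots> = (\<Sum>j<k. (\<Sum>l<k. M i (x l) * B l j) * v j)"
      by (subst sum.swap) (simp add: sum_distrib_right)
    also have "\<dots> = (\<Sum>j<k. if i = j then v j else 0)"
      by (intro sum.cong refl) (simp add: B[OF i])
    also have "\<dots> = v i" using i by simp
    finally show ?thesis .
  qed
  moreover have "a y = 0" if "y \<notin> X" for y using that x(2) by (auto simp: a_def)
  ultimately show ?thesis by blast
qed

text \<open>The chosen columns exhaust \<open>X\<close>, so the left inverse recovers every
  coefficient from the vanishing combination.\<close>

lemma cols_invertible_inj:
  assumes inv: "cols_invertible k M x" and x: "inj_on x {..<k}" "x ` {..<k} = X" and X: "X \<subseteq> V"
    and a: "\<And>y. y \<notin> X \<Longrightarrow> a y = 0" "\<And>i. i < k \<Longrightarrow> (\<Sum>y\<in>V. a y * M i y) = 0"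
  shows "a = (\<lambda>y. 0)"
proof
  fix y
  obtain B where B: "\<And>i j. i < k \<Longrightarrow> j < k \<Longrightarrow> (\<Sum>l<k. B i l * M l (x j)) = (if i = j then 1 else 0)"
    using inv unfolding cols_invertible_def by blast
  show "a y = 0"
  proof (cases "y \<in> X")
    case True
    then obtain i where i: "i < k" "y = x i" using x(2) by blast
    have row: "(\<Sum>j<k. a (x j) * M l (x j)) = 0" if "l < k" for l
    proof -
      have "(\<Sum>j<k. a (x j) * M l (x j)) = (\<Sum>y\<in>X. a y * M l y)"
        unfolding x(2)[symmetric] by (simp add: sum.reindex[OF x(1)])
      also have "\<dots> = (\<Sum>y\<in>V. a y * M l y)"
        using X a(1) finite_carrier by (intro sum.mono_neutral_left) auto
      finally show ?thesis using a(2)[OF that] by simp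
    qed
    have "a (x i) = (\<Sum>j<k. if i = j then a (x j) else 0)" using i(1) by simp
    also have "\<dots> = (\<Sum>j<k. \<Sum>l<k. B i l * M l (x j) * a (x j))"
      by (intro sum.cong refl) (simp add: B[OF i(1)] sum_distrib_right[symmetric])
    also have "\<dots> = (\<Sum>l<k. B i l * (\<Sum>j<k. a (x j) * M l (x j)))"
      by (subst sum.swap) (simp add: sum_distrib_left mult_ac)
    also have "\<dots> = 0" by (simp add: row)
    finally show ?thesis using i(2) by simp
  qed (rule a(1))
qed

lemma finite_Gset: "finite (Gset Gr L P)"
  by (rule finite_subset[OF Gset_subset finite_carrier])

text \<open>For each of the finitely many cells, \<open>k\<close> columns from its index set are
  picked; their invertibility is generic.\<close>

lemma generically_L_surjective:
  assumes ac: "alg_closed TYPE('f::field)" and k: "\<And>P. P \<in> cay_cells Gr \<Longrightarrow> k \<le> card (Gset Gr L P)"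
  shows "generically (entries k) (\<lambda>\<rho> :: 'g var \<Rightarrow> 'f. L_surjective Gr k L (mat_of \<rho>))"
  unfolding L_surjective_def
proof (rule generically_ball[OF alg_closed_infinite[OF ac]])
  show "finite (cay_cells Gr)"
    unfolding cay_cells_def cay_verts_def using finite_carrier finite_E by simp
  fix P :: "'g cell" assume "P \<in> cay_cells Gr"
  from obtain_subset_with_card_n[OF k[OF this]]
  obtain X where X: "X \<subseteq> Gset Gr L P" "card X = k" "finite X" by blast
  obtain x where x: "bij_betw x {..<k} X"
    using ex_bij_betw_nat_finite[OF X(3)] X(2) by (auto simp: atLeast0LessThan)
  then have x: "inj_on x {..<k}" "x ` {..<k} \<subseteq> Gset Gr L P" using X(1) by (auto simp: bij_betw_def)
  have "generically (entries k) (\<lambda>\<rho> :: 'g var \<Rightarrow> 'f. cols_invertible k (mat_of \<rho>) x)"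
    using x Gset_subset by (intro generically_cols_invertible) blast+
  then show "generically (entries k) (\<lambda>\<rho> :: 'g var \<Rightarrow> 'f. \<forall>v. \<exists>a. (\<forall>x. x \<notin> Gset Gr L P \<longrightarrow> a x = 0) \<and>
      (\<forall>i<k. (\<Sum>x\<in>V. a x * mat_of \<rho> i x) = v i))"
    by (rule generically_mono) (intro allI cols_invertible_surj[OF _ x Gset_subset])
qed

text \<open>When the edge spaces of one label vanish, an edge of the other label contributes at most
  the dimension at its tail, and each vertex is the tail of exactly one such edge.\<close>

lemma excess_nonpos:
  assumes U: "admissible k M L U" and i: "i \<in> {1, 2}"
    and triv: "\<And>g. g \<in> V \<Longrightarrow> Ksheaf Gr k M L (ECell g i) \<subseteq> {\<lambda>x. 0}"
  shows "excess L U \<le> 0"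
proof -
  have zero: "fdim (edge_space L U (g, i)) = 0" if g: "g \<in> V" for g
  proof -
    have "(g, i) \<in> E" using g i by (auto simp: cay_edges_def)
    then have "U (edge_tail (g, i)) \<subseteq> Ksheaf Gr k M L (VCell (edge_tail (g, i)))"
      using U tail_closed unfolding admissible_def by blast
    then have "edge_space L U (g, i) \<subseteq> Ksheaf Gr k M L (ECell g i)"
      unfolding edge_space_def by (auto simp: Ksheaf_iff)
    then show ?thesis using triv[OF g] by (intro fdim_trivial) blast
  qed
  have le: "fdim (edge_space L U (g, j)) \<le> fdim (U g)" if "g \<in> V" for g j
    using admissible_supp[OF U that]
    by (intro fdim_mono[OF finite_carrier]) (auto simp: edge_space_def edge_tail_def)
  have "(\<Sum>g\<in>V. int (fdim (edge_space L U (g, i)))) = 0" using zero by simp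
  moreover have "(\<Sum>g\<in>V. int (fdim (edge_space L U (g, j)))) \<le> (\<Sum>v\<in>V. int (fdim (U v)))" for j
    by (intro sum_mono) (simp add: le)
  ultimately show ?thesis using i unfolding excess_def sum_E by fastforce
qed

text \<open>With as many rows as available columns, an edge stalk of label \<open>i\<close> is the
  kernel of a square matrix, which is generically invertible.\<close>

lemma generically_Kmax_excess_eq_0:
  assumes ac: "alg_closed TYPE('f::field)" and i: "i \<in> {1, 2}" and k: "\<And>g. g \<in> V \<Longrightarrow> card (Gset Gr L (ECell g i)) = k"
  shows "generically (entries k) (\<lambda>\<rho> :: 'g var \<Rightarrow> 'f. Kmax_excess Gr g1 g2 k (mat_of \<rho>) L = 0)"
proof -
  have "generically (entries k) (\<lambda>\<rho> :: 'g var \<Rightarrow> 'f. \<forall>g\<in>V. Ksheaf Gr k (mat_of \<rho>) L (ECell g i) \<subseteq> {\<lambda>x. 0})"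
  proof (rule generically_ball[OF alg_closed_infinite[OF ac] finite_carrier])
    fix g assume g: "g \<in> V"
    obtain x where "bij_betw x {..<k} (Gset Gr L (ECell g i))"
      using ex_bij_betw_nat_finite[OF finite_Gset[of L "ECell g i"]] k[OF g] by (auto simp: atLeast0LessThan)
    then have x: "inj_on x {..<k}" "x ` {..<k} = Gset Gr L (ECell g i)" by (auto simp: bij_betw_def)
    have "generically (entries k) (\<lambda>\<rho> :: 'g var \<Rightarrow> 'f. cols_invertible k (mat_of \<rho>) x)"
      using x Gset_subset by (intro generically_cols_invertible) blast+
    then show "generically (entries k) (\<lambda>\<rho> :: 'g var \<Rightarrow> 'f. Ksheaf Gr k (mat_of \<rho>) L (ECell g i) \<subseteq> {\<lambda>x. 0})"
      by (rule generically_mono) (auto simp: Ksheaf_def intro!: cols_invertible_inj[OF _ x Gset_subset])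
  qed
  then show ?thesis
  proof (rule generically_mono)
    fix \<rho> :: "'g var \<Rightarrow> 'f" assume "\<forall>g\<in>V. Ksheaf Gr k (mat_of \<rho>) L (ECell g i) \<subseteq> {\<lambda>x. 0}"
    then have "\<not> 1 \<le> Kmax_excess Gr g1 g2 k (mat_of \<rho>) L"
      unfolding Kmax_excess_ge_iff using excess_nonpos[OF _ i, of k "mat_of \<rho>" L] by fastforce
    then show "Kmax_excess Gr g1 g2 k (mat_of \<rho>) L = 0"
      using Kmax_excess_nonneg[of k "mat_of \<rho>" L] by simp
  qed
qed

section \<open>Generic values and Zariski density\<close>

lemma L_surjective_cong:
  assumes "\<And>i x. i < k \<Longrightarrow> x \<in> V \<Longrightarrow> M i x = N i x"
  shows "L_surjective Gr k L M \<longleftrightarrow> L_surjective Gr k L N"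
  using assms unfolding L_surjective_def by simp

definition env_of :: "(nat \<Rightarrow> 'g \<Rightarrow> 'f::zero) \<Rightarrow> 'g var \<Rightarrow> 'f" where
  "env_of M = (\<lambda>z. case z of Entry i x \<Rightarrow> M i x | _ \<Rightarrow> 0)"

text \<open>An assignment is arbitrary where matrices in \<open>mat_space\<close> must vanish;
  truncation enforces this without changing any variable in \<open>entries k\<close>.\<close>

definition truncate :: "nat \<Rightarrow> ('g var \<Rightarrow> 'f::zero) \<Rightarrow> nat \<Rightarrow> 'g \<Rightarrow> 'f" where
  "truncate k \<rho> = (\<lambda>i x. if i < k \<and> x \<in> V then \<rho> (Entry i x) else 0)"

lemma mat_of_env_of [simp]: "mat_of (env_of M) = M"
  by (simp add: mat_of_def env_of_def)

lemma truncate_mat_space: "truncate k \<rho> \<in> mat_space Gr k"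
  by (simp add: truncate_def mat_space_def)

lemma truncate_eq: "i < k \<Longrightarrow> x \<in> V \<Longrightarrow> truncate k \<rho> i x = mat_of \<rho> i x"
  by (simp add: truncate_def mat_of_def)

lemma env_of_truncate: "z \<in> entries k \<Longrightarrow> env_of (truncate k \<rho>) z = \<rho> z"
  by (auto simp: entries_def env_of_def truncate_def)

lemma polyfun_polyfn: "polyfun Gr k p \<Longrightarrow> polyfn (entries k) (\<lambda>\<rho>. p (mat_of \<rho>))"
  by (induction rule: polyfun.induct) (auto simp: mat_of_def intro: polyfn.intros)

lemma polyfn_polyfun: "polyfn (entries k) h \<Longrightarrow> polyfun Gr k (\<lambda>M. h (env_of M))"
  by (induction rule: polyfn.induct) (auto simp: entries_def env_of_def intro: polyfun.intros)

text \<open>Density for \<open>m\<close>: a polynomial that is not identically zero and the two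
  generic properties have a common point. Maximality: matrices with excess above \<open>m\<close>
  lie in the zero set of the polynomial \<open>h\<close>, which is not identically zero.\<close>

lemma generic_max_excess_eqI:
  assumes ac: "alg_closed TYPE('f::field)" and k: "\<And>P. P \<in> cay_cells Gr \<Longrightarrow> k \<le> card (Gset Gr L P)"
    and gen: "generically (entries k) (\<lambda>\<rho> :: 'g var \<Rightarrow> 'f. Kmax_excess Gr g1 g2 k (mat_of \<rho>) L = m)"
  shows "generic_max_excess Gr g1 g2 L TYPE('f) k = m"
  unfolding generic_max_excess_def
proof (rule Greatest_equality)
  let ?S = "\<lambda>m. {M :: nat \<Rightarrow> 'g \<Rightarrow> 'f. M \<in> mat_space Gr k \<and> L_surjective Gr k L M \<and> Kmax_excess Gr g1 g2 k M L \<ge> m}"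
  note inf = alg_closed_infinite[OF ac]
  show "zariski_dense Gr k (?S m)"
    unfolding zariski_dense_def
  proof (intro conjI allI impI ballI)
    fix p :: "(nat \<Rightarrow> 'g \<Rightarrow> 'f) \<Rightarrow> 'f" and M0 assume p: "polyfun Gr k p" "\<forall>M\<in>?S m. p M = 0"
    show "p M0 = 0"
    proof (rule ccontr)
      assume "p M0 \<noteq> 0"
      then have "generically (entries k) (\<lambda>\<rho>. p (mat_of \<rho>) \<noteq> 0)"
        unfolding generically_def using polyfun_polyfn[OF p(1)]
        by (intro exI[of _ "\<lambda>\<rho>. p (mat_of \<rho>)"]) (auto intro!: exI[of _ "env_of M0"])
      then have "generically (entries k) (\<lambda>\<rho>. p (mat_of \<rho>) \<noteq> 0 \<and> Kmax_excess Gr g1 g2 k (mat_of \<rho>) L = m \<and> L_surjective Gr k L (mat_of \<rho>))"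
        by (intro generically_conj inf gen generically_L_surjective[OF ac k])
      then obtain \<rho> where \<rho>: "p (mat_of \<rho>) \<noteq> 0" "Kmax_excess Gr g1 g2 k (mat_of \<rho>) L = m" "L_surjective Gr k L (mat_of \<rho>)"
        using generically_ex by blast
      let ?M = "truncate k \<rho>"
      have "Kmax_excess Gr g1 g2 k ?M L = m" "L_surjective Gr k L ?M"
        using \<rho>(2,3) Kmax_excess_cong[of k ?M "mat_of \<rho>" L, OF truncate_eq] L_surjective_cong[of k ?M "mat_of \<rho>" L, OF truncate_eq] by simp_all
      moreover have "p ?M = p (mat_of \<rho>)"
        using polyfn_cong[OF polyfun_polyfn[OF p(1)], of "env_of ?M" \<rho>] by (simp add: env_of_truncate)
      ultimately show False using p(2) \<rho>(1) truncate_mat_space[of k \<rho>] by simp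
    qed
  qed simp
next
  fix m' assume dense: "zariski_dense Gr k {M :: nat \<Rightarrow> 'g \<Rightarrow> 'f. M \<in> mat_space Gr k \<and> L_surjective Gr k L M \<and> Kmax_excess Gr g1 g2 k M L \<ge> m'}"
  obtain h \<rho>0 where h: "polyfn (entries k) h" "h \<rho>0 \<noteq> 0" "\<And>\<rho> :: 'g var \<Rightarrow> 'f. h \<rho> \<noteq> 0 \<Longrightarrow> Kmax_excess Gr g1 g2 k (mat_of \<rho>) L = m"
    using gen unfolding generically_def by blast
  show "m' \<le> m"
  proof (rule ccontr)
    assume "\<not> m' \<le> m"
    then have "h (env_of M) = 0" if "m' \<le> Kmax_excess Gr g1 g2 k M L" for M
      using h(3)[of "env_of M"] that by fastforce
    then have "h (env_of (truncate k \<rho>0)) = 0"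
      using dense polyfn_polyfun[OF h(1)] truncate_mat_space unfolding zariski_dense_def by blast
    moreover have "h (env_of (truncate k \<rho>0)) = h \<rho>0"
      by (rule polyfn_cong[OF h(1)]) (rule env_of_truncate)
    ultimately show False using h(2) by simp
  qed
qed

lemma generically_generic_max_excess:
  assumes ac: "alg_closed TYPE('f::field)" and k: "\<And>P. P \<in> cay_cells Gr \<Longrightarrow> k \<le> card (Gset Gr L P)"
  shows "generically (entries k) (\<lambda>\<rho> :: 'g var \<Rightarrow> 'f. Kmax_excess Gr g1 g2 k (mat_of \<rho>) L = generic_max_excess Gr g1 g2 L TYPE('f) k)"
proof -
  obtain m where m: "generically (entries k) (\<lambda>\<rho> :: 'g var \<Rightarrow> 'f. Kmax_excess Gr g1 g2 k (mat_of \<rho>) L = m)"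
    using generic_value_exists[OF ac] by blast
  then show ?thesis using generic_max_excess_eqI[OF ac k m] by simp
qed

section \<open>Sizes of index sets and the removal of an edge\<close>

lemma card_Gset_VCell:
  assumes "fst L \<subseteq> V" "v \<in> V"
  shows "card (Gset Gr L (VCell v)) = card (fst L)"
proof (rule bij_betw_same_card, rule bij_betw_byWitness[where f' = "\<lambda>h. inv h \<otimes> v"])
  show "\<forall>x\<in>Gset Gr L (VCell v). inv (v \<otimes> inv x) \<otimes> v = x"
    using assms by (auto simp: Gset_VCell inv_mult_group m_assoc)
  show "\<forall>h\<in>fst L. v \<otimes> inv (inv h \<otimes> v) = h"
    using assms by (auto simp: inv_mult_group m_assoc[symmetric] subset_eq)
  show "(\<lambda>x. v \<otimes> inv x) ` Gset Gr L (VCell v) \<subseteq> fst L"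
    using assms by (auto simp: Gset_VCell)
  show "(\<lambda>h. inv h \<otimes> v) ` fst L \<subseteq> Gset Gr L (VCell v)"
    using assms by (auto simp: Gset_VCell inv_mult_group m_assoc[symmetric] subset_eq)
qed

text \<open>Sending \<open>x\<close> to \<open>g \<otimes> inv x\<close> is a bijection, so the size
  depends only on the label and not on \<open>g\<close>.\<close>

lemma card_Gset_ECell:
  assumes "snd L \<subseteq> E" "g \<in> V"
  shows "card (Gset Gr L (ECell g i)) = card {h. (h, i) \<in> snd L}"
proof (rule bij_betw_same_card, rule bij_betw_byWitness[where f' = "\<lambda>h. inv h \<otimes> g"])
  have V: "h \<in> V" if "(h, j) \<in> snd L" for h j using that assms(1) by (auto simp: cay_edges_def)
  show "\<forall>x\<in>Gset Gr L (ECell g i). inv (g \<otimes> inv x) \<otimes> g = x"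
    using assms by (auto simp: Gset_ECell inv_mult_group m_assoc)
  show "\<forall>h\<in>{h. (h, i) \<in> snd L}. g \<otimes> inv (inv h \<otimes> g) = h"
    using assms V by (auto simp: inv_mult_group m_assoc[symmetric])
  show "(\<lambda>x. g \<otimes> inv x) ` Gset Gr L (ECell g i) \<subseteq> {h. (h, i) \<in> snd L}"
    using assms by (auto simp: Gset_ECell)
  show "(\<lambda>h. inv h \<otimes> g) ` {h. (h, i) \<in> snd L} \<subseteq> Gset Gr L (ECell g i)"
    using assms V by (auto simp: Gset_ECell inv_mult_group m_assoc[symmetric])
qed

text \<open>The removed edge is translated onto \<open>(g, i0)\<close> by exactly one group element,
  \<open>inv g0 \<otimes> g\<close>, and the coordinate at this element must now vanish.\<close>

lemma edge_space_remove:
  assumes sub: "EL \<subseteq> E" and e: "(g0, i0) \<in> EL" and f: "(g, i) \<in> E"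
  shows "edge_space (VL, EL - {(g0, i0)}) U (g, i) =
    (if i = i0 then {a \<in> edge_space (VL, EL) U (g, i). a (inv g0 \<otimes> g) = 0} else edge_space (VL, EL) U (g, i))"
proof -
  have g: "g0 \<in> V" "g \<in> V" using e f sub by (auto simp: cay_edges_def)
  have "g \<otimes> inv x = g0 \<longleftrightarrow> x = inv g0 \<otimes> g" if "x \<in> V" for x
  proof
    assume "g \<otimes> inv x = g0"
    then show "x = inv g0 \<otimes> g" using g that by (auto simp: inv_mult_group m_assoc)
  next
    assume "x = inv g0 \<otimes> g"
    then show "g \<otimes> inv x = g0" using g that by (simp add: inv_mult_group m_assoc[symmetric])
  qed
  then have "Gset Gr (VL, EL - {(g0, i0)}) (ECell g i) = Gset Gr (VL, EL) (ECell g i) - (if i = i0 then {inv g0 \<otimes> g} else {})"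
    using sub g by (subst (1 2) Gset_ECell) auto
  moreover have "inv g0 \<otimes> g \<in> Gset Gr (VL, EL) (ECell g i0)"
    using sub g e by (subst Gset_ECell) (auto simp: inv_mult_group m_assoc[symmetric])
  ultimately show ?thesis by (auto simp: edge_space_def supp_in_def)
qed

text \<open>The vertices are unchanged, so a maximizer for the larger graph stays admissible; its
  edge spaces of the label of \<open>e\<close> lose at most one dimension each, the others
  none.\<close>

lemma Kmax_excess_remove_edge:
  assumes sub: "VL \<subseteq> V" "EL \<subseteq> E" and e: "e \<in> EL"
  shows "Kmax_excess Gr g1 g2 k M (VL, EL) - int (card V) \<le> Kmax_excess Gr g1 g2 k M (VL, EL - {e})"
proof -
  let ?L = "(VL, EL)" and ?L' = "(VL, EL - {e})"
  obtain g0 i0 where e0: "e = (g0, i0)" by (cases e)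
  have i0: "i0 \<in> {1, 2}" using e sub by (auto simp: e0 cay_edges_def)
  obtain U where U: "admissible k M ?L U" "excess ?L U = Kmax_excess Gr g1 g2 k M ?L"
    using Kmax_excess_attained by blast
  have "Gset Gr ?L' (VCell v) = Gset Gr ?L (VCell v)" for v
    by (simp add: Gset_def cell_in_def translate_def)
  then have U': "admissible k M ?L' U" using U(1) by (simp add: admissible_def Ksheaf_def)
  have edge: "fdim (edge_space ?L U (g, i)) \<le> fdim (edge_space ?L' U (g, i)) + (if i = i0 then 1 else 0)" if f: "(g, i) \<in> E" for g i
    using fdim_hyperplane[OF finite_carrier edge_space_supp fsubspace_edge_space[OF _ f], of U ?L "inv g0 \<otimes> g"]
      admissible_subspace[OF U(1)] unfolding e0 edge_space_remove[OF sub(2) e[unfolded e0] f] by auto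
  have label: "(\<Sum>g\<in>V. int (fdim (edge_space ?L U (g, i)))) \<le> (\<Sum>g\<in>V. int (fdim (edge_space ?L' U (g, i)))) + (if i = i0 then int (card V) else 0)"
    if i: "i \<in> {1, 2}" for i
  proof -
    have "(\<Sum>g\<in>V. int (fdim (edge_space ?L U (g, i)))) \<le> (\<Sum>g\<in>V. int (fdim (edge_space ?L' U (g, i))) + (if i = i0 then 1 else 0))"
    proof (rule sum_mono)
      fix g assume "g \<in> V"
      then have "(g, i) \<in> E" using i by (auto simp: cay_edges_def)
      then show "int (fdim (edge_space ?L U (g, i))) \<le> int (fdim (edge_space ?L' U (g, i))) + (if i = i0 then 1 else 0)"
        using edge by fastforce
    qed
    then show ?thesis by (cases "i = i0") (simp_all add: sum.distrib)
  qed
  have "(if (1::nat) = i0 then int (card V) else 0) + (if 2 = i0 then int (card V) else 0) = int (card V)"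
    using i0 by auto
  then have "excess ?L U - int (card V) \<le> excess ?L' U"
    using label[of 1] label[of 2] unfolding excess_def sum_E by simp
  then show ?thesis using admissible_excess_le[OF U'] U(2) by simp
qed

lemma equiv_conn_rel: "equiv (fst L) (conn_rel Gr g1 g2 L)"
proof (rule equivI)
  have "sym (und_adj Gr g1 g2 L)" unfolding und_adj_def by (auto intro!: symI)
  then have "sym ((und_adj Gr g1 g2 L)\<^sup>*)" by (rule sym_rtrancl)
  then show "sym (conn_rel Gr g1 g2 L)" unfolding conn_rel_def sym_def by blast
  show "trans (conn_rel Gr g1 g2 L)" unfolding conn_rel_def by (rule transI) (auto intro: rtrancl_trans)
  show "refl_on (fst L) (conn_rel Gr g1 g2 L)" unfolding conn_rel_def refl_on_def by auto
qed (auto simp: conn_rel_def)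

text \<open>Each vertex is the tail of at most one edge of each label, so in a component the edges of one
  label are outnumbered by the vertices.\<close>

lemma rho_le:
  assumes sub: "VL \<subseteq> V" "EL \<subseteq> E" and i: "i \<in> {1, 2}"
  shows "rho Gr g1 g2 (VL, EL) \<le> int (card {h. (h, i) \<in> EL})"
proof -
  let ?Q = "VL // conn_rel Gr g1 g2 (VL, EL)"
  have eq: "equiv VL (conn_rel Gr g1 g2 (VL, EL))" using equiv_conn_rel[of "(VL, EL)"] by simp
  have finVL: "finite VL" using sub finite_carrier finite_subset by blast
  have Q_sub: "C \<subseteq> VL" if "C \<in> ?Q" for C using eq that by (metis Union_quotient Union_upper)
  have finQ: "finite ?Q" using Q_sub finVL by (intro finite_subset[of ?Q "Pow VL"]) auto
  have finC: "finite C" if "C \<in> ?Q" for C using Q_sub[OF that] finVL finite_subset by blast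
  have lab: "(h, j) \<in> EL \<Longrightarrow> j = i \<or> j = 3 - i" for h j using i sub by (auto simp: cay_edges_def)
  have finE: "finite {h. (h, i) \<in> EL}"
    using sub by (intro finite_subset[OF _ finite_carrier]) (auto simp: cay_edges_def)
  have comp: "max 0 (int (card {e \<in> EL. edge_tail e \<in> C}) - int (card C)) \<le> int (card {h \<in> C. (h, i) \<in> EL})"
    if C: "C \<in> ?Q" for C
  proof -
    have "{e \<in> EL. edge_tail e \<in> C} \<subseteq> (\<lambda>h. (h, i)) ` {h \<in> C. (h, i) \<in> EL} \<union> (\<lambda>h. (h, 3 - i)) ` C"
    proof
      fix f assume f: "f \<in> {e \<in> EL. edge_tail e \<in> C}"
      then consider "f = (fst f, i)" | "f = (fst f, 3 - i)" using lab[of "fst f" "snd f"] by (cases f) auto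
      then show "f \<in> (\<lambda>h. (h, i)) ` {h \<in> C. (h, i) \<in> EL} \<union> (\<lambda>h. (h, 3 - i)) ` C"
      proof cases
        case 1
        then have "fst f \<in> {h \<in> C. (h, i) \<in> EL}" using f by (simp add: edge_tail_def)
        then show ?thesis using 1 by blast
      next
        case 2
        then show ?thesis using f by (auto simp: edge_tail_def)
      qed
    qed
    then have "card {e \<in> EL. edge_tail e \<in> C} \<le> card ((\<lambda>h. (h, i)) ` {h \<in> C. (h, i) \<in> EL} \<union> (\<lambda>h. (h, 3 - i)) ` C)"
      using finC[OF C] by (intro card_mono) auto
    also have "\<dots> \<le> card ((\<lambda>h. (h, i)) ` {h \<in> C. (h, i) \<in> EL}) + card ((\<lambda>h. (h, 3 - i)) ` C)"
      by (rule card_Un_le)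
    also have "\<dots> \<le> card {h \<in> C. (h, i) \<in> EL} + card C"
      using finC[OF C] by (intro add_mono card_image_le) auto
    finally show ?thesis by simp
  qed
  have "rho Gr g1 g2 (VL, EL) \<le> (\<Sum>C\<in>?Q. int (card {h \<in> C. (h, i) \<in> EL}))"
    unfolding rho_def using comp by (auto intro!: sum_mono)
  also have "\<dots> = int (card (\<Union>C\<in>?Q. {h \<in> C. (h, i) \<in> EL}))"
  proof -
    have "\<forall>C\<in>?Q. finite {h \<in> C. (h, i) \<in> EL}" using finC by simp
    moreover have "\<forall>C\<in>?Q. \<forall>D\<in>?Q. C \<noteq> D \<longrightarrow> {h \<in> C. (h, i) \<in> EL} \<inter> {h \<in> D. (h, i) \<in> EL} = {}"
      using quotient_disj[OF eq] by blast
    ultimately show ?thesis by (subst card_UN_disjoint[OF finQ]) simp_all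
  qed
  also have "\<dots> \<le> int (card {h. (h, i) \<in> EL})"
    using finE by (intro of_nat_mono card_mono) auto
  finally show ?thesis .
qed

text \<open>At a vertex cell the size is the number of vertices of \<open>L\<close>, which is at
  least the number of edges of label 1 because these have distinct tails.\<close>

lemma card_le_Gset:
  assumes sub: "fst L \<subseteq> V" "snd L \<subseteq> E" and tails: "\<And>f. f \<in> snd L \<Longrightarrow> edge_tail f \<in> fst L"
    and k: "\<And>i. i \<in> {1, 2} \<Longrightarrow> k \<le> card {h. (h, i) \<in> snd L}" and P: "P \<in> cay_cells Gr"
  shows "k \<le> card (Gset Gr L P)"
proof -
  have "finite (fst L)" using sub(1) finite_carrier finite_subset by blast
  moreover have "{h. (h, 1) \<in> snd L} \<subseteq> fst L" using tails by (force simp: edge_tail_def)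
  ultimately have "card {h. (h, 1) \<in> snd L} \<le> card (fst L)" by (rule card_mono)
  then have "k \<le> card (fst L)" using k[OF insertI1] by simp
  then show ?thesis
    using P k sub by (auto simp: cay_cells_def cay_verts_def cay_edges_def card_Gset_VCell card_Gset_ECell)
qed

section \<open>Convexity in the number of rows and the resulting drop\<close>

lemma generic_max_excess_convex:
  assumes ac: "alg_closed TYPE('f::field)" and k: "\<And>P. P \<in> cay_cells Gr \<Longrightarrow> Suc (Suc j) \<le> card (Gset Gr L P)"
  shows "2 * generic_max_excess Gr g1 g2 L TYPE('f) (Suc j) \<le>
    generic_max_excess Gr g1 g2 L TYPE('f) j + generic_max_excess Gr g1 g2 L TYPE('f) (Suc (Suc j))"
proof -
  note inf = alg_closed_infinite[OF ac]
  let ?m = "generic_max_excess Gr g1 g2 L TYPE('f)" and ?e = "\<lambda>i (\<rho> :: 'g var \<Rightarrow> 'f). Kmax_excess Gr g1 g2 i (mat_of \<rho>) L"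
  let ?A = "entries (Suc (Suc j))"
  \<comment> \<open>\<sigma> exchanges rows \<open>j\<close> and \<open>Suc j\<close>. A generic
    matrix can be chosen so that it and its exchanged form both take the generic value on the first
    \<open>Suc j\<close> rows.\<close>
  define \<sigma> where "\<sigma> = (\<lambda>z :: 'g var. case z of Entry i x \<Rightarrow> Entry (if i = j then Suc j else if i = Suc j then j else i) x | _ \<Rightarrow> z)"
  have gen: "generically ?A (\<lambda>\<rho>. ?e i \<rho> = ?m i)" if "i \<le> Suc (Suc j)" for i
    using generically_superset[OF generically_generic_max_excess[OF ac] entries_mono[OF that]] k that le_trans by blast
  have "inj_on \<sigma> ?A" by (auto simp: entries_def \<sigma>_def intro!: inj_onI split: if_splits)
  moreover have "\<sigma> z \<in> ?A" if z: "z \<in> ?A" for z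
  proof -
    obtain r x where "z = Entry r x" "r < Suc (Suc j)" "x \<in> V" using z by (auto simp: entries_def)
    then show ?thesis by (auto simp: \<sigma>_def)
  qed
  ultimately have "generically ?A (\<lambda>\<rho>. ?e (Suc j) (\<rho> \<circ> \<sigma>) = ?m (Suc j))"
    by (intro generically_subst[OF gen]) auto
  then have "generically ?A (\<lambda>\<rho>. ?e (Suc j) (\<rho> \<circ> \<sigma>) = ?m (Suc j) \<and> ?e j \<rho> = ?m j \<and> ?e (Suc j) \<rho> = ?m (Suc j) \<and> ?e (Suc (Suc j)) \<rho> = ?m (Suc (Suc j)))"
    by (intro generically_conj inf gen) auto
  then obtain \<rho> where \<rho>: "?e (Suc j) (\<rho> \<circ> \<sigma>) = ?m (Suc j)" "?e j \<rho> = ?m j" "?e (Suc j) \<rho> = ?m (Suc j)" "?e (Suc (Suc j)) \<rho> = ?m (Suc (Suc j))"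
    using generically_ex by blast
  have "?e (Suc j) \<rho> + ?e (Suc j) (\<rho> \<circ> \<sigma>) \<le> ?e j \<rho> + ?e (Suc (Suc j)) \<rho>"
    by (rule Kmax_excess_convex) (auto simp: mat_of_def \<sigma>_def)
  then show ?thesis using \<rho> by simp
qed

text \<open>The value at \<open>n\<close> rows is zero, as the edge stalks of label \<open>i\<close>
  vanish there. A positive value must fall before that; convexity places a fall already at the step
  to \<open>k\<close>, and divisibility enlarges it to the group order.\<close>

lemma generic_max_excess_drop:
  assumes ac: "alg_closed TYPE('f::field)" and sub: "fst L \<subseteq> V" "snd L \<subseteq> E"
    and i: "i \<in> {1, 2}" and top: "card {h. (h, i) \<in> snd L} = n"
    and n: "\<And>P. P \<in> cay_cells Gr \<Longrightarrow> n \<le> card (Gset Gr L P)"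
    and k: "1 \<le> k" "k \<le> n" and pos: "0 < generic_max_excess Gr g1 g2 L TYPE('f) k"
  shows "generic_max_excess Gr g1 g2 L TYPE('f) k + int (card V) \<le> generic_max_excess Gr g1 g2 L TYPE('f) (k - 1)"
proof -
  note inf = alg_closed_infinite[OF ac]
  define m where "m = generic_max_excess Gr g1 g2 L TYPE('f)"
  have cells: "j \<le> card (Gset Gr L P)" if "j \<le> n" "P \<in> cay_cells Gr" for j P using n[OF that(2)] that(1) by simp
  have dvd: "int (card V) dvd m j" if "j \<le> n" for j
  proof -
    have "generically (entries j) (\<lambda>\<rho> :: 'g var \<Rightarrow> 'f. Kmax_excess Gr g1 g2 j (mat_of \<rho>) L = m j \<and>
        int (card V) dvd Kmax_excess Gr g1 g2 j (mat_of \<rho>) L)"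
      unfolding m_def
      by (intro generically_conj inf generically_generic_max_excess[OF ac] generically_card_dvd[OF ac sub] cells that)
    then show ?thesis using generically_ex by fastforce
  qed
  have "m n = 0"
    unfolding m_def using top sub i
    by (intro generic_max_excess_eqI[OF ac n] generically_Kmax_excess_eq_0[OF ac i]) (auto simp: card_Gset_ECell)
  have convex: "m j - m (Suc j) \<ge> m (Suc j) - m (Suc (Suc j))" if "Suc (Suc j) \<le> n" for j
    using generic_max_excess_convex[OF ac cells[OF that]] unfolding m_def by simp
  have "0 < m (k - 1) - m k"
  proof (rule ccontr)
    assume "\<not> 0 < m (k - 1) - m k"
    \<comment> \<open>Convexity carries a missing decrease at \<open>k\<close> to all later steps,
      so the value at \<open>n\<close> would still be at least the positive value at
      \<open>k\<close>.\<close>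
    then have "m (k - 1 + t) - m (k + t) \<le> 0 \<and> m k \<le> m (k + t)" if "k + t \<le> n" for t
      using that
    proof (induction t)
      case (Suc t)
      have "Suc (Suc (k - 1 + t)) = k + Suc t" "Suc (k - 1 + t) = k + t" using k(1) by auto
      then show ?case using convex[of "k - 1 + t"] Suc by simp
    qed simp
    from this[of "n - k"] show False using k(2) pos \<open>m n = 0\<close> unfolding m_def[symmetric] by simp
  qed
  moreover have "int (card V) dvd m (k - 1) - m k" using dvd k by (intro dvd_diff) auto
  ultimately have "int (card V) \<le> m (k - 1) - m k" by (intro zdvd_imp_le)
  then show ?thesis unfolding m_def by simp
qed

end

theorem theorem2:
  fixes Gr :: "('g, 'b) monoid_scheme" and g1 g2 :: 'g
    and VL :: "'g set" and EL :: "('g \<times> nat) set" and e :: "'g \<times> nat" and k :: nat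
  assumes "alg_closed TYPE('f::field)"
    and "group Gr" and "finite (carrier Gr)"
    and "g1 \<in> carrier Gr" and "g2 \<in> carrier Gr"
    and "is_subgraph Gr g1 g2 (VL, EL)"
    and "1 \<le> k" and "int k \<le> rho Gr g1 g2 (VL, EL)"
    and "e \<in> EL"
  shows "generic_max_excess Gr g1 g2 (VL, EL - {e}) TYPE('f) (k - 1)
           \<ge> generic_max_excess Gr g1 g2 (VL, EL) TYPE('f) k"
proof -
  interpret cayley_bigraph Gr g1 g2
    using assms(2-5) by (intro cayley_bigraph.intro cayley_bigraph_axioms.intro)
  note ac = assms(1) note inf = alg_closed_infinite[OF ac]
  let ?L = "(VL, EL)" and ?L' = "(VL, EL - {e})"
  let ?m = "generic_max_excess Gr g1 g2 ?L TYPE('f)" and ?m' = "generic_max_excess Gr g1 g2 ?L' TYPE('f)"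
  have sub: "VL \<subseteq> V" "EL \<subseteq> E" and tails: "\<And>f. f \<in> EL \<Longrightarrow> edge_tail f \<in> VL"
    using assms(6) by (auto simp: is_subgraph_def cay_verts_def)
  define N where "N = (\<lambda>i. card {h. (h, i) \<in> EL})"
  have fin: "finite {h. (h, i) \<in> EL}" for i
    using sub by (intro finite_subset[OF _ finite_carrier]) (auto simp: cay_edges_def)
  have kN: "k \<le> N i" if "i \<in> {1, 2}" for i
    using rho_le[OF sub that] assms(8) unfolding N_def by linarith
  \<comment> \<open>The label with fewer edges: its count is the number of rows at which the excess
    vanishes, and it exceeds the size of no index set.\<close>
  define i where "i = (if N 1 \<le> N 2 then 1 else 2::nat)"
  have i: "i \<in> {1, 2}" "\<And>j. j \<in> {1, 2} \<Longrightarrow> N i \<le> N j" by (auto simp: i_def)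
  have cells: "N i \<le> card (Gset Gr ?L P)" if "P \<in> cay_cells Gr" for P
    using i(2) sub tails that by (intro card_le_Gset) (auto simp: N_def)
  \<comment> \<open>Removing one edge lowers the count of each label by at most one, which is
    absorbed by passing to \<open>k - 1\<close>.\<close>
  have cells': "k - 1 \<le> card (Gset Gr ?L' P)" if P: "P \<in> cay_cells Gr" for P
  proof (rule card_le_Gset[OF _ _ _ _ P])
    fix j assume j: "j \<in> {1, 2::nat}"
    have "{h. (h, j) \<in> EL} \<subseteq> insert (fst e) {h. (h, j) \<in> EL - {e}}" by auto
    then have "N j \<le> card (insert (fst e) {h. (h, j) \<in> EL - {e}})"
      unfolding N_def using fin[of j] by (intro card_mono) (auto intro: finite_subset)
    also have "\<dots> \<le> Suc (card {h. (h, j) \<in> EL - {e}})" by (rule card_insert_le_m1) auto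
    finally show "k - 1 \<le> card {h. (h, j) \<in> snd ?L'}" using kN[OF j] by simp
  qed (use sub tails in auto)
  have gen': "generically (entries (k - 1)) (\<lambda>\<rho> :: 'g var \<Rightarrow> 'f. Kmax_excess Gr g1 g2 (k - 1) (mat_of \<rho>) ?L' = ?m' (k - 1))"
    by (rule generically_generic_max_excess[OF ac cells'])
  show ?thesis
  \<comment> \<open>For a positive value at \<open>k\<close>, the gain from dropping a row covers
    the cost of the edge; otherwise nonnegativity of the excess suffices.\<close>
  proof (cases "0 < ?m k")
    case True
    have "k - 1 \<le> card (Gset Gr ?L P)" if "P \<in> cay_cells Gr" for P
      using cells[OF that] kN[OF i(1)] by simp
    \<comment> \<open>The two graphs are compared at one matrix that is generic for both.\<close>
    then have "generically (entries (k - 1)) (\<lambda>\<rho> :: 'g var \<Rightarrow> 'f. Kmax_excess Gr g1 g2 (k - 1) (mat_of \<rho>) ?L' = ?m' (k - 1) \<and>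
        Kmax_excess Gr g1 g2 (k - 1) (mat_of \<rho>) ?L = ?m (k - 1))"
      by (intro generically_conj inf gen' generically_generic_max_excess[OF ac])
    from generically_ex[OF this] obtain \<rho> :: "'g var \<Rightarrow> 'f" where "Kmax_excess Gr g1 g2 (k - 1) (mat_of \<rho>) ?L' = ?m' (k - 1)"
        "Kmax_excess Gr g1 g2 (k - 1) (mat_of \<rho>) ?L = ?m (k - 1)"
      by blast
    then have "?m (k - 1) - int (card V) \<le> ?m' (k - 1)"
      using Kmax_excess_remove_edge[OF sub assms(9), of "k - 1" "mat_of \<rho>"] by simp
    moreover have "?m k + int (card V) \<le> ?m (k - 1)"
      using sub kN[OF i(1)] True
      by (intro generic_max_excess_drop[OF ac _ _ i(1) _ cells assms(7)]) (auto simp: N_def)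
    ultimately show ?thesis by simp
  next
    case False
    obtain \<rho> :: "'g var \<Rightarrow> 'f" where "Kmax_excess Gr g1 g2 (k - 1) (mat_of \<rho>) ?L' = ?m' (k - 1)"
      using generically_ex[OF gen'] by blast
    then have "0 \<le> ?m' (k - 1)" using Kmax_excess_nonneg[of "k - 1" "mat_of \<rho>" ?L'] by simp
    then show ?thesis using False by simp
  qed
qed

end
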